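(* Let $f : A \to B$ be a DG ring homomorphism, let $u : \tilde{A} \to A$ and $v : \tilde{B} \to B$ be semi-free resolutions, and let $\{\tilde{f}_i\}_{i \in I}$ be the collection of all liftings $\tilde{f}_i : \tilde{A} \to \tilde{B}$ of $f$ with respect to $u$ and $v$. Then: \begin{enumerate} \item For every $i, j \in I$ there is a distinguished isomorphism $[\tilde{g}_{i,j}] : \tilde{f}_i \to \tilde{f}_j$ in the groupoid $\operatorname{SHom}_{\leq 1}(\tilde{A}, \tilde{B})$. \item The collection of distinguished isomorphisms $\{[\tilde{g}_{i,j}]\}_{i,j \in I}$ satisfies $[\tilde{g}_{j,k}] \cdot [\tilde{g}_{i,j}] = [\tilde{g}_{i,k}]$ for all $i,j,k \in I$, and $[\tilde{g}_{i,i}] = \operatorname{id}_{\tilde{f}_i}$. \end{enumerate}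
   Context: A DG ring is a graded ring $A = \bigoplus_{i \in \mathbb{Z}} A^i$ (associative, unital) with a differential $\mathrm{d}$ of degree $1$ satisfying $\mathrm{d} \circ \mathrm{d} = 0$ and $\mathrm{d}(a b) = \mathrm{d}(a) b + (-1)^i a\, \mathrm{d}(b)$ for $a \in A^i$. DG ring homomorphisms are unital, degree $0$, and commute with differentials; $\mathsf{DGRng}$ is the category of DG rings. Semi-free: a filtered graded set $(X,F)$ is a graded set $X = \coprod_{i \in \mathbb{Z}} X^i$ with an ascending filtration $\{F_j(X)\}_{j \geq -1}$ by graded subsets, such that $F_{-1}(X) = \varnothing$ and $X = \bigcup_j F_j(X)$. Let $\mathbb{Z}\langle X \rangle$ be the noncommutative graded polynomial ring on $X$, filtered by $F_j(\mathbb{Z}\langle X\rangle) := \mathbb{Z}\langle F_j(X)\rangle$ for $j \geq 0$ and $F_{-1}(\mathbb{Z}\langle X \rangle) := 0$. A DG ring $\tilde{A}$ is (noncommutative) semi-free if there are a filtered graded set $(X,F)$ and an isomorphism of graded rings $\tilde{A} \cong \mathbb{Z}\langle X\rangle$ (forgetting differentials) under which $\mathrm{d}(F_j(X)) \subseteq F_{j-1}(\mathbb{Z}\langle X\rangle)$ for all $j \geq 0$. A semi-free resolution of a DG ring $A$ is a surjective quasi-isomorphism of DG rings $u : \tilde{A} \to A$ with $\tilde{A}$ semi-free. Given $f : A \to B$ and semi-free resolutions $u : \tilde{A} \to A$, $v : \tilde{B} \to B$, a lifting of $f$ with respect to $u$ and $v$ is a DG ring homomorphism $\tilde{f} : \tilde{A}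 \to \tilde{B}$ with $v \circ \tilde{f} = f \circ u$. The DG rings $\operatorname{N}(X,B)$: for a simplicial set $X$, with face maps $\partial_i$, let $\operatorname{N}^p(X,\mathbb{Z})$ be the group of functions $\phi : X_p \to \mathbb{Z}$ vanishing on degenerate simplices, and $\operatorname{N}(X,\mathbb{Z}) := \bigoplus_{p \geq 0} \operatorname{N}^p(X,\mathbb{Z})$. It is a DG ring with differential $(\mathrm{d}\phi)(x) = \sum_{i=0}^{p+1} (-1)^i \phi(\partial_i x)$ for $\phi\in \operatorname{N}^p$, and Alexander-Whitney multiplication $(\phi * \psi)(x) = \phi(\partial_{>p}(x)) \cdot \psi(\partial_{<p}(x))$ for $\phi \in \operatorname{N}^p$, $\psi \in \operatorname{N}^q$, $x \in X_{p+q}$, where $\partial_{>p}(x) \in X_p$ is the front face of $x$ (induced by $[p] \to [p+q]$, $i \mapsto i$) and $\partial_{<p}(x) \in X_q$ is the back face (induced by $[q] \to [p+q]$, $i \mapsto p+i$). For a DG ring $B$ set $\operatorname{N}(X,B) := \operatorname{N}(X,\mathbb{Z}) \otimes_{\mathbb{Z}} B$, the tensor product of DG rings with the usual Koszul signs. This is contravariantly functorial in $X$ and covariantly functorial in $B$. Cylinders: $\operatorname{Cyl}_q(B) := \operatorname{N}(\Delta^q, B)$, where $\Delta^q$ is the standard $q$-simplex; the cosimplicial structure of $\{\Delta^q\}_{q}$ makes $\{\operatorname{Cyl}_q(B)\}_{q \in \mathbb{N}}$ a simplicial DG ring. $\operatorname{SHom}(A,B)$ is the simplicial set with $\operatorname{SHom}_q(A,B)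 := \operatorname{Hom}_{\mathsf{DGRng}}(A, \operatorname{Cyl}_q(B))$. When $\tilde{A}$ is semi-free, the simplicial set $S := \operatorname{SHom}(\tilde{A},B)$ is a Kan complex, and $\operatorname{SHom}_{\leq 1}(\tilde{A},B)$ denotes its fundamental groupoid $\pi_{\leq 1}(S)$. Explicitly: the objects are the elements of $S_0$, i.e. the DG ring homomorphisms $f : \tilde{A} \to B$; the morphisms $f_0 \to f_1$ are the classes $[g]$ of elements $g \in S_1$ with $\partial_1(g) = f_0$, $\partial_0(g) = f_1$, where $[g] = [g']$ iff there is $h \in S_2$ with $\partial_0(h) = \operatorname{s}_0(f_1)$, $\partial_1(h) = g'$, $\partial_2(h) = g$; the composition satisfies $[g_{02}] = [g_{12}] \cdot [g_{01}]$ iff there is $h \in S_2$ with $\partial_0(h) = g_{12}$, $\partial_1(h) = g_{02}$, $\partial_2(h) = g_{01}$; the identity of $f$ is $[\operatorname{s}_0(f)]$. Meaning of "distinguished": $v$ induces a functor $\operatorname{SHom}_{\leq 1}(\tilde{A}, \tilde{B}) \to \operatorname{SHom}_{\leq 1}(\tilde{A}, B)$ sending every lifting $\tilde{f}_i$ to $f \circ u$. The distinguished isomorphism $[\tilde{g}_{i,j}] : \tilde{f}_i \to \tilde{f}_j$ is the unique isomorphism $\tilde{f}_i \to \tilde{f}_j$ in $\operatorname{SHom}_{\leq 1}(\tilde{A}, \tilde{B})$ that this functor sends to the identity of $f \circ u$; item (1) asserts that it exists (and is unique). *)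

theory Defs
  imports
    "HOL-Algebra.Free_Abelian_Groups"
    "HOL-Algebra.Generated_Groups"
    "HOL-Algebra.QuotRing"
begin

section \<open>DG rings\<close>

record 'a gr_ring = "'a ring" +
  grade :: "int \<Rightarrow> 'a set"

record 'a dg_ring = "'a gr_ring" +
  dif :: "'a \<Rightarrow> 'a"

definition sign :: "int \<Rightarrow> int"
  where "sign i = (if even i then 1 else - 1)"

text \<open>\<open>c i\<close> is the component of degree \<open>i\<close> of the element \<open>a\<close>.\<close>

definition decomposition :: "('a, 'm) gr_ring_scheme \<Rightarrow> 'a \<Rightarrow> (int \<Rightarrow> 'a) \<Rightarrow> bool"
  where "decomposition A a c \<longleftrightarrow>
    (\<forall>i. c i \<in> grade A i) \<and> finite {i. c i \<noteq> \<zero>\<^bsub>A\<^esub>} \<and>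
    a = finsum A c {i. c i \<noteq> \<zero>\<^bsub>A\<^esub>}"

definition hcomp :: "('a, 'm) gr_ring_scheme \<Rightarrow> 'a \<Rightarrow> int \<Rightarrow> 'a"
  where "hcomp A a = (THE c. decomposition A a c)"

definition hsupp :: "('a, 'm) gr_ring_scheme \<Rightarrow> 'a \<Rightarrow> int set"
  where "hsupp A a = {i. hcomp A a i \<noteq> \<zero>\<^bsub>A\<^esub>}"

locale dg_ring = ring A for A :: "'a dg_ring" (structure) +
  assumes grade_subgroup: "additive_subgroup (grade A i) A"
    and grade_direct_sum: "a \<in> carrier A \<Longrightarrow> \<exists>!c. decomposition A a c"
    and grade_one: "\<one> \<in> grade A 0"
    and grade_mult: "\<lbrakk>a \<in> grade A i; b \<in> grade A j\<rbrakk> \<Longrightarrow> a \<otimes> b \<in> grade A (i + j)"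
    and dif_add: "\<lbrakk>a \<in> carrier A; b \<in> carrier A\<rbrakk> \<Longrightarrow> dif A (a \<oplus> b) = dif A a \<oplus> dif A b"
    and dif_grade: "a \<in> grade A i \<Longrightarrow> dif A a \<in> grade A (i + 1)"
    and dif_dif: "a \<in> carrier A \<Longrightarrow> dif A (dif A a) = \<zero>"
    and dif_mult: "\<lbrakk>a \<in> grade A i; b \<in> carrier A\<rbrakk> \<Longrightarrow>
      dif A (a \<otimes> b) = (dif A a \<otimes> b) \<oplus> [sign i] \<cdot> (a \<otimes> dif A b)"

text \<open>Homomorphisms are taken \<open>extensional\<close> on the carrier, so that equality of
  HOL functions is equality of homomorphisms.\<close>

definition dg_hom :: "'a dg_ring \<Rightarrow> 'b dg_ring \<Rightarrow> ('a \<Rightarrow> 'b) set"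
  where "dg_hom A B = {h \<in> ring_hom A B \<inter> extensional (carrier A).
    (\<forall>i. h ` grade A i \<subseteq> grade B i) \<and> (\<forall>a \<in> carrier A. h (dif A a) = dif B (h a))}"

definition cohomology :: "'a dg_ring \<Rightarrow> int \<Rightarrow> 'a set monoid"
  where "cohomology A i =
    (add_monoid A)\<lparr>carrier := {a \<in> grade A i. dif A a = \<zero>\<^bsub>A\<^esub>}\<rparr> Mod (dif A ` grade A (i - 1))"

text \<open>Here and below, a map on a quotient is given by the union of the classes of the images of
  all representatives; when it is well defined this union is a single class.\<close>

definition cohomology_map :: "'b dg_ring \<Rightarrow> int \<Rightarrow> ('a \<Rightarrow> 'b) \<Rightarrow> 'a set \<Rightarrow> 'b set"
  where "cohomology_map B i h c = (\<Union>z\<in>c. (dif B ` grade B (i - 1)) #>\<^bsub>add_monoid B\<^esub> h z)"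

definition quasi_iso :: "'a dg_ring \<Rightarrow> 'b dg_ring \<Rightarrow> ('a \<Rightarrow> 'b) \<Rightarrow> bool"
  where "quasi_iso A B h \<longleftrightarrow> h \<in> dg_hom A B \<and>
    (\<forall>i. cohomology_map B i h \<in> iso (cohomology A i) (cohomology B i))"


section \<open>Semi-free DG rings\<close>

text \<open>The noncommutative polynomial ring on the set \<open>X\<close>, graded by \<open>deg\<close>: the free abelian group
  on the words in \<open>X\<close>, multiplied by concatenation.\<close>

definition free_ring :: "'x set \<Rightarrow> ('x \<Rightarrow> int) \<Rightarrow> ('x list \<Rightarrow>\<^sub>0 int) gr_ring"
  where "free_ring X deg =
    \<lparr>carrier = carrier (free_Abelian_group (lists X)),
     monoid.mult = (\<lambda>p q. frag_extend (\<lambda>v. frag_extend (\<lambda>w. frag_of (v @ w)) q) p),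
     one = frag_of [],
     zero = 0,
     add = (+),
     grade = (\<lambda>i. {p \<in> carrier (free_Abelian_group (lists X)).
       \<forall>w \<in> Poly_Mapping.keys p. sum_list (map deg w) = i})\<rparr>"

text \<open>A filtered graded set is a set \<open>X\<close> with a degree function \<open>deg\<close>, so that
  \<open>X\<^sup>i = {x \<in> X. deg x = i}\<close>, and a filtration \<open>F\<close>, of which only the indices \<open>j \<ge> -1\<close> matter.
  Every subset of \<open>X\<close> is a graded subset, so \<open>deg\<close> does not enter the condition.\<close>

definition set_filtration :: "'x set \<Rightarrow> (int \<Rightarrow> 'x set) \<Rightarrow> bool"
  where "set_filtration X F \<longleftrightarrow>
    F (- 1) = {} \<and> (\<forall>j\<ge>-1. F j \<subseteq> F (j + 1)) \<and> X = (\<Union>j\<in>{-1..}. F j)"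

definition free_ring_filtration ::
    "(int \<Rightarrow> 'x set) \<Rightarrow> ('x \<Rightarrow> int) \<Rightarrow> int \<Rightarrow> ('x list \<Rightarrow>\<^sub>0 int) set"
  where "free_ring_filtration F deg j = (if j < 0 then {0} else carrier (free_ring (F j) deg))"

text \<open>The generators are taken in the type of the elements of \<open>A\<close>. This loses no generality, since
  the isomorphism embeds the set of generators into the carrier of \<open>A\<close>.\<close>

definition semi_free :: "'a dg_ring \<Rightarrow> bool"
  where "semi_free A \<longleftrightarrow> dg_ring A \<and>
    (\<exists>(X :: 'a set) deg F \<phi>. set_filtration X F \<and>
      \<phi> \<in> ring_iso (free_ring X deg) A \<and>
      (\<forall>i. \<phi> ` grade (free_ring X deg) i = grade A i) \<and>
      (\<forall>j\<ge>0. \<forall>x \<in> F j. dif A (\<phi> (frag_of [x])) \<in> \<phi> ` free_ring_filtration F deg (j - 1)))"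

definition semi_free_resolution :: "'a dg_ring \<Rightarrow> 'b dg_ring \<Rightarrow> ('a \<Rightarrow> 'b) \<Rightarrow> bool"
  where "semi_free_resolution A' A u \<longleftrightarrow>
    semi_free A' \<and> quasi_iso A' A u \<and> u ` carrier A' = carrier A"

definition liftings ::
    "'c dg_ring \<Rightarrow> 'd dg_ring \<Rightarrow> ('c \<Rightarrow> 'a) \<Rightarrow> ('d \<Rightarrow> 'b) \<Rightarrow> ('a \<Rightarrow> 'b) \<Rightarrow> ('c \<Rightarrow> 'd) set"
  where "liftings A' B' u v f =
    {f' \<in> dg_hom A' B'. compose (carrier A') v f' = compose (carrier A') f u}"


section \<open>Tensor products over the integers\<close>

definition tensor_free :: "'a dg_ring \<Rightarrow> 'b dg_ring \<Rightarrow> ('a \<times> 'b \<Rightarrow>\<^sub>0 int) monoid"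
  where "tensor_free A B = free_Abelian_group (carrier A \<times> carrier B)"

definition tensor_rels :: "'a dg_ring \<Rightarrow> 'b dg_ring \<Rightarrow> ('a \<times> 'b \<Rightarrow>\<^sub>0 int) set"
  where "tensor_rels A B = generate (tensor_free A B)
    ({frag_of (a \<oplus>\<^bsub>A\<^esub> a', b) - frag_of (a, b) - frag_of (a', b) | a a' b.
        a \<in> carrier A \<and> a' \<in> carrier A \<and> b \<in> carrier B} \<union>
     {frag_of (a, b \<oplus>\<^bsub>B\<^esub> b') - frag_of (a, b) - frag_of (a, b') | a b b'.
        a \<in> carrier A \<and> b \<in> carrier B \<and> b' \<in> carrier B})"

definition tensor_group :: "'a dg_ring \<Rightarrow> 'b dg_ring \<Rightarrow> ('a \<times> 'b \<Rightarrow>\<^sub>0 int) set monoid"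
  where "tensor_group A B = tensor_free A B Mod tensor_rels A B"

definition tensor_class ::
    "'a dg_ring \<Rightarrow> 'b dg_ring \<Rightarrow> ('a \<times> 'b \<Rightarrow>\<^sub>0 int) \<Rightarrow> ('a \<times> 'b \<Rightarrow>\<^sub>0 int) set"
  where "tensor_class A B x = tensor_rels A B #>\<^bsub>tensor_free A B\<^esub> x"

definition pure_tensor :: "'a dg_ring \<Rightarrow> 'b dg_ring \<Rightarrow> 'a \<Rightarrow> 'b \<Rightarrow> ('a \<times> 'b \<Rightarrow>\<^sub>0 int) set"
  where "pure_tensor A B a b = tensor_class A B (frag_of (a, b))"

text \<open>For homogeneous \<open>b\<close> and \<open>a'\<close> the product of \<open>a \<otimes> b\<close> and \<open>a' \<otimes> b'\<close> is
  \<open>(-1) ^ (|b| |a'|) (a a' \<otimes> b b')\<close>, and for homogeneous \<open>a\<close> the differential of \<open>a \<otimes> b\<close> is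
  \<open>d a \<otimes> b + (-1) ^ |a| (a \<otimes> d b)\<close>; the sums below run over the homogeneous components.\<close>

definition tensor_mult_gen ::
    "'a dg_ring \<Rightarrow> 'b dg_ring \<Rightarrow> 'a \<times> 'b \<Rightarrow> 'a \<times> 'b \<Rightarrow> ('a \<times> 'b \<Rightarrow>\<^sub>0 int)"
  where "tensor_mult_gen A B = (\<lambda>(a, b) (a', b').
    \<Sum>i \<in> hsupp B b. \<Sum>j \<in> hsupp A a'.
      frag_cmul (sign (i * j)) (frag_of (a \<otimes>\<^bsub>A\<^esub> hcomp A a' j, hcomp B b i \<otimes>\<^bsub>B\<^esub> b')))"

definition tensor_dif_gen :: "'a dg_ring \<Rightarrow> 'b dg_ring \<Rightarrow> 'a \<times> 'b \<Rightarrow> ('a \<times> 'b \<Rightarrow>\<^sub>0 int)"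
  where "tensor_dif_gen A B = (\<lambda>(a, b).
    frag_of (dif A a, b) +
    (\<Sum>i \<in> hsupp A a. frag_cmul (sign i) (frag_of (hcomp A a i, dif B b))))"

definition tensor :: "'a dg_ring \<Rightarrow> 'b dg_ring \<Rightarrow> ('a \<times> 'b \<Rightarrow>\<^sub>0 int) set dg_ring"
  where "tensor A B =
    \<lparr>carrier = carrier (tensor_group A B),
     monoid.mult = (\<lambda>s t. \<Union>x\<in>s. \<Union>y\<in>t. tensor_class A B
       (frag_extend (\<lambda>p. frag_extend (\<lambda>q. tensor_mult_gen A B p q) y) x)),
     one = pure_tensor A B \<one>\<^bsub>A\<^esub> \<one>\<^bsub>B\<^esub>,
     zero = \<one>\<^bsub>tensor_group A B\<^esub>,
     add = monoid.mult (tensor_group A B),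
     grade = (\<lambda>n. generate (tensor_group A B)
       {pure_tensor A B a b | a b. \<exists>i. a \<in> grade A i \<and> b \<in> grade B (n - i)}),
     dif = (\<lambda>s. \<Union>x\<in>s. tensor_class A B (frag_extend (tensor_dif_gen A B) x))\<rparr>"

text \<open>The homomorphism \<open>\<alpha> \<otimes> \<beta>\<close> into \<open>tensor A B\<close>.\<close>

definition tensor_map ::
    "'a dg_ring \<Rightarrow> 'b dg_ring \<Rightarrow> ('a' \<Rightarrow> 'a) \<Rightarrow> ('b' \<Rightarrow> 'b) \<Rightarrow>
     ('a' \<times> 'b' \<Rightarrow>\<^sub>0 int) set \<Rightarrow> ('a \<times> 'b \<Rightarrow>\<^sub>0 int) set"
  where "tensor_map A B \<alpha> \<beta> s =
    (\<Union>x\<in>s. tensor_class A B (frag_extend (\<lambda>(a, b). frag_of (\<alpha> a, \<beta> b)) x))"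


section \<open>Simplicial sets\<close>

text \<open>\<open>simplices X n\<close> is the set of \<open>n\<close>-simplices, and \<open>act X m n \<theta>\<close> is the map from \<open>n\<close>-simplices to
  \<open>m\<close>-simplices induced by a monotone \<open>\<theta> : [m] \<rightarrow> [n]\<close>; only the values of \<open>\<theta>\<close> on \<open>{0..m}\<close> matter.\<close>

record 'x sset =
  simplices :: "nat \<Rightarrow> 'x set"
  act :: "nat \<Rightarrow> nat \<Rightarrow> (nat \<Rightarrow> nat) \<Rightarrow> 'x \<Rightarrow> 'x"

text \<open>\<open>face X n i\<close> is \<open>\<partial>\<^sub>i\<close> on \<open>n\<close>-simplices, for \<open>n \<ge> 1\<close> and \<open>i \<le> n\<close>;
  \<open>degen X n i\<close> is \<open>s\<^sub>i\<close> on \<open>n\<close>-simplices, for \<open>i \<le> n\<close>.\<close>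

definition face :: "'x sset \<Rightarrow> nat \<Rightarrow> nat \<Rightarrow> 'x \<Rightarrow> 'x"
  where "face X n i = act X (n - 1) n (\<lambda>k. if k < i then k else k + 1)"

definition degen :: "'x sset \<Rightarrow> nat \<Rightarrow> nat \<Rightarrow> 'x \<Rightarrow> 'x"
  where "degen X n i = act X (n + 1) n (\<lambda>k. if k \<le> i then k else k - 1)"

definition degenerate :: "'x sset \<Rightarrow> nat \<Rightarrow> 'x set"
  where "degenerate X n = {degen X m i y | m i y. n = m + 1 \<and> i \<le> m \<and> y \<in> simplices X m}"

text \<open>A \<open>p\<close>-simplex of \<open>\<Delta>\<^sup>q\<close> is a monotone map \<open>[p] \<rightarrow> [q]\<close>, extensional on \<open>{0..p}\<close>.\<close>

definition std_simplex :: "nat \<Rightarrow> (nat \<Rightarrow> nat) sset"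
  where "std_simplex q =
    \<lparr>simplices = (\<lambda>p. {x \<in> {0..p} \<rightarrow>\<^sub>E {0..q}. mono_on {0..p} x}),
     act = (\<lambda>m n \<theta> x. compose {0..m} x \<theta>)\<rparr>"

text \<open>The map \<open>\<Delta>\<^sup>m \<rightarrow> \<Delta>\<^sup>n\<close> induced by a monotone \<open>\<theta> : [m] \<rightarrow> [n]\<close>, on \<open>p\<close>-simplices.\<close>

definition std_simplex_map :: "(nat \<Rightarrow> nat) \<Rightarrow> nat \<Rightarrow> (nat \<Rightarrow> nat) \<Rightarrow> (nat \<Rightarrow> nat)"
  where "std_simplex_map \<theta> p x = compose {0..p} \<theta> x"


section \<open>Normalized cochains\<close>

text \<open>An element of \<open>N(X, \<int>)\<close> is a family \<open>\<phi>\<close> with \<open>\<phi> p\<close> in \<open>N\<^sup>p(X, \<int>)\<close>, almost all zero. Each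
  \<open>\<phi> p\<close> is extended by zero outside the \<open>p\<close>-simplices.\<close>

definition cochains :: "'x sset \<Rightarrow> (nat \<Rightarrow> 'x \<Rightarrow> int) set"
  where "cochains X = {\<phi>. (\<forall>p x. x \<notin> simplices X p \<or> x \<in> degenerate X p \<longrightarrow> \<phi> p x = 0) \<and>
    finite {p. \<phi> p \<noteq> (\<lambda>_. 0)}}"

definition cochain_ring :: "'x sset \<Rightarrow> (nat \<Rightarrow> 'x \<Rightarrow> int) dg_ring"
  where "cochain_ring X =
    \<lparr>carrier = cochains X,
     monoid.mult = (\<lambda>\<phi> \<psi> n x. if x \<in> simplices X n
       then \<Sum>p\<le>n. \<phi> p (act X p n (\<lambda>i. i) x) * \<psi> (n - p) (act X (n - p) n (\<lambda>i. p + i) x)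
       else 0),
     one = (\<lambda>p x. if p = 0 \<and> x \<in> simplices X 0 then 1 else 0),
     zero = (\<lambda>p x. 0),
     add = (\<lambda>\<phi> \<psi> p x. \<phi> p x + \<psi> p x),
     grade = (\<lambda>i. {\<phi> \<in> cochains X. \<forall>p. int p \<noteq> i \<longrightarrow> \<phi> p = (\<lambda>_. 0)}),
     dif = (\<lambda>\<phi> n x. if n \<ge> 1 \<and> x \<in> simplices X n
       then \<Sum>i\<le>n. (- 1) ^ i * \<phi> (n - 1) (face X n i x)
       else 0)\<rparr>"

text \<open>The homomorphism \<open>N(Y, \<int>) \<rightarrow> N(X, \<int>)\<close> induced by a simplicial map \<open>h : X \<rightarrow> Y\<close>.\<close>

definition cochain_map ::
    "'x sset \<Rightarrow> (nat \<Rightarrow> 'x \<Rightarrow> 'y) \<Rightarrow> (nat \<Rightarrow> 'y \<Rightarrow> int) \<Rightarrow> (nat \<Rightarrow> 'x \<Rightarrow> int)"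
  where "cochain_map X h \<phi> = (\<lambda>p x. if x \<in> simplices X p then \<phi> p (h p x) else 0)"

definition N_ring :: "'x sset \<Rightarrow> 'b dg_ring \<Rightarrow> ((nat \<Rightarrow> 'x \<Rightarrow> int) \<times> 'b \<Rightarrow>\<^sub>0 int) set dg_ring"
  where "N_ring X B = tensor (cochain_ring X) B"


section \<open>Cylinders and the simplicial set of homomorphisms\<close>

type_synonym 'b cyl = "((nat \<Rightarrow> (nat \<Rightarrow> nat) \<Rightarrow> int) \<times> 'b \<Rightarrow>\<^sub>0 int) set"

definition Cyl :: "nat \<Rightarrow> 'b dg_ring \<Rightarrow> 'b cyl dg_ring"
  where "Cyl q B = N_ring (std_simplex q) B"

text \<open>The map \<open>Cyl n B \<rightarrow> Cyl m B\<close> induced by a monotone \<open>\<theta> : [m] \<rightarrow> [n]\<close>.\<close>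

definition Cyl_act :: "'b dg_ring \<Rightarrow> nat \<Rightarrow> (nat \<Rightarrow> nat) \<Rightarrow> 'b cyl \<Rightarrow> 'b cyl"
  where "Cyl_act B m \<theta> = tensor_map (cochain_ring (std_simplex m)) B
    (cochain_map (std_simplex m) (std_simplex_map \<theta>)) (\<lambda>b. b)"

text \<open>The map \<open>Cyl q B' \<rightarrow> Cyl q B\<close> induced by a homomorphism \<open>v : B' \<rightarrow> B\<close>.\<close>

definition Cyl_map :: "'b dg_ring \<Rightarrow> ('d \<Rightarrow> 'b) \<Rightarrow> nat \<Rightarrow> 'd cyl \<Rightarrow> 'b cyl"
  where "Cyl_map B v q = tensor_map (cochain_ring (std_simplex q)) B (\<lambda>\<phi>. \<phi>) v"

definition SHom :: "'a dg_ring \<Rightarrow> 'b dg_ring \<Rightarrow> ('a \<Rightarrow> 'b cyl) sset"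
  where "SHom A B =
    \<lparr>simplices = (\<lambda>q. dg_hom A (Cyl q B)),
     act = (\<lambda>m n \<theta> g. compose (carrier A) (Cyl_act B m \<theta>) g)\<rparr>"

text \<open>The simplicial map \<open>SHom A B' \<rightarrow> SHom A B\<close> induced by \<open>v : B' \<rightarrow> B\<close>.\<close>

definition SHom_map ::
    "'a dg_ring \<Rightarrow> 'b dg_ring \<Rightarrow> ('d \<Rightarrow> 'b) \<Rightarrow> nat \<Rightarrow> ('a \<Rightarrow> 'd cyl) \<Rightarrow> ('a \<Rightarrow> 'b cyl)"
  where "SHom_map A B v q g = compose (carrier A) (Cyl_map B v q) g"

text \<open>The vertex of \<open>SHom A B\<close> given by a homomorphism \<open>f : A \<rightarrow> B\<close>, through the
  canonical isomorphism \<open>B \<cong> Cyl 0 B\<close>, \<open>b \<mapsto> 1 \<otimes> b\<close>.\<close>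

definition SHom_obj :: "'a dg_ring \<Rightarrow> 'b dg_ring \<Rightarrow> ('a \<Rightarrow> 'b) \<Rightarrow> ('a \<Rightarrow> 'b cyl)"
  where "SHom_obj A B f = compose (carrier A)
    (pure_tensor (cochain_ring (std_simplex 0)) B \<one>\<^bsub>cochain_ring (std_simplex 0)\<^esub>) f"


section \<open>The fundamental groupoid of a Kan complex\<close>

text \<open>The definitions below make sense as they stand for every simplicial set; for a Kan complex
  they describe its fundamental groupoid. Objects are the vertices.\<close>

definition paths :: "'x sset \<Rightarrow> 'x \<Rightarrow> 'x \<Rightarrow> 'x set"
  where "paths S x y = {g \<in> simplices S 1. face S 1 1 g = x \<and> face S 1 0 g = y}"

definition path_rel :: "'x sset \<Rightarrow> 'x \<Rightarrow> 'x \<Rightarrow> ('x \<times> 'x) set"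
  where "path_rel S x y = {(g, g'). g \<in> paths S x y \<and> g' \<in> paths S x y \<and>
    (\<exists>h \<in> simplices S 2. face S 2 0 h = degen S 0 0 y \<and> face S 2 1 h = g' \<and> face S 2 2 h = g)}"

definition pi_hom :: "'x sset \<Rightarrow> 'x \<Rightarrow> 'x \<Rightarrow> 'x set set"
  where "pi_hom S x y = paths S x y // path_rel S x y"

definition pi_id :: "'x sset \<Rightarrow> 'x \<Rightarrow> 'x set"
  where "pi_id S x = path_rel S x x `` {degen S 0 0 x}"

text \<open>The composite \<open>\<delta> \<cdot> \<gamma>\<close>, as the set of its representatives.\<close>

definition pi_comp :: "'x sset \<Rightarrow> 'x set \<Rightarrow> 'x set \<Rightarrow> 'x set"
  where "pi_comp S \<delta> \<gamma> = {g. \<exists>h \<in> simplices S 2.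
    face S 2 0 h \<in> \<delta> \<and> face S 2 1 h = g \<and> face S 2 2 h \<in> \<gamma>}"

definition pi_iso :: "'x sset \<Rightarrow> 'x \<Rightarrow> 'x \<Rightarrow> 'x set \<Rightarrow> bool"
  where "pi_iso S x y \<gamma> \<longleftrightarrow> \<gamma> \<in> pi_hom S x y \<and>
    (\<exists>\<delta> \<in> pi_hom S y x. pi_comp S \<delta> \<gamma> = pi_id S x \<and> pi_comp S \<gamma> \<delta> = pi_id S y)"

text \<open>The action on morphisms \<open>\<gamma> : x \<rightarrow> y\<close> of the functor induced by a simplicial map \<open>h\<close> into \<open>T\<close>.\<close>

definition pi_map :: "'y sset \<Rightarrow> (nat \<Rightarrow> 'x \<Rightarrow> 'y) \<Rightarrow> 'x \<Rightarrow> 'x \<Rightarrow> 'x set \<Rightarrow> 'y set"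
  where "pi_map T h x y \<gamma> = (\<Union>g\<in>\<gamma>. path_rel T (h 0 x) (h 0 y) `` {h 1 g})"


section \<open>Distinguished isomorphisms\<close>

definition distinguished ::
    "'c dg_ring \<Rightarrow> 'd dg_ring \<Rightarrow> 'b dg_ring \<Rightarrow> ('c \<Rightarrow> 'a) \<Rightarrow> ('d \<Rightarrow> 'b) \<Rightarrow> ('a \<Rightarrow> 'b) \<Rightarrow>
     ('c \<Rightarrow> 'd) \<Rightarrow> ('c \<Rightarrow> 'd) \<Rightarrow> ('c \<Rightarrow> 'd cyl) set \<Rightarrow> bool"
  where "distinguished A' B' B u v f f0 f1 \<gamma> \<longleftrightarrow>
    pi_iso (SHom A' B') (SHom_obj A' B' f0) (SHom_obj A' B' f1) \<gamma> \<and>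
    pi_map (SHom A' B) (SHom_map A' B v) (SHom_obj A' B' f0) (SHom_obj A' B' f1) \<gamma>
      = pi_id (SHom A' B) (SHom_obj A' B (compose (carrier A') f u))"

definition distinguished_iso ::
    "'c dg_ring \<Rightarrow> 'd dg_ring \<Rightarrow> 'b dg_ring \<Rightarrow> ('c \<Rightarrow> 'a) \<Rightarrow> ('d \<Rightarrow> 'b) \<Rightarrow> ('a \<Rightarrow> 'b) \<Rightarrow>
     ('c \<Rightarrow> 'd) \<Rightarrow> ('c \<Rightarrow> 'd) \<Rightarrow> ('c \<Rightarrow> 'd cyl) set"
  where "distinguished_iso A' B' B u v f f0 f1 =
    (THE \<gamma>. distinguished A' B' B u v f f0 f1 \<gamma>)"

end

theory Submission
  imports Defs
begin

text \<open>Since \<open>v\<close> is a surjective quasi-isomorphism and \<open>A'\<close> is semi-free, the simplicial map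
  \<open>v\<^sub>* : SHom A' B' \<rightarrow> SHom A' B\<close> has the right lifting property against boundary inclusions; only
  the dimensions 1 and 2 are needed. Lifting an edge shows that any two liftings of \<open>f\<close> are joined
  by a path over the constant path at \<open>f \<circ> u\<close>, and lifting triangles shows that two parallel paths
  over homotopic paths are homotopic. Hence, for liftings \<open>x\<close> and \<open>y\<close>, the paths from \<open>x\<close> to \<open>y\<close> over
  a null-homotopic loop form a single class, which is the distinguished isomorphism, and these classes
  compose. In the base, one only needs to fill horns of type \<open>\<Lambda>\<^sup>3\<^sub>1\<close>, so that homotopy of paths
  is an equivalence relation and null-homotopic loops are closed under composition.

  Both the lifting property and the filling of horns are instances of one statement: a sub-DG-ring
  of \<open>A' \<times> C\<close> that projects onto \<open>A'\<close> with acyclic kernel contains the graph of a homomorphism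
  \<open>A' \<rightarrow> C\<close>, which is constructed generator by generator along the filtration. For the cylinders the
  acyclicity of the kernel is visible after identifying tensors with \<open>B\<close>-valued cochains.\<close>

section \<open>DG rings and their homomorphisms\<close>

text \<open>Paths are homomorphisms into the noncommutative ring \<open>Cyl 1 B'\<close>, not chain
  homotopies, so they have to be constructed multiplicatively. This is why edges, triangles and horn
  fillers are all obtained as sections over a semi-free ring, with one obstruction argument. The
  kernels that occur are small. An element of \<open>Cyl n B'\<close> with vanishing faces lives on
  the top simplex, so the kernel is the kernel of \<open>v\<close> shifted by \<open>n\<close>,
  which is acyclic because \<open>v\<close> is a surjective quasi-isomorphism. For the horn the
  kernel lives on two simplices, the top one and the missing face. The differential takes the dual
  cochain of the second to minus that of the first, so the kernel is the cone of an identity,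
  acyclic for every \<open>B\<close>. Most of the labour lies in reaching this description: a tensor
  is a coset in a free abelian group, and its value at a simplex exists only through the universal
  property. Since a standard simplex has finitely many nondegenerate simplices, an element of a
  cylinder is determined by its values there, and these values can be prescribed freely.\<close>

locale pregraded_ring = ring A for A :: "('a, 'm) gr_ring_scheme" (structure) +
  assumes grade_additive_subgroup: "additive_subgroup (grade A i) A"
begin

lemma grade_carrier: "a \<in> grade A i \<Longrightarrow> a \<in> carrier A"
  using additive_subgroup.a_subset[OF grade_additive_subgroup] by blast

lemma zero_grade: "\<zero> \<in> grade A i"
  using additive_subgroup.zero_closed[OF grade_additive_subgroup] .

lemma add_grade: "a \<in> grade A i \<Longrightarrow> b \<in> grade A i \<Longrightarrow> a \<oplus> b \<in> grade A i"
  using additive_subgroup.a_closed[OF grade_additive_subgroup] .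

lemma uminus_grade: "a \<in> grade A i \<Longrightarrow> \<ominus> a \<in> grade A i"
  using additive_subgroup.a_inv_closed[OF grade_additive_subgroup] .

lemma minus_grade: "a \<in> grade A i \<Longrightarrow> b \<in> grade A i \<Longrightarrow> a \<ominus> b \<in> grade A i"
  unfolding a_minus_def by (intro add_grade uminus_grade)

lemma finsum_grade: "finite S \<Longrightarrow> (\<And>s. s \<in> S \<Longrightarrow> c s \<in> grade A i) \<Longrightarrow> finsum A c S \<in> grade A i"
proof (induction S rule: finite_induct)
  case (insert s S)
  then have "finsum A c (insert s S) = c s \<oplus> finsum A c S"
    by (intro finsum_insert) (auto intro: grade_carrier)
  then show ?case using insert by (auto intro: add_grade)
qed (simp add: zero_grade)

lemma finsum_support:
  assumes "finite S" "{i. c i \<noteq> \<zero>} \<subseteq> S" "\<And>i. c i \<in> carrier A"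
  shows "finsum A c {i. c i \<noteq> \<zero>} = finsum A c S"
  using assms by (intro add.finprod_mono_neutral_cong_left) auto

text \<open>\<open>decomposition\<close> sums over the exact support, which is unstable under
  addition. Any finite set containing the support serves as well, and decompositions are produced in
  this form.\<close>

lemma decompositionI:
  assumes "finite S" "\<And>i. c i \<in> grade A i" "\<And>i. i \<notin> S \<Longrightarrow> c i = \<zero>" "a = finsum A c S"
  shows "decomposition A a c"
proof -
  have sub: "{i. c i \<noteq> \<zero>} \<subseteq> S" using assms(3) by blast
  moreover have "finsum A c {i. c i \<noteq> \<zero>} = finsum A c S"
    using assms(1,2) sub by (intro finsum_support) (auto intro: grade_carrier)
  ultimately show ?thesis unfolding decomposition_def
    using assms(1,2,4) by (auto intro: finite_subset)
qed

lemma decomposition_add: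
  assumes "decomposition A a c" "decomposition A b c'"
  shows "decomposition A (a \<oplus> b) (\<lambda>i. c i \<oplus> c' i)"
proof -
  let ?S = "{i. c i \<noteq> \<zero>} \<union> {i. c' i \<noteq> \<zero>}"
  have c: "c i \<in> grade A i" "c' i \<in> grade A i" for i using assms unfolding decomposition_def by auto
  have cc: "c i \<in> carrier A" "c' i \<in> carrier A" for i using c grade_carrier by blast+
  have S: "finite ?S" using assms unfolding decomposition_def by blast
  have "a = finsum A c ?S" "b = finsum A c' ?S"
    using assms S finsum_support[of ?S c] finsum_support[of ?S c'] cc unfolding decomposition_def by auto
  then have "a \<oplus> b = finsum A (\<lambda>i. c i \<oplus> c' i) ?S" using cc by (simp add: finsum_addf)
  then show ?thesis using c S by (intro decompositionI[of ?S]) (auto intro: add_grade)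
qed

lemma decomposition_homogeneous: "a \<in> grade A i \<Longrightarrow> decomposition A a (\<lambda>j. if j = i then a else \<zero>)"
  by (intro decompositionI[of "{i}"]) (auto simp: zero_grade grade_carrier)

text \<open>Uniqueness of the decomposition is read off from additive projections onto the summands.\<close>

lemma direct_sumI:
  assumes \<pi>add: "\<And>i a b. a \<in> carrier A \<Longrightarrow> b \<in> carrier A \<Longrightarrow> \<pi> i (a \<oplus> b) = \<pi> i a \<oplus> \<pi> i b"
    and \<pi>cl: "\<And>i a. a \<in> carrier A \<Longrightarrow> \<pi> i a \<in> carrier A"
    and \<pi>id: "\<And>i a. a \<in> grade A i \<Longrightarrow> \<pi> i a = a"
    and \<pi>0: "\<And>i j a. i \<noteq> j \<Longrightarrow> a \<in> grade A j \<Longrightarrow> \<pi> i a = \<zero>"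
    and ex: "\<exists>c. decomposition A a c"
  shows "\<exists>!c. decomposition A a c"
proof -
  have u: "c = (\<lambda>i. \<pi> i a)" if d: "decomposition A a c" for c
  proof
    fix i
    have gc: "c j \<in> grade A j" "c j \<in> carrier A" for j
      using d grade_carrier unfolding decomposition_def by blast+
    have "\<pi> i \<zero> \<oplus> \<pi> i \<zero> = \<pi> i \<zero>" using \<pi>add[of \<zero> \<zero> i] by simp
    then have z: "\<pi> i \<zero> = \<zero>" using \<pi>cl[of \<zero> i] by (simp add: add.r_cancel_one)
    have "\<pi> i (finsum A c S) = (if i \<in> S then c i else \<zero>)" if "finite S" for S
      using that
    proof (induction S rule: finite_induct)
      case empty then show ?case using z by simp
    next
      case (insert s S)
      then have "finsum A c (insert s S) = c s \<oplus> finsum A c S"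
        using gc by (intro finsum_insert) auto
      then have "\<pi> i (finsum A c (insert s S)) = \<pi> i (c s) \<oplus> (if i \<in> S then c i else \<zero>)"
        using insert \<pi>add[of "c s" "finsum A c S" i] gc by (auto simp: finsum_closed)
      then show ?case using insert(2) \<pi>id[of "c i" i] \<pi>0[of i s "c s"] gc
        by (cases "i = s") auto
    qed
    from this[of "{i. c i \<noteq> \<zero>}"] show "c i = \<pi> i a" using d unfolding decomposition_def by auto
  qed
  then show ?thesis using ex by metis
qed

end

text \<open>The facts about homogeneous elements are used for \<open>tensor A B\<close> and
  \<open>cochain_ring X\<close> while their direct sum property is still to be shown; hence the
  intermediate locale.\<close>

sublocale dg_ring \<subseteq> pregraded_ring A
  by (intro pregraded_ring.intro pregraded_ring_axioms.intro ring_axioms grade_subgroup)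

context dg_ring
begin

lemma hcomp_decomposition: "a \<in> carrier A \<Longrightarrow> decomposition A a (hcomp A a)"
  unfolding hcomp_def using grade_direct_sum by (rule theI')

lemma hcomp_unique: "a \<in> carrier A \<Longrightarrow> decomposition A a c \<Longrightarrow> hcomp A a = c"
  using grade_direct_sum hcomp_decomposition by blast

lemma hcomp_grade: "a \<in> carrier A \<Longrightarrow> hcomp A a i \<in> grade A i"
  using hcomp_decomposition unfolding decomposition_def by blast

lemma hcomp_carrier: "a \<in> carrier A \<Longrightarrow> hcomp A a i \<in> carrier A"
  using hcomp_grade grade_carrier by blast

lemma finite_hsupp: "a \<in> carrier A \<Longrightarrow> finite (hsupp A a)"
  using hcomp_decomposition unfolding decomposition_def hsupp_def by blast

lemma finsum_hcomp: "a \<in> carrier A \<Longrightarrow> finsum A (hcomp A a) (hsupp A a) = a"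
  using hcomp_decomposition unfolding decomposition_def hsupp_def by metis

lemma not_hsupp: "i \<notin> hsupp A a \<Longrightarrow> hcomp A a i = \<zero>"
  unfolding hsupp_def by blast

lemma hcomp_homogeneous: "a \<in> grade A i \<Longrightarrow> hcomp A a = (\<lambda>j. if j = i then a else \<zero>)"
proof (rule hcomp_unique)
  assume a: "a \<in> grade A i"
  then show "a \<in> carrier A" by (rule grade_carrier)
  then show "decomposition A a (\<lambda>j. if j = i then a else \<zero>)"
    using a by (intro decompositionI[of "{i}"]) (auto simp: zero_grade)
qed

lemma hcomp_add:
  assumes "a \<in> carrier A" "b \<in> carrier A"
  shows "hcomp A (a \<oplus> b) = (\<lambda>i. hcomp A a i \<oplus> hcomp A b i)"
proof (rule hcomp_unique)
  let ?S = "hsupp A a \<union> hsupp A b"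
  have S: "finite ?S" using assms finite_hsupp by blast
  have "finsum A (\<lambda>i. hcomp A a i \<oplus> hcomp A b i) ?S = finsum A (hcomp A a) ?S \<oplus> finsum A (hcomp A b) ?S"
    using assms by (intro finsum_addf) (auto simp: hcomp_carrier)
  moreover have "finsum A (hcomp A a) ?S = a"
    using finsum_support[of ?S "hcomp A a"] S assms finsum_hcomp[of a] hcomp_carrier
    by (auto simp: hsupp_def)
  moreover have "finsum A (hcomp A b) ?S = b"
    using finsum_support[of ?S "hcomp A b"] S assms finsum_hcomp[of b] hcomp_carrier
    by (auto simp: hsupp_def)
  ultimately show "decomposition A (a \<oplus> b) (\<lambda>i. hcomp A a i \<oplus> hcomp A b i)"
    using S assms by (intro decompositionI[of ?S]) (auto simp: hcomp_grade add_grade not_hsupp)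
qed (use assms in simp)

text \<open>Every element is the finite sum of its components. Zero is homogeneous, so the empty sum
  falls under the homogeneous case.\<close>

lemma graded_induct [consumes 1, case_names homogeneous add]:
  assumes "a \<in> carrier A"
    and hom: "\<And>i a. a \<in> grade A i \<Longrightarrow> P a"
    and add: "\<And>a b. a \<in> carrier A \<Longrightarrow> b \<in> carrier A \<Longrightarrow> P a \<Longrightarrow> P b \<Longrightarrow> P (a \<oplus> b)"
  shows "P a"
proof -
  have "P (finsum A c S)" if "finite S" "\<And>i. c i \<in> grade A i" for S c
    using that
  proof (induction S rule: finite_induct)
    case empty then show ?case using hom[OF zero_grade] by simp
  next
    case (insert s S)
    then have "finsum A c (insert s S) = c s \<oplus> finsum A c S"
      by (intro finsum_insert) (auto intro: grade_carrier)
    then show ?case using insert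
      by (auto intro!: add hom[of "c s"] finsum_closed grade_carrier[of "c _"])
  qed
  from this[of "hsupp A a" "hcomp A a"] show ?thesis
    using assms(1) finsum_hcomp finite_hsupp hcomp_grade by simp
qed

lemma dif_closed: "a \<in> carrier A \<Longrightarrow> dif A a \<in> carrier A"
  by (induction a rule: graded_induct) (auto simp: dif_add intro: grade_carrier dif_grade)

lemma dif_zero: "dif A \<zero> = \<zero>"
  using dif_add[of \<zero> \<zero>] dif_closed[of \<zero>] by (simp add: add.r_cancel_one)

lemma dif_uminus: "a \<in> carrier A \<Longrightarrow> dif A (\<ominus> a) = \<ominus> dif A a"
  using dif_add[of "\<ominus> a" a] dif_closed dif_zero by (simp add: l_neg minus_equality[symmetric])

lemma dif_minus: "a \<in> carrier A \<Longrightarrow> b \<in> carrier A \<Longrightarrow> dif A (a \<ominus> b) = dif A a \<ominus> dif A b"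
  unfolding a_minus_def by (simp add: dif_add dif_uminus)

lemma sign_pow: "a \<in> carrier A \<Longrightarrow> [sign i] \<cdot> a = (if even i then a else \<ominus> a)"
  by (simp add: sign_def add.int_pow_neg)

lemma dif_one: "dif A \<one> = \<zero>"
proof -
  have "dif A \<one> = dif A \<one> \<oplus> dif A \<one>"
    using dif_mult[OF grade_one one_closed] dif_closed[OF one_closed] by (simp add: sign_pow)
  then show ?thesis using dif_closed[OF one_closed] by (simp add: add.r_cancel_one)
qed

end

text \<open>Unlike \<open>dg_hom\<close>, this does not require the map to be extensional.\<close>

definition dg_map :: "'a dg_ring \<Rightarrow> 'b dg_ring \<Rightarrow> ('a \<Rightarrow> 'b) \<Rightarrow> bool"
  where "dg_map A B h \<longleftrightarrow> h \<in> ring_hom A B \<and> (\<forall>i. h ` grade A i \<subseteq> grade B i) \<and>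
    (\<forall>a \<in> carrier A. h (dif A a) = dif B (h a))"

lemma dg_hom_iff: "h \<in> dg_hom A B \<longleftrightarrow> dg_map A B h \<and> h \<in> extensional (carrier A)"
  unfolding dg_hom_def dg_map_def by auto

lemma dg_mapD:
  assumes "dg_map A B h"
  shows "\<And>a i. a \<in> grade A i \<Longrightarrow> h a \<in> grade B i"
    "\<And>a. a \<in> carrier A \<Longrightarrow> h (dif A a) = dif B (h a)"
    "\<And>a. a \<in> carrier A \<Longrightarrow> h a \<in> carrier B"
    "\<And>a b. a \<in> carrier A \<Longrightarrow> b \<in> carrier A \<Longrightarrow> h (a \<oplus>\<^bsub>A\<^esub> b) = h a \<oplus>\<^bsub>B\<^esub> h b"
    "\<And>a b. a \<in> carrier A \<Longrightarrow> b \<in> carrier A \<Longrightarrow> h (a \<otimes>\<^bsub>A\<^esub> b) = h a \<otimes>\<^bsub>B\<^esub> h b"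
    "h \<one>\<^bsub>A\<^esub> = \<one>\<^bsub>B\<^esub>"
  using assms unfolding dg_map_def ring_hom_def by blast+

lemma dg_mapI:
  assumes "\<And>a i. a \<in> grade A i \<Longrightarrow> h a \<in> grade B i"
    "\<And>a. a \<in> carrier A \<Longrightarrow> h (dif A a) = dif B (h a)"
    "\<And>a. a \<in> carrier A \<Longrightarrow> h a \<in> carrier B"
    "\<And>a b. a \<in> carrier A \<Longrightarrow> b \<in> carrier A \<Longrightarrow> h (a \<oplus>\<^bsub>A\<^esub> b) = h a \<oplus>\<^bsub>B\<^esub> h b"
    "\<And>a b. a \<in> carrier A \<Longrightarrow> b \<in> carrier A \<Longrightarrow> h (a \<otimes>\<^bsub>A\<^esub> b) = h a \<otimes>\<^bsub>B\<^esub> h b"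
    "h \<one>\<^bsub>A\<^esub> = \<one>\<^bsub>B\<^esub>"
  shows "dg_map A B h"
  using assms unfolding dg_map_def ring_hom_def by blast

lemma (in dg_ring) dg_map_id: "dg_map A A (\<lambda>a. a)"
  by (rule dg_mapI) simp_all

lemma (in dg_ring) dg_hom_compose:
  assumes "g \<in> dg_hom A B" "dg_map B C h"
  shows "compose (carrier A) h g \<in> dg_hom A C"
proof -
  note g = dg_mapD[of A B g] and h = dg_mapD[OF assms(2)]
  have "dg_map A C (compose (carrier A) h g)"
    using assms(1) by (intro dg_mapI)
      (auto simp: compose_def dg_hom_iff g h grade_carrier dif_closed)
  then show ?thesis by (simp add: dg_hom_iff compose_extensional)
qed

locale dg_hom_pair = A: dg_ring A + B: dg_ring B
  for A :: "'a dg_ring" and B :: "'b dg_ring" and h :: "'a \<Rightarrow> 'b" +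
  assumes h: "dg_map A B h"
begin

lemmas hD = dg_mapD[OF h]

lemma h_zero: "h \<zero>\<^bsub>A\<^esub> = \<zero>\<^bsub>B\<^esub>"
  using hD(4)[of "\<zero>\<^bsub>A\<^esub>" "\<zero>\<^bsub>A\<^esub>"] hD(3)[of "\<zero>\<^bsub>A\<^esub>"] by (simp add: B.add.r_cancel_one)

lemma h_uminus: "a \<in> carrier A \<Longrightarrow> h (\<ominus>\<^bsub>A\<^esub> a) = \<ominus>\<^bsub>B\<^esub> h a"
  using hD(4)[of "\<ominus>\<^bsub>A\<^esub> a" a] hD(3) h_zero by (simp add: A.l_neg B.minus_equality[symmetric])

lemma h_minus: "a \<in> carrier A \<Longrightarrow> b \<in> carrier A \<Longrightarrow> h (a \<ominus>\<^bsub>A\<^esub> b) = h a \<ominus>\<^bsub>B\<^esub> h b"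
  unfolding a_minus_def by (simp add: h_uminus hD)

lemma h_finsum: "finite S \<Longrightarrow> (\<And>s. s \<in> S \<Longrightarrow> c s \<in> carrier A) \<Longrightarrow> h (finsum A c S) = finsum B (\<lambda>s. h (c s)) S"
proof (induction S rule: finite_induct)
  case (insert s S)
  have "finsum A c (insert s S) = c s \<oplus>\<^bsub>A\<^esub> finsum A c S"
    "finsum B (\<lambda>s. h (c s)) (insert s S) = h (c s) \<oplus>\<^bsub>B\<^esub> finsum B (\<lambda>s. h (c s)) S"
    using insert hD by (auto intro!: A.finsum_insert B.finsum_insert)
  then show ?case using insert hD by (auto simp: A.finsum_closed)
qed (simp add: h_zero)

lemma h_hcomp:
  assumes "a \<in> carrier A"
  shows "hcomp B (h a) = (\<lambda>i. h (hcomp A a i))"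
proof (rule B.hcomp_unique)
  show "h a \<in> carrier B" using assms hD by blast
  have "h a = finsum B (\<lambda>i. h (hcomp A a i)) (hsupp A a)"
    using h_finsum[of "hsupp A a" "hcomp A a"] assms
    by (simp add: A.finite_hsupp A.finsum_hcomp A.hcomp_carrier)
  then show "decomposition B (h a) (\<lambda>i. h (hcomp A a i))"
    using assms by (intro B.decompositionI[of "hsupp A a"])
      (auto simp: A.finite_hsupp A.not_hsupp h_zero intro: hD A.hcomp_grade)
qed

end

section \<open>Tensor products of DG rings\<close>

text \<open>Subgroups are stated through the operations of the type
  \<open>'x \<Rightarrow>\<^sub>0 int\<close> rather than through a group record, so that
  congruences modulo the tensor relations can be manipulated by ordinary arithmetic.\<close>

definition frag_subgroup :: "('x \<Rightarrow>\<^sub>0 int) set \<Rightarrow> bool"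
  where "frag_subgroup K \<longleftrightarrow> 0 \<in> K \<and> (\<forall>x\<in>K. \<forall>y\<in>K. x - y \<in> K)"

lemma frag_subgroupD:
  assumes "frag_subgroup K"
  shows "0 \<in> K" "\<And>x y. x \<in> K \<Longrightarrow> y \<in> K \<Longrightarrow> x - y \<in> K"
    "\<And>x. x \<in> K \<Longrightarrow> - x \<in> K" "\<And>x y. x \<in> K \<Longrightarrow> y \<in> K \<Longrightarrow> x + y \<in> K"
proof -
  show 1: "0 \<in> K" and 2: "\<And>x y. x \<in> K \<Longrightarrow> y \<in> K \<Longrightarrow> x - y \<in> K"
    using assms unfolding frag_subgroup_def by blast+
  show 3: "- x \<in> K" if "x \<in> K" for x using 2[OF 1 that] by simp
  show "x + y \<in> K" if "x \<in> K" "y \<in> K" for x y using 2[OF that(1) 3[OF that(2)]] by simp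
qed

lemma frag_subgroup_sum: "frag_subgroup K \<Longrightarrow> (\<And>i. i \<in> I \<Longrightarrow> f i \<in> K) \<Longrightarrow> sum f I \<in> K"
  by (induction I rule: infinite_finite_induct) (auto simp: frag_subgroupD)

lemma frag_subgroup_cmul: "frag_subgroup K \<Longrightarrow> x \<in> K \<Longrightarrow> frag_cmul c x \<in> K"
  by (rule frag_closure_minus_cmul) (auto simp: frag_subgroupD)

lemma frag_subgroup_sum3:
  assumes "frag_subgroup K" "\<And>i. i \<in> I \<Longrightarrow> f i - g i - h i \<in> K"
  shows "sum f I - sum g I - sum h I \<in> K"
  using frag_subgroup_sum[OF assms(1), of I "\<lambda>i. f i - g i - h i"] assms(2)
  by (simp add: sum_subtractf)

text \<open>Congruent elements have the same coset; in this form congruences modulo the tensor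
  relations become equalities of tensor classes.\<close>

lemma frag_subgroup_shift:
  assumes "frag_subgroup K" "a - b \<in> K"
  shows "y - a \<in> K \<longleftrightarrow> y - b \<in> K"
  using frag_subgroupD(4)[OF assms(1) _ assms(2), of "y - a"] frag_subgroupD(2)[OF assms(1) _ assms(2), of "y - b"]
  by (auto simp: algebra_simps)

context dg_ring
begin

context
  fixes K :: "('x \<Rightarrow>\<^sub>0 int) set" and G :: "int \<Rightarrow> 'a \<Rightarrow> ('x \<Rightarrow>\<^sub>0 int)"
  assumes K: "frag_subgroup K"
    and G: "\<And>i a b. a \<in> grade A i \<Longrightarrow> b \<in> grade A i \<Longrightarrow> G i (a \<oplus> b) - G i a - G i b \<in> K"
begin

text \<open>Additivity of \<open>G i\<close> modulo \<open>K\<close> puts \<open>G i \<zero>\<close>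
  into \<open>K\<close>, so the vanishing components outside the support contribute only elements of
  \<open>K\<close>.\<close>

lemma hsum_superset:
  assumes "a \<in> carrier A" "finite S" "hsupp A a \<subseteq> S"
  shows "(\<Sum>i\<in>S. G i (hcomp A a i)) - (\<Sum>i\<in>hsupp A a. G i (hcomp A a i)) \<in> K"
proof -
  have "- G i \<zero> \<in> K" for i using G[OF zero_grade zero_grade, of i] by simp
  then have "G i \<zero> \<in> K" for i using frag_subgroupD(3)[OF K, of "- G i \<zero>"] by simp
  then have "(\<Sum>i\<in>S - hsupp A a. G i (hcomp A a i)) \<in> K"
    by (intro frag_subgroup_sum[OF K]) (simp add: not_hsupp)
  then show ?thesis
    using assms by (subst sum_diff[symmetric]) auto
qed

text \<open>The range of summation depends on the element. All three sums are therefore moved to the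
  union of the three supports, where additivity holds term by term.\<close>

lemma hsum_additive:
  assumes "a \<in> carrier A" "b \<in> carrier A"
  shows "(\<Sum>i\<in>hsupp A (a \<oplus> b). G i (hcomp A (a \<oplus> b) i)) - (\<Sum>i\<in>hsupp A a. G i (hcomp A a i))
    - (\<Sum>i\<in>hsupp A b. G i (hcomp A b i)) \<in> K"
proof -
  define S where "S = hsupp A (a \<oplus> b) \<union> hsupp A a \<union> hsupp A b"
  let ?H = "\<lambda>S c. \<Sum>i\<in>S. G i (hcomp A c i)"
  have S: "finite S" unfolding S_def using assms by (auto intro: finite_hsupp)
  have sup: "?H S c - ?H (hsupp A c) c \<in> K" if "c \<in> {a, b, a \<oplus> b}" for c
    using that assms S by (intro hsum_superset) (auto simp: S_def)
  have "?H S (a \<oplus> b) - ?H S a - ?H S b \<in> K"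
    using assms by (intro frag_subgroup_sum3[OF K]) (simp add: hcomp_add G hcomp_grade)
  then have X: "?H S (a \<oplus> b) - ?H S a - ?H S b \<in> K" .
  note D = frag_subgroupD[OF K]
  from D(4)[OF D(4)[OF D(2)[OF X sup[of "a \<oplus> b", simplified]] sup[of a, simplified]] sup[of b, simplified]]
  show ?thesis by (simp add: algebra_simps)
qed

text \<open>This is a congruence and not an equality: zero is homogeneous of every degree but has
  empty support, so the sum may be empty while \<open>G i a\<close> is a nonzero element of
  \<open>K\<close>.\<close>

lemma hsum_homogeneous:
  assumes "a \<in> grade A i"
  shows "(\<Sum>j\<in>hsupp A a. G j (hcomp A a j)) - G i a \<in> K"
proof -
  have "hsupp A a \<subseteq> {i}" using assms by (auto simp: hsupp_def hcomp_homogeneous split: if_splits)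
  from hsum_superset[OF grade_carrier[OF assms] _ this]
  have "G i a - (\<Sum>j\<in>hsupp A a. G j (hcomp A a j)) \<in> K"
    using assms by (simp add: hcomp_homogeneous)
  from frag_subgroupD(3)[OF K this] show ?thesis by simp
qed

end

end

section \<open>The additive group of the tensor product\<close>

lemma mem_tensor_class: "y \<in> tensor_class A B x \<longleftrightarrow> y - x \<in> tensor_rels A B"
  by (auto simp: tensor_class_def r_coset_def tensor_free_def intro!: bexI[of _ "y - x"])

locale dg_pair = A: dg_ring A + B: dg_ring B
  for A :: "'a dg_ring" and B :: "'b dg_ring"
begin

abbreviation "F \<equiv> {x :: 'a \<times> 'b \<Rightarrow>\<^sub>0 int. Poly_Mapping.keys x \<subseteq> carrier A \<times> carrier B}"
abbreviation "R \<equiv> tensor_rels A B"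
abbreviation "T \<equiv> tensor A B"
abbreviation "cl \<equiv> tensor_class A B"
abbreviation "pt \<equiv> pure_tensor A B"

lemma F_subgroup: "frag_subgroup F"
  unfolding frag_subgroup_def using keys_diff by fastforce

lemma rels_aux: "R \<subseteq> F \<and> frag_subgroup R"
proof -
  interpret G: group "tensor_free A B" unfolding tensor_free_def by simp
  have "subgroup R (tensor_free A B)" unfolding tensor_rels_def
  proof (rule G.generate_is_subgroup)
    show "{frag_of (a \<oplus>\<^bsub>A\<^esub> a', b) - frag_of (a, b) - frag_of (a', b) | a a' b.
        a \<in> carrier A \<and> a' \<in> carrier A \<and> b \<in> carrier B} \<union>
     {frag_of (a, b \<oplus>\<^bsub>B\<^esub> b') - frag_of (a, b) - frag_of (a, b') | a b b'.
        a \<in> carrier A \<and> b \<in> carrier B \<and> b' \<in> carrier B} \<subseteq> carrier (tensor_free A B)"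
      using frag_subgroupD(2)[OF F_subgroup] by (auto simp: tensor_free_def simp del: keys_diff)
  qed
  then have s: "R \<subseteq> F" "0 \<in> R" "\<And>x y. x \<in> R \<Longrightarrow> y \<in> R \<Longrightarrow> x + y \<in> R"
    "\<And>x. x \<in> R \<Longrightarrow> inv\<^bsub>tensor_free A B\<^esub> x \<in> R"
    using subgroup.subset subgroup.one_closed subgroup.m_closed subgroup.m_inv_closed
    by (fastforce simp: tensor_free_def)+
  moreover have "- x \<in> R" if "x \<in> R" for x
    using s(1) s(4)[OF that] that by (auto simp: tensor_free_def)
  ultimately show ?thesis unfolding frag_subgroup_def by (metis diff_conv_add_uminus)
qed

lemmas rels_F = rels_aux[THEN conjunct1] and rels_subgroup = rels_aux[THEN conjunct2]
lemmas rels = frag_subgroupD[OF rels_subgroup]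

lemma rels_left: "a \<in> carrier A \<Longrightarrow> a' \<in> carrier A \<Longrightarrow> b \<in> carrier B \<Longrightarrow>
    frag_of (a \<oplus>\<^bsub>A\<^esub> a', b) - frag_of (a, b) - frag_of (a', b) \<in> R"
  unfolding tensor_rels_def by (rule generate.incl) blast

lemma rels_right: "a \<in> carrier A \<Longrightarrow> b \<in> carrier B \<Longrightarrow> b' \<in> carrier B \<Longrightarrow>
    frag_of (a, b \<oplus>\<^bsub>B\<^esub> b') - frag_of (a, b) - frag_of (a, b') \<in> R"
  unfolding tensor_rels_def by (rule generate.incl) blast

text \<open>The condition under which \<open>frag_extend G\<close> descends to the tensor product;
  \<open>K\<close> is typically the group of relations of a tensor product in the target.\<close>

definition bilin :: "('a \<times> 'b \<Rightarrow> ('x \<Rightarrow>\<^sub>0 int)) \<Rightarrow> ('x \<Rightarrow>\<^sub>0 int) set \<Rightarrow> bool"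
  where "bilin G K \<longleftrightarrow> frag_subgroup K \<and>
    (\<forall>a\<in>carrier A. \<forall>a'\<in>carrier A. \<forall>b\<in>carrier B. G (a \<oplus>\<^bsub>A\<^esub> a', b) - G (a, b) - G (a', b) \<in> K) \<and>
    (\<forall>a\<in>carrier A. \<forall>b\<in>carrier B. \<forall>b'\<in>carrier B. G (a, b \<oplus>\<^bsub>B\<^esub> b') - G (a, b) - G (a, b') \<in> K)"

lemma bilin_extend:
  assumes "bilin G K" "x \<in> R"
  shows "frag_extend G x \<in> K"
proof -
  have K: "frag_subgroup K" using assms(1) unfolding bilin_def by blast
  show ?thesis
    using assms(2) unfolding tensor_rels_def
  proof (induction x rule: generate.induct)
    case one
    then show ?case by (simp add: tensor_free_def frag_subgroupD[OF K])
  next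
    case (incl h)
    then show ?case using assms(1) unfolding bilin_def by (auto simp: frag_extend_diff)
  next
    case (inv h)
    then have "h \<in> R" unfolding tensor_rels_def by (rule generate.incl)
    then have "inv\<^bsub>tensor_free A B\<^esub> h = - h" using rels_F by (auto simp: tensor_free_def)
    moreover have "frag_extend G h \<in> K"
      using inv assms(1) unfolding bilin_def by (auto simp: frag_extend_diff)
    ultimately show ?case using frag_subgroupD[OF K] by (simp add: frag_extend_minus)
  next
    case (eng h1 h2)
    then show ?case by (simp add: tensor_free_def frag_extend_add frag_subgroupD[OF K])
  qed
qed

text \<open>The operations of \<open>tensor\<close> are unions over all representatives. For
  bilinear \<open>G\<close> all members of the union coincide, so any representative computes
  it.\<close>

lemma bilin_class_union:
  assumes "bilin G (tensor_rels A' B')"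
  shows "(\<Union>z\<in>cl x. tensor_class A' B' (frag_extend G z)) = tensor_class A' B' (frag_extend G x)"
proof -
  have K: "frag_subgroup (tensor_rels A' B')" using assms unfolding bilin_def by blast
  have "tensor_class A' B' (frag_extend G z) = tensor_class A' B' (frag_extend G x)" if "z \<in> cl x" for z
  proof -
    have "frag_extend G z - frag_extend G x \<in> tensor_rels A' B'"
      using bilin_extend[OF assms, of "z - x"] that by (simp add: mem_tensor_class frag_extend_diff)
    from frag_subgroup_shift[OF K this] show ?thesis
      unfolding set_eq_iff mem_tensor_class by simp
  qed
  moreover have "x \<in> cl x" by (simp add: mem_tensor_class rels)
  ultimately show ?thesis by blast
qed

lemma class_eq_iff: "cl x = cl y \<longleftrightarrow> x - y \<in> R"
proof
  assume "cl x = cl y"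
  moreover have "x \<in> cl x" by (simp add: mem_tensor_class rels)
  ultimately show "x - y \<in> R" by (simp add: mem_tensor_class)
next
  assume d: "x - y \<in> R"
  from frag_subgroup_shift[OF rels_subgroup d] show "cl x = cl y"
    unfolding set_eq_iff mem_tensor_class by simp
qed

lemma tensor_carrier: "carrier T = cl ` F"
  by (auto simp: tensor_def tensor_group_def carrier_FactGroup tensor_class_def tensor_free_def)

lemma tensor_add: "s \<oplus>\<^bsub>T\<^esub> t = (\<Union>h\<in>s. \<Union>k\<in>t. {h + k})"
  by (simp add: tensor_def tensor_group_def set_mult_def tensor_free_def FactGroup_def free_Abelian_group_def)

lemma class_add: "cl x \<oplus>\<^bsub>T\<^esub> cl y = cl (x + y)"
proof (intro Set.set_eqI iffI)
  fix z assume "z \<in> cl x \<oplus>\<^bsub>T\<^esub> cl y"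
  then obtain h k where hk: "h \<in> cl x" "k \<in> cl y" "z = h + k"
    unfolding tensor_add by blast
  then have "h - x \<in> R" "k - y \<in> R" by (auto simp: mem_tensor_class)
  from rels(4)[OF this] show "z \<in> cl (x + y)" by (simp add: mem_tensor_class hk(3) algebra_simps)
next
  fix z assume "z \<in> cl (x + y)"
  then have "z - y \<in> cl x" by (simp add: mem_tensor_class algebra_simps)
  moreover have "y \<in> cl y" by (simp add: mem_tensor_class rels)
  moreover have "z = (z - y) + y" by simp
  ultimately show "z \<in> cl x \<oplus>\<^bsub>T\<^esub> cl y" unfolding tensor_add by blast
qed

lemma class_zero: "\<zero>\<^bsub>T\<^esub> = cl 0"
  by (simp add: tensor_def tensor_group_def set_eq_iff mem_tensor_class)

lemma class_closed: "x \<in> F \<Longrightarrow> cl x \<in> carrier T"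
  unfolding tensor_carrier by blast

lemma class_cases:
  assumes "s \<in> carrier T" obtains x where "x \<in> F" "s = cl x"
  using assms unfolding tensor_carrier by blast

lemma abelian_group_T: "abelian_group T"
proof (rule abelian_groupI)
  show "x \<oplus>\<^bsub>T\<^esub> y \<in> carrier T" if "x \<in> carrier T" "y \<in> carrier T" for x y
    using that frag_subgroupD(4)[OF F_subgroup] unfolding tensor_carrier by (auto simp: class_add)
  show "\<zero>\<^bsub>T\<^esub> \<in> carrier T" unfolding class_zero by (rule class_closed) simp
  show "\<exists>y\<in>carrier T. y \<oplus>\<^bsub>T\<^esub> x = \<zero>\<^bsub>T\<^esub>" if x: "x \<in> carrier T" for x
  proof -
    obtain x' where x': "x' \<in> F" "x = cl x'" using x by (rule class_cases)
    show ?thesis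
    proof (rule bexI)
      show "cl (- x') \<oplus>\<^bsub>T\<^esub> x = \<zero>\<^bsub>T\<^esub>" by (simp add: x'(2) class_add class_zero)
      show "cl (- x') \<in> carrier T" using x'(1) by (intro class_closed) simp
    qed
  qed
next
  fix x y z assume "x \<in> carrier T" "y \<in> carrier T" "z \<in> carrier T"
  then show "x \<oplus>\<^bsub>T\<^esub> y \<oplus>\<^bsub>T\<^esub> z = x \<oplus>\<^bsub>T\<^esub> (y \<oplus>\<^bsub>T\<^esub> z)"
    by (elim class_cases) (simp add: class_add add.assoc)
next
  fix x y assume "x \<in> carrier T" "y \<in> carrier T"
  then show "x \<oplus>\<^bsub>T\<^esub> y = y \<oplus>\<^bsub>T\<^esub> x"
    by (elim class_cases) (simp add: class_add add.commute)
next
  fix x assume "x \<in> carrier T"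
  then show "\<zero>\<^bsub>T\<^esub> \<oplus>\<^bsub>T\<^esub> x = x"
    by (elim class_cases) (simp add: class_add class_zero)
qed

sublocale T: abelian_group T by (rule abelian_group_T)

lemma class_uminus: "x \<in> F \<Longrightarrow> \<ominus>\<^bsub>T\<^esub> cl x = cl (- x)"
  by (rule T.minus_equality) (simp_all add: class_add class_zero class_closed)

lemma class_cmul_sign: "x \<in> F \<Longrightarrow> cl (frag_cmul (sign i) x) = [sign i] \<cdot>\<^bsub>T\<^esub> cl x"
  by (simp add: sign_def T.add.int_pow_neg class_uminus class_closed)

lemma pt_closed: "a \<in> carrier A \<Longrightarrow> b \<in> carrier B \<Longrightarrow> pt a b \<in> carrier T"
  unfolding pure_tensor_def by (rule class_closed) auto

lemma pt_add_left: "a \<in> carrier A \<Longrightarrow> a' \<in> carrier A \<Longrightarrow> b \<in> carrier B \<Longrightarrow>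
    pt (a \<oplus>\<^bsub>A\<^esub> a') b = pt a b \<oplus>\<^bsub>T\<^esub> pt a' b"
  unfolding pure_tensor_def class_add class_eq_iff using rels_left by (simp add: algebra_simps)

lemma pt_add_right: "a \<in> carrier A \<Longrightarrow> b \<in> carrier B \<Longrightarrow> b' \<in> carrier B \<Longrightarrow>
    pt a (b \<oplus>\<^bsub>B\<^esub> b') = pt a b \<oplus>\<^bsub>T\<^esub> pt a b'"
  unfolding pure_tensor_def class_add class_eq_iff using rels_right by (simp add: algebra_simps)

lemma pt_zero_left: "b \<in> carrier B \<Longrightarrow> pt \<zero>\<^bsub>A\<^esub> b = \<zero>\<^bsub>T\<^esub>"
  using pt_add_left[of "\<zero>\<^bsub>A\<^esub>" "\<zero>\<^bsub>A\<^esub>" b] pt_closed[of "\<zero>\<^bsub>A\<^esub>" b] by (simp add: T.add.r_cancel_one)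

lemma pt_zero_right: "a \<in> carrier A \<Longrightarrow> pt a \<zero>\<^bsub>B\<^esub> = \<zero>\<^bsub>T\<^esub>"
  using pt_add_right[of a "\<zero>\<^bsub>B\<^esub>" "\<zero>\<^bsub>B\<^esub>"] pt_closed[of a "\<zero>\<^bsub>B\<^esub>"] by (simp add: T.add.r_cancel_one)

lemma pt_uminus_left: "a \<in> carrier A \<Longrightarrow> b \<in> carrier B \<Longrightarrow> pt (\<ominus>\<^bsub>A\<^esub> a) b = \<ominus>\<^bsub>T\<^esub> pt a b"
  using pt_add_left[of "\<ominus>\<^bsub>A\<^esub> a" a b] by (intro T.minus_equality[symmetric]) (auto simp: pt_closed A.l_neg pt_zero_left)

lemma pt_uminus_right: "a \<in> carrier A \<Longrightarrow> b \<in> carrier B \<Longrightarrow> pt a (\<ominus>\<^bsub>B\<^esub> b) = \<ominus>\<^bsub>T\<^esub> pt a b"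
  using pt_add_right[of a "\<ominus>\<^bsub>B\<^esub> b" b] by (intro T.minus_equality[symmetric]) (auto simp: pt_closed B.l_neg pt_zero_right)

lemma tensor_induct [consumes 1, case_names pure add]:
  assumes "s \<in> carrier T"
    and pure: "\<And>i j a b. a \<in> grade A i \<Longrightarrow> b \<in> grade B j \<Longrightarrow> P (pt a b)"
    and add: "\<And>s t. s \<in> carrier T \<Longrightarrow> t \<in> carrier T \<Longrightarrow> P s \<Longrightarrow> P t \<Longrightarrow> P (s \<oplus>\<^bsub>T\<^esub> t)"
  shows "P s"
proof -
  have pure1: "P (pt a b)" if "a \<in> grade A i" "b \<in> carrier B" for a b i
    using that(2)
  proof (induction b rule: B.graded_induct)
    case (homogeneous j b)
    then show ?case using pure that by blast
  next
    case (add b b')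
    then show ?case using that assms(3) A.grade_carrier by (simp add: pt_add_right pt_closed)
  qed
  have pure2: "P (pt a b)" if "a \<in> carrier A" "b \<in> carrier B" for a b
    using that(1)
  proof (induction a rule: A.graded_induct)
    case (homogeneous i a)
    then show ?case using pure1 that by blast
  next
    case (add a a')
    then show ?case using that assms(3) by (simp add: pt_add_left pt_closed)
  qed
  obtain x where x: "x \<in> F" "s = cl x" using assms(1) unfolding tensor_carrier by blast
  \<comment> \<open>\<open>frag_induction\<close> proceeds by differences while the rule
    \<open>add\<close> offers only sums, so the claim is carried along for \<open>- x\<close> too. A
    negated generator is again a pure tensor, with the sign moved to the left factor.\<close>
  have "x \<in> F \<Longrightarrow> P (cl x) \<and> P (cl (- x)) \<and> x \<in> F"
    unfolding mem_Collect_eq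
  proof (induction x rule: frag_induction)
    case zero
    then show ?case using pure2[of "\<zero>\<^bsub>A\<^esub>" "\<zero>\<^bsub>B\<^esub>"] by (simp add: pt_zero_left class_zero)
  next
    case (one p)
    obtain a b where p: "p = (a, b)" "a \<in> carrier A" "b \<in> carrier B" using one by auto
    then have "cl (- frag_of p) = pt (\<ominus>\<^bsub>A\<^esub> a) b" 
      using pt_uminus_left[of a b] class_uminus[of "frag_of (a, b)"] by (simp add: pure_tensor_def)
    then show ?case using pure2[of a b] pure2[of "\<ominus>\<^bsub>A\<^esub> a" b] p by (simp add: pure_tensor_def)
  next
    case (diff x y)
    then have F: "x \<in> F" "y \<in> F" "- x \<in> F" by auto
    have "P (cl x \<oplus>\<^bsub>T\<^esub> cl (- y))" "P (cl (- x) \<oplus>\<^bsub>T\<^esub> cl y)"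
      using diff F by (auto intro!: add class_closed)
    then show ?case using frag_subgroupD(2)[OF F_subgroup F(1,2)] by (simp add: class_add algebra_simps)
  qed
  then show ?thesis using x by blast
qed

end

section \<open>Koszul signs and the multiplication of the tensor product\<close>

lemma (in abelian_group) sign_cases:
  "x \<in> carrier G \<Longrightarrow> [sign i] \<cdot> x = (if even i then x else \<ominus> x)"
  by (simp add: sign_def add.int_pow_neg)

lemma (in abelian_group) sign_closed: "x \<in> carrier G \<Longrightarrow> [sign i] \<cdot> x \<in> carrier G"
  by (simp add: sign_cases)

lemma (in abelian_group) sign_sign: "x \<in> carrier G \<Longrightarrow> [sign i] \<cdot> ([sign j] \<cdot> x) = [sign (i + j)] \<cdot> x"
  by (simp add: sign_cases)

lemma (in abelian_group) sign_add: "x \<in> carrier G \<Longrightarrow> y \<in> carrier G \<Longrightarrow>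
    [sign i] \<cdot> (x \<oplus> y) = [sign i] \<cdot> x \<oplus> [sign i] \<cdot> y"
  by (simp add: sign_cases minus_add)

lemma frag_cmul_diff2: "frag_cmul c (a - b) = frag_cmul c a - frag_cmul c b"
  using frag_cmul_distrib2[of c "a - b" b] by simp

context dg_pair
begin

lemma tensor_mult_gen_pair: "tensor_mult_gen A B (a, b) (a', b') = (\<Sum>i \<in> hsupp B b. \<Sum>j \<in> hsupp A a'.
      frag_cmul (sign (i * j)) (frag_of (a \<otimes>\<^bsub>A\<^esub> hcomp A a' j, hcomp B b i \<otimes>\<^bsub>B\<^esub> b')))"
  by (simp add: tensor_mult_gen_def)

lemma rels_left_cmul: "a \<in> carrier A \<Longrightarrow> a' \<in> carrier A \<Longrightarrow> b \<in> carrier B \<Longrightarrow>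
    frag_cmul c (frag_of (a \<oplus>\<^bsub>A\<^esub> a', b)) - frag_cmul c (frag_of (a, b)) - frag_cmul c (frag_of (a', b)) \<in> R"
  using frag_subgroup_cmul[OF rels_subgroup rels_left, of a a' b c]
  by (simp add: frag_cmul_diff2)

lemma rels_right_cmul: "a \<in> carrier A \<Longrightarrow> b \<in> carrier B \<Longrightarrow> b' \<in> carrier B \<Longrightarrow>
    frag_cmul c (frag_of (a, b \<oplus>\<^bsub>B\<^esub> b')) - frag_cmul c (frag_of (a, b)) - frag_cmul c (frag_of (a, b')) \<in> R"
  using frag_subgroup_cmul[OF rels_subgroup rels_right, of a b b' c]
  by (simp add: frag_cmul_diff2)

text \<open>Of the four entries of \<open>tensor_mult_gen\<close> only the right factor of the first
  pair and the left factor of the second enter through homogeneous components. Additivity in those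
  two rests on \<open>hsum_additive\<close>; in the other two, as here, it is checked term by
  term.\<close>

lemma mult_gen_left:
  assumes "a \<in> carrier A" "a2 \<in> carrier A" "b \<in> carrier B" "q \<in> carrier A \<times> carrier B"
  shows "tensor_mult_gen A B (a \<oplus>\<^bsub>A\<^esub> a2, b) q - tensor_mult_gen A B (a, b) q - tensor_mult_gen A B (a2, b) q \<in> R"
proof -
  obtain a' b' where q: "q = (a', b')" "a' \<in> carrier A" "b' \<in> carrier B" using assms(4) by blast
  show ?thesis unfolding q(1) tensor_mult_gen_pair
    using assms(1-3) q(2,3)
    by (intro frag_subgroup_sum3[OF rels_subgroup])
      (simp add: A.l_distr A.hcomp_carrier B.hcomp_carrier rels_left_cmul)
qed

lemma mult_gen_left':
  assumes "a \<in> carrier A" "b \<in> carrier B" "b2 \<in> carrier B" "q \<in> carrier A \<times> carrier B"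
  shows "tensor_mult_gen A B (a, b \<oplus>\<^bsub>B\<^esub> b2) q - tensor_mult_gen A B (a, b) q - tensor_mult_gen A B (a, b2) q \<in> R"
proof -
  obtain a' b' where q: "q = (a', b')" "a' \<in> carrier A" "b' \<in> carrier B" using assms(4) by blast
  show ?thesis unfolding q(1) tensor_mult_gen_pair
  proof (rule B.hsum_additive[OF rels_subgroup])
    fix i b b2 assume "b \<in> grade B i" "b2 \<in> grade B i"
    then have "b \<in> carrier B" "b2 \<in> carrier B" by (auto intro: B.grade_carrier)
    then show "(\<Sum>j\<in>hsupp A a'. frag_cmul (sign (i * j)) (frag_of (a \<otimes>\<^bsub>A\<^esub> hcomp A a' j, (b \<oplus>\<^bsub>B\<^esub> b2) \<otimes>\<^bsub>B\<^esub> b')))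
      - (\<Sum>j\<in>hsupp A a'. frag_cmul (sign (i * j)) (frag_of (a \<otimes>\<^bsub>A\<^esub> hcomp A a' j, b \<otimes>\<^bsub>B\<^esub> b')))
      - (\<Sum>j\<in>hsupp A a'. frag_cmul (sign (i * j)) (frag_of (a \<otimes>\<^bsub>A\<^esub> hcomp A a' j, b2 \<otimes>\<^bsub>B\<^esub> b'))) \<in> R"
      using assms(1) q(2,3)
      by (intro frag_subgroup_sum3[OF rels_subgroup])
        (simp add: B.l_distr A.hcomp_carrier B.hcomp_carrier rels_right_cmul)
  qed (use assms in auto)
qed

lemma mult_gen_bilin:
  assumes "p \<in> carrier A \<times> carrier B"
  shows "bilin (tensor_mult_gen A B p) R"
proof -
  obtain a b where p: "p = (a, b)" "a \<in> carrier A" "b \<in> carrier B" using assms by blast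
  have 1: "tensor_mult_gen A B (a, b) (a' \<oplus>\<^bsub>A\<^esub> a2, b') - tensor_mult_gen A B (a, b) (a', b')
      - tensor_mult_gen A B (a, b) (a2, b') \<in> R"
    if "a' \<in> carrier A" "a2 \<in> carrier A" "b' \<in> carrier B" for a' a2 b'
    unfolding tensor_mult_gen_pair
  proof (rule frag_subgroup_sum3[OF rels_subgroup], rule A.hsum_additive[OF rels_subgroup])
    fix i j a' a2 assume "a' \<in> grade A j" "a2 \<in> grade A j"
    then have "a' \<in> carrier A" "a2 \<in> carrier A" by (auto intro: A.grade_carrier)
    then show "frag_cmul (sign (i * j)) (frag_of (a \<otimes>\<^bsub>A\<^esub> (a' \<oplus>\<^bsub>A\<^esub> a2), hcomp B b i \<otimes>\<^bsub>B\<^esub> b'))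
      - frag_cmul (sign (i * j)) (frag_of (a \<otimes>\<^bsub>A\<^esub> a', hcomp B b i \<otimes>\<^bsub>B\<^esub> b'))
      - frag_cmul (sign (i * j)) (frag_of (a \<otimes>\<^bsub>A\<^esub> a2, hcomp B b i \<otimes>\<^bsub>B\<^esub> b')) \<in> R"
      using p(2,3) that by (simp add: A.r_distr B.hcomp_carrier rels_left_cmul)
  qed (use that in auto)
  have 2: "tensor_mult_gen A B (a, b) (a', b' \<oplus>\<^bsub>B\<^esub> b2) - tensor_mult_gen A B (a, b) (a', b')
      - tensor_mult_gen A B (a, b) (a', b2) \<in> R"
    if "a' \<in> carrier A" "b' \<in> carrier B" "b2 \<in> carrier B" for a' b' b2
    unfolding tensor_mult_gen_pair
    using p(2,3) that
    by (intro frag_subgroup_sum3[OF rels_subgroup])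
      (simp add: B.r_distr A.hcomp_carrier B.hcomp_carrier rels_right_cmul)
  show ?thesis unfolding bilin_def p(1) using 1 2 rels_subgroup by blast
qed

lemma mult_gen_F:
  assumes "p \<in> carrier A \<times> carrier B" "q \<in> carrier A \<times> carrier B"
  shows "tensor_mult_gen A B p q \<in> F"
proof -
  obtain a b a' b' where pq: "p = (a, b)" "a \<in> carrier A" "b \<in> carrier B" "q = (a', b')" "a' \<in> carrier A" "b' \<in> carrier B"
    using assms by blast
  show ?thesis unfolding pq(1,4) tensor_mult_gen_pair
    using pq by (intro frag_subgroup_sum[OF F_subgroup] frag_subgroup_cmul[OF F_subgroup])
      (simp add: A.hcomp_carrier B.hcomp_carrier)
qed

lemma frag_extend_closed:
  assumes "frag_subgroup K" "x \<in> F" "\<And>p. p \<in> carrier A \<times> carrier B \<Longrightarrow> G p \<in> K"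
  shows "frag_extend G x \<in> K"
  unfolding frag_extend_def using assms
  by (intro frag_subgroup_sum[OF assms(1)] frag_subgroup_cmul[OF assms(1)]) auto

lemma frag_extend_add_fun:
  "frag_extend (\<lambda>p. f p - g p - h p) x = frag_extend f x - frag_extend g x - frag_extend h x"
  by (simp add: frag_extend_def sum_subtractf frag_cmul_diff2)

text \<open>The product of representatives in the free abelian group. It is strictly biadditive in
  \<open>x\<close> and \<open>y\<close>, while additivity in the entries of a generator holds modulo
  \<open>R\<close>.\<close>

definition "bm x y = frag_extend (\<lambda>p. frag_extend (tensor_mult_gen A B p) y) x"

lemma bm_F: "x \<in> F \<Longrightarrow> y \<in> F \<Longrightarrow> bm x y \<in> F"
  unfolding bm_def by (intro frag_extend_closed[OF F_subgroup] mult_gen_F)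

lemma bm_rels_right: "x \<in> F \<Longrightarrow> y \<in> R \<Longrightarrow> bm x y \<in> R"
  unfolding bm_def by (intro frag_extend_closed[OF rels_subgroup] bilin_extend[OF mult_gen_bilin])

lemma bm_rels_left:
  assumes "x \<in> R" "y \<in> F"
  shows "bm x y \<in> R"
proof -
  have "bilin (\<lambda>p. frag_extend (tensor_mult_gen A B p) y) R"
    unfolding bilin_def frag_extend_add_fun[symmetric] using assms(2)
    by (auto intro!: rels_subgroup frag_extend_closed[OF rels_subgroup] mult_gen_left mult_gen_left')
  from bilin_extend[OF this assms(1)] show ?thesis unfolding bm_def .
qed

lemma bm_diff_left: "bm (x - x') y = bm x y - bm x' y"
  by (simp add: bm_def frag_extend_diff)

lemma bm_add_left: "bm (x + x') y = bm x y + bm x' y"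
  by (simp add: bm_def frag_extend_add)

lemma bm_add_right: "bm x (y + y') = bm x y + bm x y'"
  by (simp add: bm_def frag_extend_add) (simp add: frag_extend_def frag_cmul_distrib2 sum.distrib)

lemma bm_diff_right: "bm x (y - y') = bm x y - bm x y'"
  using bm_add_right[of x "y - y'" y'] by simp

text \<open>Independence of representatives comes from x'y' - xy = x'(y' - y) + (x' - x)y, where
  each summand has a factor in \<open>R\<close>.\<close>

lemma class_mult:
  assumes "x \<in> F" "y \<in> F"
  shows "cl x \<otimes>\<^bsub>T\<^esub> cl y = cl (bm x y)"
proof -
  have "cl (bm x' y') = cl (bm x y)" if "x' \<in> cl x" "y' \<in> cl y" for x' y'
  proof -
    have d: "x' - x \<in> R" "y' - y \<in> R" using that by (simp_all add: mem_tensor_class)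
    then have "x' - x + x \<in> F" using frag_subgroupD(4)[OF F_subgroup] rels_F assms(1) by blast
    then have "x' \<in> F" by (metis diff_add_cancel)
    then have "bm x' (y' - y) + bm (x' - x) y \<in> R"
      using d assms by (intro rels(4) bm_rels_left bm_rels_right)
    then show ?thesis unfolding class_eq_iff by (simp add: bm_diff_left bm_diff_right)
  qed
  moreover have "x \<in> cl x" "y \<in> cl y" by (simp_all add: mem_tensor_class rels)
  moreover have "cl x \<otimes>\<^bsub>T\<^esub> cl y = (\<Union>x'\<in>cl x. \<Union>y'\<in>cl y. cl (bm x' y'))"
    by (simp add: tensor_def bm_def)
  ultimately show ?thesis by blast
qed

lemma mult_closed: "s \<in> carrier T \<Longrightarrow> t \<in> carrier T \<Longrightarrow> s \<otimes>\<^bsub>T\<^esub> t \<in> carrier T"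
  by (elim class_cases) (simp only: class_mult class_closed bm_F)

lemma mult_add_left: "s \<in> carrier T \<Longrightarrow> s' \<in> carrier T \<Longrightarrow> t \<in> carrier T \<Longrightarrow>
    (s \<oplus>\<^bsub>T\<^esub> s') \<otimes>\<^bsub>T\<^esub> t = s \<otimes>\<^bsub>T\<^esub> t \<oplus>\<^bsub>T\<^esub> s' \<otimes>\<^bsub>T\<^esub> t"
  by (elim class_cases) (simp only: class_mult class_add frag_subgroupD(4)[OF F_subgroup] bm_add_left)

lemma mult_add_right: "s \<in> carrier T \<Longrightarrow> t \<in> carrier T \<Longrightarrow> t' \<in> carrier T \<Longrightarrow>
    s \<otimes>\<^bsub>T\<^esub> (t \<oplus>\<^bsub>T\<^esub> t') = s \<otimes>\<^bsub>T\<^esub> t \<oplus>\<^bsub>T\<^esub> s \<otimes>\<^bsub>T\<^esub> t'"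
  by (elim class_cases) (simp only: class_mult class_add frag_subgroupD(4)[OF F_subgroup] bm_add_right)

lemma mult_zero_left: "t \<in> carrier T \<Longrightarrow> \<zero>\<^bsub>T\<^esub> \<otimes>\<^bsub>T\<^esub> t = \<zero>\<^bsub>T\<^esub>"
  using mult_add_left[of "\<zero>\<^bsub>T\<^esub>" "\<zero>\<^bsub>T\<^esub>" t] mult_closed[of "\<zero>\<^bsub>T\<^esub>" t] by (simp add: T.add.r_cancel_one)

lemma mult_zero_right: "t \<in> carrier T \<Longrightarrow> t \<otimes>\<^bsub>T\<^esub> \<zero>\<^bsub>T\<^esub> = \<zero>\<^bsub>T\<^esub>"
  using mult_add_right[of t "\<zero>\<^bsub>T\<^esub>" "\<zero>\<^bsub>T\<^esub>"] mult_closed[of t "\<zero>\<^bsub>T\<^esub>"] by (simp add: T.add.r_cancel_one)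

lemma mult_uminus_left: "s \<in> carrier T \<Longrightarrow> t \<in> carrier T \<Longrightarrow> (\<ominus>\<^bsub>T\<^esub> s) \<otimes>\<^bsub>T\<^esub> t = \<ominus>\<^bsub>T\<^esub> (s \<otimes>\<^bsub>T\<^esub> t)"
  using mult_add_left[of "\<ominus>\<^bsub>T\<^esub> s" s t]
  by (intro T.minus_equality[symmetric]) (auto simp: mult_closed T.l_neg mult_zero_left)

lemma mult_uminus_right: "s \<in> carrier T \<Longrightarrow> t \<in> carrier T \<Longrightarrow> s \<otimes>\<^bsub>T\<^esub> (\<ominus>\<^bsub>T\<^esub> t) = \<ominus>\<^bsub>T\<^esub> (s \<otimes>\<^bsub>T\<^esub> t)"
  using mult_add_right[of s "\<ominus>\<^bsub>T\<^esub> t" t]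
  by (intro T.minus_equality[symmetric]) (auto simp: mult_closed T.l_neg mult_zero_right)

lemma mult_sign_left: "s \<in> carrier T \<Longrightarrow> t \<in> carrier T \<Longrightarrow>
    ([sign i] \<cdot>\<^bsub>T\<^esub> s) \<otimes>\<^bsub>T\<^esub> t = [sign i] \<cdot>\<^bsub>T\<^esub> (s \<otimes>\<^bsub>T\<^esub> t)"
  by (simp add: T.sign_cases mult_closed mult_uminus_left)

lemma mult_sign_right: "s \<in> carrier T \<Longrightarrow> t \<in> carrier T \<Longrightarrow>
    s \<otimes>\<^bsub>T\<^esub> ([sign i] \<cdot>\<^bsub>T\<^esub> t) = [sign i] \<cdot>\<^bsub>T\<^esub> (s \<otimes>\<^bsub>T\<^esub> t)"
  by (simp add: T.sign_cases mult_closed mult_uminus_right)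

lemma pt_sign_left: "a \<in> carrier A \<Longrightarrow> b \<in> carrier B \<Longrightarrow> pt ([sign i] \<cdot>\<^bsub>A\<^esub> a) b = [sign i] \<cdot>\<^bsub>T\<^esub> pt a b"
  by (simp add: A.sign_cases T.sign_cases pt_closed pt_uminus_left)

lemma pt_sign_right: "a \<in> carrier A \<Longrightarrow> b \<in> carrier B \<Longrightarrow> pt a ([sign i] \<cdot>\<^bsub>B\<^esub> b) = [sign i] \<cdot>\<^bsub>T\<^esub> pt a b"
  by (simp add: B.sign_cases T.sign_cases pt_closed pt_uminus_right)

text \<open>The double sum over components collapses twice, first in \<open>b\<close> and then in
  \<open>a'\<close>; each collapse is a congruence modulo the relations.\<close>

lemma mult_pure:
  assumes a: "a \<in> carrier A" and b: "b \<in> grade B i" and a': "a' \<in> grade A j" and b': "b' \<in> carrier B"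
  shows "pt a b \<otimes>\<^bsub>T\<^esub> pt a' b' = [sign (i * j)] \<cdot>\<^bsub>T\<^esub> pt (a \<otimes>\<^bsub>A\<^esub> a') (b \<otimes>\<^bsub>B\<^esub> b')"
proof -
  note c = B.grade_carrier[OF b] A.grade_carrier[OF a']
  let ?f = "\<lambda>i j b a'. frag_cmul (sign (i * j)) (frag_of (a \<otimes>\<^bsub>A\<^esub> a', b \<otimes>\<^bsub>B\<^esub> b'))"
  let ?g = "\<lambda>i b. \<Sum>j\<in>hsupp A a'. ?f i j b (hcomp A a' j)"
  have 1: "(\<Sum>i\<in>hsupp B b. ?g i (hcomp B b i)) - ?g i b \<in> R"
  proof (rule B.hsum_homogeneous[OF rels_subgroup _ b])
    fix i b b2 assume "b \<in> grade B i" "b2 \<in> grade B i"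
    then have "b \<in> carrier B" "b2 \<in> carrier B" by (auto intro: B.grade_carrier)
    then show "?g i (b \<oplus>\<^bsub>B\<^esub> b2) - ?g i b - ?g i b2 \<in> R"
      using a b' c
      by (intro frag_subgroup_sum3[OF rels_subgroup])
        (simp add: B.l_distr A.hcomp_carrier B.hcomp_carrier rels_right_cmul)
  qed
  have 2: "?g i b - ?f i j b a' \<in> R"
  proof (rule A.hsum_homogeneous[OF rels_subgroup _ a'])
    fix j a' a2 assume "a' \<in> grade A j" "a2 \<in> grade A j"
    then have "a' \<in> carrier A" "a2 \<in> carrier A" by (auto intro: A.grade_carrier)
    then show "?f i j b (a' \<oplus>\<^bsub>A\<^esub> a2) - ?f i j b a' - ?f i j b a2 \<in> R"
      using a b' c by (simp add: A.r_distr rels_left_cmul)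
  qed
  have "tensor_mult_gen A B (a, b) (a', b') - ?f i j b a' \<in> R"
    using rels(4)[OF 1 2] unfolding tensor_mult_gen_pair by (simp del: minus_frag_cmul)
  then have "cl (tensor_mult_gen A B (a, b) (a', b')) = cl (?f i j b a')" by (simp add: class_eq_iff)
  then show ?thesis
    using a b' c class_mult[of "frag_of (a, b)" "frag_of (a', b')"]
      class_cmul_sign[of "frag_of (a \<otimes>\<^bsub>A\<^esub> a', b \<otimes>\<^bsub>B\<^esub> b')" "i * j"]
    unfolding pure_tensor_def by (simp add: bm_def)
qed

lemma one_T: "\<one>\<^bsub>T\<^esub> = pt \<one>\<^bsub>A\<^esub> \<one>\<^bsub>B\<^esub>"
  by (simp add: tensor_def)

text \<open>On homogeneous pure tensors, with \<open>i\<close> the degree of a left factor and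
  \<open>j\<close> that of a right factor, both bracketings carry the sign with exponent j1 i2 + j1
  i3 + j2 i3.\<close>

lemma mult_assoc:
  assumes "s \<in> carrier T" "t \<in> carrier T" "r \<in> carrier T"
  shows "s \<otimes>\<^bsub>T\<^esub> t \<otimes>\<^bsub>T\<^esub> r = s \<otimes>\<^bsub>T\<^esub> (t \<otimes>\<^bsub>T\<^esub> r)"
  using assms(1)
proof (induction s rule: tensor_induct)
  case (pure i1 j1 a1 b1)
  note p1 = pure A.grade_carrier[OF pure(1)] B.grade_carrier[OF pure(2)]
  show ?case using assms(2)
  proof (induction t rule: tensor_induct)
    case (pure i2 j2 a2 b2)
    note p2 = pure A.grade_carrier[OF pure(1)] B.grade_carrier[OF pure(2)]
    show ?case using assms(3)
    proof (induction r rule: tensor_induct)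
      case (pure i3 j3 a3 b3)
      note p3 = pure A.grade_carrier[OF pure(1)] B.grade_carrier[OF pure(2)]
      have "pt a1 b1 \<otimes>\<^bsub>T\<^esub> pt a2 b2 \<otimes>\<^bsub>T\<^esub> pt a3 b3 =
        [sign (j1 * i2)] \<cdot>\<^bsub>T\<^esub> ([sign ((j1 + j2) * i3)] \<cdot>\<^bsub>T\<^esub> pt (a1 \<otimes>\<^bsub>A\<^esub> a2 \<otimes>\<^bsub>A\<^esub> a3) (b1 \<otimes>\<^bsub>B\<^esub> b2 \<otimes>\<^bsub>B\<^esub> b3))"
        using p1 p2 p3 by (simp add: mult_pure[of _ _ j1 _ i2] mult_sign_left pt_closed
          mult_pure[of _ _ "j1 + j2" _ i3] B.grade_mult)
      moreover have "pt a1 b1 \<otimes>\<^bsub>T\<^esub> (pt a2 b2 \<otimes>\<^bsub>T\<^esub> pt a3 b3) =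
        [sign (j2 * i3)] \<cdot>\<^bsub>T\<^esub> ([sign (j1 * (i2 + i3))] \<cdot>\<^bsub>T\<^esub> pt (a1 \<otimes>\<^bsub>A\<^esub> (a2 \<otimes>\<^bsub>A\<^esub> a3)) (b1 \<otimes>\<^bsub>B\<^esub> (b2 \<otimes>\<^bsub>B\<^esub> b3)))"
        using p1 p2 p3 by (simp add: mult_pure[of _ _ j2 _ i3] mult_sign_right pt_closed
          mult_pure[of _ _ j1 _ "i2 + i3"] A.grade_mult)
      ultimately show ?case
        using p1 p2 p3 by (simp add: T.sign_sign pt_closed A.m_assoc B.m_assoc algebra_simps)
    qed (use p1 p2 in \<open>simp add: mult_add_right mult_closed pt_closed\<close>)
  qed (use p1 assms in \<open>simp add: mult_add_left mult_add_right mult_closed pt_closed\<close>)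
qed (use assms in \<open>simp add: mult_add_left mult_closed\<close>)

lemma ring_T: "ring T"
proof (rule ringI)
  show "Group.monoid T"
  proof (rule monoidI)
    show o: "\<one>\<^bsub>T\<^esub> \<in> carrier T" unfolding one_T by (simp add: pt_closed)
    show "\<one>\<^bsub>T\<^esub> \<otimes>\<^bsub>T\<^esub> s = s" if "s \<in> carrier T" for s using that
    proof (induction s rule: tensor_induct)
      case (pure i j a b)
      then show ?case unfolding one_T using mult_pure[OF _ B.grade_one, of "\<one>\<^bsub>A\<^esub>" a i b]
        by (simp add: A.grade_carrier B.grade_carrier sign_def pt_closed)
    qed (simp add: mult_add_right o)
    show "s \<otimes>\<^bsub>T\<^esub> \<one>\<^bsub>T\<^esub> = s" if "s \<in> carrier T" for s using that
    proof (induction s rule: tensor_induct)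
      case (pure i j a b)
      then show ?case unfolding one_T using mult_pure[OF _ _ A.grade_one, of a b j "\<one>\<^bsub>B\<^esub>"]
        by (simp add: A.grade_carrier B.grade_carrier sign_def pt_closed)
    qed (simp add: mult_add_left o)
  qed (simp_all add: mult_closed mult_assoc)
qed (simp_all add: abelian_group_T mult_add_left mult_add_right)

sublocale T: ring T by (rule ring_T)

end

section \<open>Differential, grading and functoriality of tensor products, as maps induced by
  bilinear maps\<close>

definition tlift :: "'c dg_ring \<Rightarrow> 'd dg_ring \<Rightarrow> ('a \<times> 'b \<Rightarrow> ('c \<times> 'd \<Rightarrow>\<^sub>0 int)) \<Rightarrow>
    ('a \<times> 'b \<Rightarrow>\<^sub>0 int) set \<Rightarrow> ('c \<times> 'd \<Rightarrow>\<^sub>0 int) set"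
  where "tlift A' B' G s = (\<Union>z\<in>s. tensor_class A' B' (frag_extend G z))"

lemma tensor_dif_tlift: "dif (tensor A B) = tlift A B (tensor_dif_gen A B)"
  by (simp add: tensor_def tlift_def fun_eq_iff)

lemma tensor_map_tlift: "tensor_map A B \<alpha> \<beta> = tlift A B (\<lambda>(a, b). frag_of (\<alpha> a, \<beta> b))"
  by (simp add: tensor_map_def tlift_def fun_eq_iff)

text \<open>The grading is generated in \<open>tensor_group A B\<close>, whereas the subgroup lemmas
  speak of \<open>add_monoid T\<close>; the two records share the fields on which
  \<open>generate\<close> depends.\<close>

lemma generate_cong:
  fixes G :: "('a, 'm) monoid_scheme" and H :: "('a, 'n) monoid_scheme"
  assumes "carrier G = carrier H" "monoid.mult G = monoid.mult H" "one G = one H"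
  shows "generate G S = generate H S"
proof -
  have m: "m_inv G = m_inv H" by (simp add: m_inv_def fun_eq_iff assms)
  have "x \<in> generate H S" if "x \<in> generate G S" for x
    using that by induction (metis assms m generate.intros)+
  moreover have "x \<in> generate G S" if "x \<in> generate H S" for x
    using that by induction (metis assms m generate.intros)+
  ultimately show ?thesis by blast
qed

context dg_pair
begin

lemma tlift_class: "bilin G (tensor_rels A' B') \<Longrightarrow> tlift A' B' G (cl x) = tensor_class A' B' (frag_extend G x)"
  unfolding tlift_def by (rule bilin_class_union)

lemma tlift_pure: "bilin G (tensor_rels A' B') \<Longrightarrow> tlift A' B' G (pt a b) = tensor_class A' B' (G (a, b))"
  unfolding pure_tensor_def by (simp add: tlift_class)

context
  fixes A' :: "'c dg_ring" and B' :: "'d dg_ring" and G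
  assumes pair': "dg_pair A' B'"
    and G: "bilin G (tensor_rels A' B')"
    and G_closed: "\<And>p. p \<in> carrier A \<times> carrier B \<Longrightarrow> Poly_Mapping.keys (G p) \<subseteq> carrier A' \<times> carrier B'"
begin

interpretation T': dg_pair A' B' by (rule pair')

lemma tlift_closed: "s \<in> carrier T \<Longrightarrow> tlift A' B' G s \<in> carrier (tensor A' B')"
  using G_closed frag_extend_closed[OF T'.F_subgroup, of _ G]
  by (elim class_cases) (simp add: tlift_class[OF G] T'.class_closed)

lemma tlift_add: "s \<in> carrier T \<Longrightarrow> t \<in> carrier T \<Longrightarrow>
    tlift A' B' G (s \<oplus>\<^bsub>T\<^esub> t) = tlift A' B' G s \<oplus>\<^bsub>tensor A' B'\<^esub> tlift A' B' G t"
  by (elim class_cases) (simp add: tlift_class[OF G] T'.class_add class_add frag_extend_add)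

lemma tlift_zero: "tlift A' B' G \<zero>\<^bsub>T\<^esub> = \<zero>\<^bsub>tensor A' B'\<^esub>"
  unfolding class_zero T'.class_zero by (simp add: tlift_class[OF G])

lemma tlift_uminus: "s \<in> carrier T \<Longrightarrow> tlift A' B' G (\<ominus>\<^bsub>T\<^esub> s) = \<ominus>\<^bsub>tensor A' B'\<^esub> tlift A' B' G s"
  using tlift_add[of "\<ominus>\<^bsub>T\<^esub> s" s]
  by (intro T'.T.minus_equality[symmetric]) (auto simp: tlift_closed T.l_neg tlift_zero)

lemma tlift_sign: "s \<in> carrier T \<Longrightarrow> tlift A' B' G ([sign i] \<cdot>\<^bsub>T\<^esub> s) = [sign i] \<cdot>\<^bsub>tensor A' B'\<^esub> tlift A' B' G s"
  by (simp add: T.sign_cases T'.T.sign_cases tlift_closed tlift_uminus)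

end

lemma dif_gen_bilin: "bilin (tensor_dif_gen A B) R"
  unfolding bilin_def
proof (intro conjI ballI)
  show "frag_subgroup R" by (rule rels_subgroup)
  fix a a' b assume ab: "a \<in> carrier A" "a' \<in> carrier A" "b \<in> carrier B"
  let ?h = "\<lambda>a. \<Sum>i \<in> hsupp A a. frag_cmul (sign i) (frag_of (hcomp A a i, dif B b))"
  have "?h (a \<oplus>\<^bsub>A\<^esub> a') - ?h a - ?h a' \<in> R"
    using ab by (intro A.hsum_additive[OF rels_subgroup])
      (auto intro!: rels_left_cmul A.grade_carrier B.dif_closed)
  moreover have "frag_of (dif A (a \<oplus>\<^bsub>A\<^esub> a'), b) - frag_of (dif A a, b) - frag_of (dif A a', b) \<in> R"
    using ab by (simp add: A.dif_add A.dif_closed rels_left)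
  ultimately have "(?h (a \<oplus>\<^bsub>A\<^esub> a') - ?h a - ?h a') +
      (frag_of (dif A (a \<oplus>\<^bsub>A\<^esub> a'), b) - frag_of (dif A a, b) - frag_of (dif A a', b)) \<in> R"
    by (rule rels(4))
  then show "tensor_dif_gen A B (a \<oplus>\<^bsub>A\<^esub> a', b) - tensor_dif_gen A B (a, b) - tensor_dif_gen A B (a', b) \<in> R"
    unfolding tensor_dif_gen_def by (simp add: algebra_simps)
next
  fix a b b' assume ab: "a \<in> carrier A" "b \<in> carrier B" "b' \<in> carrier B"
  let ?h = "\<lambda>b. \<Sum>i \<in> hsupp A a. frag_cmul (sign i) (frag_of (hcomp A a i, dif B b))"
  have "?h (b \<oplus>\<^bsub>B\<^esub> b') - ?h b - ?h b' \<in> R"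
    using ab by (intro frag_subgroup_sum3[OF rels_subgroup])
      (simp add: B.dif_add B.dif_closed A.hcomp_carrier rels_right_cmul)
  moreover have "frag_of (dif A a, b \<oplus>\<^bsub>B\<^esub> b') - frag_of (dif A a, b) - frag_of (dif A a, b') \<in> R"
    using ab by (simp add: A.dif_closed rels_right)
  ultimately have "(?h (b \<oplus>\<^bsub>B\<^esub> b') - ?h b - ?h b') +
      (frag_of (dif A a, b \<oplus>\<^bsub>B\<^esub> b') - frag_of (dif A a, b) - frag_of (dif A a, b')) \<in> R"
    by (rule rels(4))
  then show "tensor_dif_gen A B (a, b \<oplus>\<^bsub>B\<^esub> b') - tensor_dif_gen A B (a, b) - tensor_dif_gen A B (a, b') \<in> R"
    unfolding tensor_dif_gen_def by (simp add: algebra_simps)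
qed

lemma dif_gen_F: "p \<in> carrier A \<times> carrier B \<Longrightarrow> tensor_dif_gen A B p \<in> F"
  unfolding tensor_dif_gen_def split_beta
  by (intro frag_subgroupD(4)[OF F_subgroup] frag_subgroup_sum[OF F_subgroup] frag_subgroup_cmul[OF F_subgroup])
    (auto simp: A.dif_closed B.dif_closed A.hcomp_carrier)

lemma dg_pair_self: "dg_pair A B" by unfold_locales

lemmas dif_tlift = tlift_closed[OF dg_pair_self dif_gen_bilin, folded tensor_dif_tlift]
  tlift_add[OF dg_pair_self dif_gen_bilin, folded tensor_dif_tlift]
  tlift_sign[OF dg_pair_self dif_gen_bilin, folded tensor_dif_tlift]

lemma dif_T_closed: "s \<in> carrier T \<Longrightarrow> dif T s \<in> carrier T"
  and dif_T_add: "s \<in> carrier T \<Longrightarrow> t \<in> carrier T \<Longrightarrow> dif T (s \<oplus>\<^bsub>T\<^esub> t) = dif T s \<oplus>\<^bsub>T\<^esub> dif T t"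
  and dif_T_sign: "s \<in> carrier T \<Longrightarrow> dif T ([sign i] \<cdot>\<^bsub>T\<^esub> s) = [sign i] \<cdot>\<^bsub>T\<^esub> dif T s"
  using dif_tlift dif_gen_F by simp_all

lemma dif_pure:
  assumes a: "a \<in> grade A i" and b: "b \<in> carrier B"
  shows "dif T (pt a b) = pt (dif A a) b \<oplus>\<^bsub>T\<^esub> [sign i] \<cdot>\<^bsub>T\<^esub> pt a (dif B b)"
proof -
  note c = A.grade_carrier[OF a] b A.dif_closed[OF A.grade_carrier[OF a]] B.dif_closed[OF b]
  have "(\<Sum>i \<in> hsupp A a. frag_cmul (sign i) (frag_of (hcomp A a i, dif B b)))
      - frag_cmul (sign i) (frag_of (a, dif B b)) \<in> R"
    using c by (intro A.hsum_homogeneous[OF rels_subgroup _ a])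
      (auto intro!: rels_left_cmul A.grade_carrier)
  then have "tensor_dif_gen A B (a, b) - (frag_of (dif A a, b) + frag_cmul (sign i) (frag_of (a, dif B b))) \<in> R"
    unfolding tensor_dif_gen_def by (simp add: algebra_simps del: minus_frag_cmul)
  then have "dif T (pt a b) = cl (frag_of (dif A a, b) + frag_cmul (sign i) (frag_of (a, dif B b)))"
    unfolding tensor_dif_tlift tlift_pure[OF dif_gen_bilin] by (simp only: class_eq_iff)
  then show ?thesis using class_cmul_sign[of "frag_of (a, dif B b)" i] c
    by (simp add: class_add[symmetric] pure_tensor_def)
qed

lemma grade_T: "grade T n = generate (add_monoid T) {pt a b | a b. \<exists>i. a \<in> grade A i \<and> b \<in> grade B (n - i)}"
proof -
  have "grade T n = generate (tensor_group A B) {pt a b | a b. \<exists>i. a \<in> grade A i \<and> b \<in> grade B (n - i)}"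
    by (simp add: tensor_def)
  also have "\<dots> = generate (add_monoid T) {pt a b | a b. \<exists>i. a \<in> grade A i \<and> b \<in> grade B (n - i)}"
    by (rule generate_cong) (simp_all add: tensor_def)
  finally show ?thesis .
qed

lemma grade_T_gens: "{pt a b | a b. \<exists>i. a \<in> grade A i \<and> b \<in> grade B (n - i)} \<subseteq> carrier T"
  using A.grade_carrier B.grade_carrier pt_closed by blast

lemma grade_T_subgroup: "additive_subgroup (grade T n) T"
  unfolding grade_T additive_subgroup_def
  using T.add.generate_is_subgroup[OF grade_T_gens] .

sublocale T: pregraded_ring T
  by (intro pregraded_ring.intro pregraded_ring_axioms.intro T.ring_axioms grade_T_subgroup)

lemma pt_grade: "a \<in> grade A i \<Longrightarrow> b \<in> grade B j \<Longrightarrow> pt a b \<in> grade T (i + j)"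
  unfolding grade_T by (rule generate.incl) force

lemma grade_T_induct [consumes 1, case_names pure add]:
  assumes "s \<in> grade T n"
    and pure: "\<And>i a b. a \<in> grade A i \<Longrightarrow> b \<in> grade B (n - i) \<Longrightarrow> P (pt a b)"
    and add: "\<And>s t. s \<in> grade T n \<Longrightarrow> t \<in> grade T n \<Longrightarrow> P s \<Longrightarrow> P t \<Longrightarrow> P (s \<oplus>\<^bsub>T\<^esub> t)"
  shows "P s"
  using assms(1) unfolding grade_T
proof (induction s rule: generate.induct)
  case one
  then show ?case using pure[OF A.zero_grade B.zero_grade] by (simp add: pt_zero_left)
next
  case (incl h)
  then show ?case using pure by blast
next
  case (inv h)
  then obtain a b i where h: "h = pt a b" "a \<in> grade A i" "b \<in> grade B (n - i)" by blast
  then have "inv\<^bsub>add_monoid T\<^esub> h = pt (\<ominus>\<^bsub>A\<^esub> a) b"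
    by (simp add: pt_uminus_left A.grade_carrier B.grade_carrier a_inv_def[symmetric])
  then show ?case using pure[of "\<ominus>\<^bsub>A\<^esub> a" i b] h by (simp add: A.uminus_grade)
next
  case (eng h1 h2)
  then show ?case using add unfolding grade_T by simp
qed

text \<open>Represents the projection of the tensor product onto degree \<open>n\<close>, the sum of
  all a_i tensor b_(n-i). The grading is only given by generators, and these projections show that
  the sum of its pieces is direct.\<close>

definition "proj_gen n = (\<lambda>(a, b). \<Sum>i\<in>hsupp A a. frag_of (hcomp A a i, hcomp B b (n - i)))"

lemma proj_gen_bilin: "bilin (proj_gen n) R"
  unfolding bilin_def proj_gen_def split
proof (intro conjI ballI)
  show "frag_subgroup R" by (rule rels_subgroup)
next
  fix a a' b assume "a \<in> carrier A" "a' \<in> carrier A" "b \<in> carrier B"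
  then show "(\<Sum>i\<in>hsupp A (a \<oplus>\<^bsub>A\<^esub> a'). frag_of (hcomp A (a \<oplus>\<^bsub>A\<^esub> a') i, hcomp B b (n - i)))
      - (\<Sum>i\<in>hsupp A a. frag_of (hcomp A a i, hcomp B b (n - i)))
      - (\<Sum>i\<in>hsupp A a'. frag_of (hcomp A a' i, hcomp B b (n - i))) \<in> R"
    by (intro A.hsum_additive[OF rels_subgroup, where G = "\<lambda>i a. frag_of (a, hcomp B b (n - i))"])
      (auto intro!: rels_left A.grade_carrier B.hcomp_carrier)
next
  fix a b b' assume "a \<in> carrier A" "b \<in> carrier B" "b' \<in> carrier B"
  then show "(\<Sum>i\<in>hsupp A a. frag_of (hcomp A a i, hcomp B (b \<oplus>\<^bsub>B\<^esub> b') (n - i)))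
      - (\<Sum>i\<in>hsupp A a. frag_of (hcomp A a i, hcomp B b (n - i)))
      - (\<Sum>i\<in>hsupp A a. frag_of (hcomp A a i, hcomp B b' (n - i))) \<in> R"
    by (intro frag_subgroup_sum3[OF rels_subgroup])
      (simp add: B.hcomp_add rels_right A.hcomp_carrier B.hcomp_carrier)
qed

lemma proj_gen_F: "p \<in> carrier A \<times> carrier B \<Longrightarrow> proj_gen n p \<in> F"
  unfolding proj_gen_def split_beta
  by (intro frag_subgroup_sum[OF F_subgroup]) (auto simp: A.hcomp_carrier B.hcomp_carrier)

lemma proj_pure:
  assumes a: "a \<in> grade A i" and b: "b \<in> grade B j"
  shows "tlift A B (proj_gen n) (pt a b) = (if n = i + j then pt a b else \<zero>\<^bsub>T\<^esub>)"
proof -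
  have "proj_gen n (a, b) - frag_of (a, hcomp B b (n - i)) \<in> R"
    unfolding proj_gen_def split
    using B.grade_carrier[OF b]
    by (intro A.hsum_homogeneous[OF rels_subgroup _ a, where G = "\<lambda>i a. frag_of (a, hcomp B b (n - i))"])
      (auto intro!: rels_left A.grade_carrier B.hcomp_carrier)
  then have "tlift A B (proj_gen n) (pt a b) = pt a (hcomp B b (n - i))"
    unfolding tlift_pure[OF proj_gen_bilin] unfolding pure_tensor_def by (simp add: class_eq_iff)
  then show ?thesis using a b by (auto simp: B.hcomp_homogeneous pt_zero_right A.grade_carrier)
qed

lemmas proj_lift = tlift_closed[OF dg_pair_self proj_gen_bilin] tlift_add[OF dg_pair_self proj_gen_bilin]

lemma dg_ring_T: "dg_ring T"
proof (intro dg_ring.intro dg_ring_axioms.intro)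
  fix i s
  note pl = proj_lift[OF proj_gen_F[unfolded mem_Collect_eq]]
  assume "s \<in> carrier T"
  show "\<exists>!c. decomposition T s c"
  \<comment> \<open>Existence of a decomposition passes through sums of pure tensors; uniqueness is
    supplied by the projections \<open>proj_gen\<close>.\<close>
  proof (rule T.direct_sumI[of "\<lambda>n. tlift A B (proj_gen n)"])
    fix n t assume "t \<in> grade T n"
    then show "tlift A B (proj_gen n) t = t"
      by (induction rule: grade_T_induct) (simp_all add: proj_pure pl T.grade_carrier)
  next
    fix n m t assume "n \<noteq> m" "t \<in> grade T m"
    from this(2) this(1) show "tlift A B (proj_gen n) t = \<zero>\<^bsub>T\<^esub>"
      by (induction rule: grade_T_induct) (auto simp: proj_pure pl T.grade_carrier)
  next
    show "\<exists>c. decomposition T s c" using \<open>s \<in> carrier T\<close>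
    proof (induction s rule: tensor_induct)
      case (pure i j a b)
      then show ?case using T.decomposition_homogeneous[OF pt_grade] by blast
    next
      case (add s t)
      then show ?case using T.decomposition_add by blast
    qed
  qed (simp_all add: pl)
next
  show "\<one>\<^bsub>T\<^esub> \<in> grade T 0"
    unfolding one_T using pt_grade[OF A.grade_one B.grade_one] by simp
next
  fix s t i j assume s: "s \<in> grade T i" and t: "t \<in> grade T j"
  from s show "s \<otimes>\<^bsub>T\<^esub> t \<in> grade T (i + j)"
  proof (induction s rule: grade_T_induct)
    case p: (pure k a b)
    from t show ?case
    proof (induction t rule: grade_T_induct)
      case (pure l a' b')
      have "pt (a \<otimes>\<^bsub>A\<^esub> a') (b \<otimes>\<^bsub>B\<^esub> b') \<in> grade T ((k + l) + ((i - k) + (j - l)))"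
        using p pure by (intro pt_grade A.grade_mult B.grade_mult)
      then have "pt (a \<otimes>\<^bsub>A\<^esub> a') (b \<otimes>\<^bsub>B\<^esub> b') \<in> grade T (i + j)" by (simp add: algebra_simps)
      then show ?case using p pure
        by (simp add: mult_pure A.grade_carrier B.grade_carrier T.sign_cases T.grade_carrier T.uminus_grade)
    next
      case (add t t')
      then show ?case using p
        by (simp add: T.r_distr T.grade_carrier pt_closed A.grade_carrier B.grade_carrier T.add_grade)
    qed
  next
    case (add s s')
    then show ?case using t by (simp add: T.l_distr T.grade_carrier T.add_grade)
  qed
next
  fix s t assume "s \<in> carrier T" "t \<in> carrier T"
  then show "dif T (s \<oplus>\<^bsub>T\<^esub> t) = dif T s \<oplus>\<^bsub>T\<^esub> dif T t" by (rule dif_T_add)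
next
  fix s i assume "s \<in> grade T i"
  then show "dif T s \<in> grade T (i + 1)"
  proof (induction s rule: grade_T_induct)
    case (pure k a b)
    have "pt (dif A a) b \<in> grade T ((k + 1) + (i - k))" "pt a (dif B b) \<in> grade T (k + ((i - k) + 1))"
      using pt_grade[OF A.dif_grade[OF pure(1)] pure(2)] pt_grade[OF pure(1) B.dif_grade[OF pure(2)]]
      by simp_all
    then have "pt (dif A a) b \<in> grade T (i + 1)" "pt a (dif B b) \<in> grade T (i + 1)"
      by (simp_all add: algebra_simps)
    then show ?case using pure
      by (simp add: dif_pure B.grade_carrier T.sign_cases T.grade_carrier T.uminus_grade T.add_grade)
  next
    case (add s t)
    then show ?case by (simp add: dif_T_add T.grade_carrier T.add_grade)
  qed
next
  fix s assume "s \<in> carrier T"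
  then show "dif T (dif T s) = \<zero>\<^bsub>T\<^esub>"
  proof (induction s rule: tensor_induct)
    case (pure i j a b)
    note c = A.grade_carrier[OF pure(1)] B.grade_carrier[OF pure(2)]
    note d = A.dif_closed[OF c(1)] B.dif_closed[OF c(2)]
    \<comment> \<open>Only the mixed term survives. It occurs with the signs of \<open>i + 1\<close>
      and of \<open>i\<close>, because \<open>dif A a\<close> has degree one more than
      \<open>a\<close>, and so it cancels.\<close>
    have "dif T (dif T (pt a b)) = [sign (i + 1)] \<cdot>\<^bsub>T\<^esub> pt (dif A a) (dif B b) \<oplus>\<^bsub>T\<^esub> [sign i] \<cdot>\<^bsub>T\<^esub> pt (dif A a) (dif B b)"
      using pure c d by (simp add: dif_pure[of _ i] dif_pure[of _ "i + 1"] A.dif_grade dif_T_add dif_T_sign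
        pt_closed T.sign_closed A.dif_dif B.dif_dif pt_zero_left pt_zero_right)
    then show ?case using c d by (auto simp: T.sign_cases pt_closed T.l_neg T.r_neg)
  next
    case (add s t)
    then show ?case by (simp add: dif_T_add dif_T_closed)
  qed
next
  fix s t i assume s: "s \<in> grade T i" and t: "t \<in> carrier T"
  from s show "dif T (s \<otimes>\<^bsub>T\<^esub> t) = dif T s \<otimes>\<^bsub>T\<^esub> t \<oplus>\<^bsub>T\<^esub> [sign i] \<cdot>\<^bsub>T\<^esub> (s \<otimes>\<^bsub>T\<^esub> dif T t)"
  proof (induction s rule: grade_T_induct)
    case p: (pure k a b)
    note c = A.grade_carrier[OF p(1)] B.grade_carrier[OF p(2)]
    note d = A.dif_closed[OF c(1)] B.dif_closed[OF c(2)]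
    from t show ?case
    proof (induction t rule: tensor_induct)
      case (pure l m a' b')
      note c' = A.grade_carrier[OF pure(1)] B.grade_carrier[OF pure(2)]
      note d' = A.dif_closed[OF c'(1)] B.dif_closed[OF c'(2)]
      note cl = pt_closed c d c' d' A.m_closed B.m_closed
      \<comment> \<open>The four terms of the Leibniz rule without their signs: the differential
        falls on \<open>a\<close>, on \<open>a'\<close>, on \<open>b\<close>, on
        \<open>b'\<close>.\<close>
      define x1 x2 x3 x4 where "x1 = pt (dif A a \<otimes>\<^bsub>A\<^esub> a') (b \<otimes>\<^bsub>B\<^esub> b')"
        and "x2 = pt (a \<otimes>\<^bsub>A\<^esub> dif A a') (b \<otimes>\<^bsub>B\<^esub> b')"
        and "x3 = pt (a \<otimes>\<^bsub>A\<^esub> a') (dif B b \<otimes>\<^bsub>B\<^esub> b')"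
        and "x4 = pt (a \<otimes>\<^bsub>A\<^esub> a') (b \<otimes>\<^bsub>B\<^esub> dif B b')"
      note x_def = x1_def x2_def x3_def x4_def
      have x: "x1 \<in> carrier T" "x2 \<in> carrier T" "x3 \<in> carrier T" "x4 \<in> carrier T"
        unfolding x_def using cl by auto
      let ?s = "\<lambda>i x. [sign i] \<cdot>\<^bsub>T\<^esub> x"
      have "dif T (pt a b \<otimes>\<^bsub>T\<^esub> pt a' b') = ?s ((i - k) * l) (dif T (pt (a \<otimes>\<^bsub>A\<^esub> a') (b \<otimes>\<^bsub>B\<^esub> b')))"
        using p pure cl by (simp add: mult_pure dif_T_sign)
      also have "dif T (pt (a \<otimes>\<^bsub>A\<^esub> a') (b \<otimes>\<^bsub>B\<^esub> b')) =
        (x1 \<oplus>\<^bsub>T\<^esub> ?s k x2) \<oplus>\<^bsub>T\<^esub> ?s (k + l) (x3 \<oplus>\<^bsub>T\<^esub> ?s (i - k) x4)"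
        using p pure cl by (simp add: dif_pure[of _ "k + l"] A.grade_mult A.dif_mult[of _ k] B.dif_mult[of _ "i - k"]
            pt_add_left pt_add_right pt_sign_left pt_sign_right A.sign_closed B.sign_closed x_def)
      finally have L: "dif T (pt a b \<otimes>\<^bsub>T\<^esub> pt a' b') = ?s ((i - k) * l)
        ((x1 \<oplus>\<^bsub>T\<^esub> ?s k x2) \<oplus>\<^bsub>T\<^esub> ?s (k + l) (x3 \<oplus>\<^bsub>T\<^esub> ?s (i - k) x4))" .
      have R1: "dif T (pt a b) \<otimes>\<^bsub>T\<^esub> pt a' b' = ?s ((i - k) * l) x1 \<oplus>\<^bsub>T\<^esub> ?s k (?s ((i - k + 1) * l) x3)"
        using p pure cl by (simp add: dif_pure[of _ k] T.l_distr T.sign_closed mult_sign_left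
            mult_pure[of _ _ "i - k" _ l] mult_pure[of _ _ "i - k + 1" _ l] B.dif_grade x_def)
      have R2: "pt a b \<otimes>\<^bsub>T\<^esub> dif T (pt a' b') = ?s ((i - k) * (l + 1)) x2 \<oplus>\<^bsub>T\<^esub> ?s l (?s ((i - k) * l) x4)"
        using p pure cl by (simp add: dif_pure[of _ l] T.r_distr T.sign_closed mult_sign_right
            mult_pure[of _ _ "i - k" _ l] mult_pure[of _ _ "i - k" _ "l + 1"] A.dif_grade x_def)
      \<comment> \<open>Both sides are signed sums of the same four terms, and every sign depends
        only on the parities of \<open>i\<close>, \<open>k\<close> and \<open>l\<close>.\<close>
      show ?case unfolding L R1 R2
        using x by (cases "even i"; cases "even k"; cases "even l")
          (simp_all add: T.sign_cases T.minus_add T.a_ac)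
    next
      case (add t t')
      then show ?case using p c
        by (simp add: T.r_distr pt_closed mult_closed dif_T_add dif_T_closed T.sign_add T.a_ac T.sign_closed)
    qed
  next
    case (add s s')
    then show ?case using t
      by (simp add: T.l_distr T.grade_carrier mult_closed dif_T_add dif_T_closed T.sign_add T.a_ac T.sign_closed)
  qed
qed (rule T.ring_axioms, rule grade_T_subgroup)

sublocale T: dg_ring T by (rule dg_ring_T)

end

lemma dg_map_tensor_map:
  assumes "dg_pair A B" "dg_pair A' B'" and \<alpha>: "dg_map A A' \<alpha>" and \<beta>: "dg_map B B' \<beta>"
  shows "dg_map (tensor A B) (tensor A' B') (tensor_map A' B' \<alpha> \<beta>)"
    and "a \<in> carrier A \<Longrightarrow> b \<in> carrier B \<Longrightarrow> tensor_map A' B' \<alpha> \<beta> (pure_tensor A B a b) = pure_tensor A' B' (\<alpha> a) (\<beta> b)"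
proof -
  interpret dg_pair A B by fact
  interpret T': dg_pair A' B' by fact
  interpret \<alpha>: dg_hom_pair A A' \<alpha> using \<alpha> by unfold_locales
  interpret \<beta>: dg_hom_pair B B' \<beta> using \<beta> by unfold_locales
  let ?G = "\<lambda>(a, b). frag_of (\<alpha> a, \<beta> b)"
  have bi: "bilin ?G T'.R"
    unfolding bilin_def split using T'.rels_subgroup T'.rels_left T'.rels_right
    by (simp add: \<alpha>.hD \<beta>.hD)
  have "Poly_Mapping.keys (?G p) \<subseteq> carrier A' \<times> carrier B'" if "p \<in> carrier A \<times> carrier B" for p
    using that by (auto simp: \<alpha>.hD \<beta>.hD)
  note h = tlift_closed[OF T'.dg_pair_self bi this] tlift_add[OF T'.dg_pair_self bi this]
    tlift_sign[OF T'.dg_pair_self bi this]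
  have pure: "tlift A' B' ?G (pt a b) = T'.pt (\<alpha> a) (\<beta> b)" for a b
    unfolding tlift_pure[OF bi] by (simp add: pure_tensor_def)
  show "a \<in> carrier A \<Longrightarrow> b \<in> carrier B \<Longrightarrow> tensor_map A' B' \<alpha> \<beta> (pt a b) = T'.pt (\<alpha> a) (\<beta> b)"
    unfolding tensor_map_tlift pure ..
  show "dg_map T T'.T (tensor_map A' B' \<alpha> \<beta>)"
    unfolding tensor_map_tlift
  proof (rule dg_mapI)
    fix s i assume "s \<in> grade T i"
    then show "tlift A' B' ?G s \<in> grade T'.T i"
    proof (induction s rule: grade_T_induct)
      case (pure k a b)
      then show ?case using T'.pt_grade[of "\<alpha> a" k "\<beta> b" "i - k"]
        by (simp add: \<open>\<And>a b. tlift A' B' ?G (pt a b) = _\<close> \<alpha>.hD \<beta>.hD)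
    qed (simp add: h T.grade_carrier T'.T.add_grade)
  next
    fix s assume "s \<in> carrier T"
    then show "tlift A' B' ?G (dif T s) = dif T'.T (tlift A' B' ?G s)"
    proof (induction s rule: tensor_induct)
      case (pure i j a b)
      note c = A.grade_carrier[OF pure(1)] B.grade_carrier[OF pure(2)]
      note d = A.dif_closed[OF c(1)] B.dif_closed[OF c(2)]
      show ?case using pure c d
        by (simp add: dif_pure[of _ i] h pt_closed T.sign_closed
          \<open>\<And>a b. tlift A' B' ?G (pt a b) = _\<close> \<alpha>.hD \<beta>.hD T'.dif_pure[of _ i])
    qed (simp add: h T.dif_add T.dif_closed T'.T.dif_add)
  next
    fix s t assume s: "s \<in> carrier T" and t: "t \<in> carrier T"
    from s show "tlift A' B' ?G (s \<otimes>\<^bsub>T\<^esub> t) = tlift A' B' ?G s \<otimes>\<^bsub>T'.T\<^esub> tlift A' B' ?G t"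
    proof (induction s rule: tensor_induct)
      case p: (pure i j a b)
      note c = A.grade_carrier[OF p(1)] B.grade_carrier[OF p(2)]
      from t show ?case
      proof (induction t rule: tensor_induct)
        case p': (pure k l a' b')
        note c' = A.grade_carrier[OF p'(1)] B.grade_carrier[OF p'(2)]
        show ?case using p p' c c'
          by (simp add: mult_pure[of _ _ j _ k] h pt_closed T.sign_closed pure
             \<alpha>.hD \<beta>.hD T'.mult_pure[of _ _ j _ k])
      qed (use c in \<open>simp add: T.r_distr pt_closed h T'.T.r_distr\<close>)
    qed (use t in \<open>simp add: T.l_distr h T'.T.l_distr\<close>)
  qed (simp_all add: h one_T T'.one_T pure \<alpha>.hD \<beta>.hD)
qed

text \<open>With the cochains of the 0-simplex as left factor, this is the map through which
  \<open>SHom_obj\<close> turns a homomorphism into a vertex.\<close>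

lemma (in dg_pair) dg_map_pure_one: "dg_map B T (pt \<one>\<^bsub>A\<^esub>)"
proof (rule dg_mapI)
  fix b i assume "b \<in> grade B i"
  then show "pt \<one>\<^bsub>A\<^esub> b \<in> grade T i" using pt_grade[OF A.grade_one] by force
next
  fix b assume "b \<in> carrier B"
  then show "pt \<one>\<^bsub>A\<^esub> (dif B b) = dif T (pt \<one>\<^bsub>A\<^esub> b)"
    using dif_pure[OF A.grade_one, of b]
    by (simp add: A.dif_one pt_zero_left pt_closed B.dif_closed T.sign_cases)
next
  fix b b' assume b: "b \<in> carrier B" and b': "b' \<in> carrier B"
  from b show "pt \<one>\<^bsub>A\<^esub> (b \<otimes>\<^bsub>B\<^esub> b') = pt \<one>\<^bsub>A\<^esub> b \<otimes>\<^bsub>T\<^esub> pt \<one>\<^bsub>A\<^esub> b'"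
  proof (induction b rule: B.graded_induct)
    case (homogeneous i b)
    then show ?case using b' mult_pure[OF _ homogeneous A.grade_one, of "\<one>\<^bsub>A\<^esub>" b']
      by (simp add: T.sign_cases pt_closed B.grade_carrier)
  next
    case (add b c)
    then show ?case using b' by (simp add: B.l_distr pt_add_right pt_closed T.l_distr)
  qed
qed (simp_all add: pt_closed pt_add_right one_T)

section \<open>Normalized cochains of a simplicial set\<close>

definition monomap :: "nat \<Rightarrow> nat \<Rightarrow> (nat \<Rightarrow> nat) \<Rightarrow> bool"
  where "monomap m n \<theta> \<longleftrightarrow> (\<forall>k\<le>m. \<theta> k \<le> n) \<and> (\<forall>j k. j \<le> k \<longrightarrow> k \<le> m \<longrightarrow> \<theta> j \<le> \<theta> k)"

lemma plus_0_id: "(+) (0::nat) = (\<lambda>k. k)"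
  by auto

locale simplicial_set =
  fixes X :: "'x sset"
  assumes act_closed: "monomap m n \<theta> \<Longrightarrow> x \<in> simplices X n \<Longrightarrow> act X m n \<theta> x \<in> simplices X m"
    and act_act: "monomap m n \<theta> \<Longrightarrow> monomap l m \<eta> \<Longrightarrow> x \<in> simplices X n \<Longrightarrow>
      act X l m \<eta> (act X m n \<theta> x) = act X l n (\<lambda>k. \<theta> (\<eta> k)) x"
    and act_cong: "(\<And>k. k \<le> m \<Longrightarrow> \<theta> k = \<theta>' k) \<Longrightarrow> act X m n \<theta> x = act X m n \<theta>' x"
    and act_id: "x \<in> simplices X n \<Longrightarrow> act X n n (\<lambda>k. k) x = x"
begin

abbreviation "C \<equiv> cochain_ring X"
abbreviation "front m n x \<equiv> act X m n (\<lambda>k. k) x"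
abbreviation "back r m n x \<equiv> act X m n (\<lambda>k. r + k) x"

text \<open>The simplicial identities below reduce to a pointwise comparison of two composites of
  monotone maps.\<close>

lemma act_act_eq:
  assumes "monomap m n \<theta>" "monomap l m \<eta>" "monomap m' n \<theta>'" "monomap l m' \<eta>'" "x \<in> simplices X n"
    and "\<And>k. k \<le> l \<Longrightarrow> \<theta> (\<eta> k) = \<theta>' (\<eta>' k)"
  shows "act X l m \<eta> (act X m n \<theta> x) = act X l m' \<eta>' (act X m' n \<theta>' x)"
  using assms act_cong[of l "\<lambda>k. \<theta> (\<eta> k)" "\<lambda>k. \<theta>' (\<eta>' k)" n x] by (simp add: act_act)

lemma act_act_eq1:
  assumes "monomap m n \<theta>" "monomap l m \<eta>" "x \<in> simplices X n"
    and "\<And>k. k \<le> l \<Longrightarrow> \<theta> (\<eta> k) = \<theta>' k"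
  shows "act X l m \<eta> (act X m n \<theta> x) = act X l n \<theta>' x"
  using assms act_cong[of l "\<lambda>k. \<theta> (\<eta> k)" \<theta>' n x] by (simp add: act_act)

lemma face_closed: "n \<ge> 1 \<Longrightarrow> i \<le> n \<Longrightarrow> x \<in> simplices X n \<Longrightarrow> face X n i x \<in> simplices X (n - 1)"
  unfolding face_def by (rule act_closed) (auto simp: monomap_def)

lemma degen_closed: "i \<le> n \<Longrightarrow> x \<in> simplices X n \<Longrightarrow> degen X n i x \<in> simplices X (n + 1)"
  unfolding degen_def by (rule act_closed) (auto simp: monomap_def)

lemma front_closed: "m \<le> n \<Longrightarrow> x \<in> simplices X n \<Longrightarrow> front m n x \<in> simplices X m"
  by (rule act_closed) (auto simp: monomap_def)

lemma back_closed: "r + m \<le> n \<Longrightarrow> x \<in> simplices X n \<Longrightarrow> back r m n x \<in> simplices X m"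
  by (rule act_closed) (auto simp: monomap_def)

lemma degenerateE:
  assumes "x \<in> degenerate X n"
  obtains m i y where "n = m + 1" "i \<le> m" "y \<in> simplices X m" "x = degen X m i y"
  using assms unfolding degenerate_def by blast

lemma degenerateI: "i \<le> m \<Longrightarrow> y \<in> simplices X m \<Longrightarrow> n = m + 1 \<Longrightarrow> x = degen X m i y \<Longrightarrow> x \<in> degenerate X n"
  unfolding degenerate_def by blast

lemma face_degen_low:
  assumes "k < i" "i \<le> m" "y \<in> simplices X m"
  shows "face X (m + 1) k (degen X m i y) \<in> degenerate X m"
proof (rule degenerateI)
  show "i - 1 \<le> m - 1" "m = m - 1 + 1" "face X m k y \<in> simplices X (m - 1)"
    using assms face_closed[of m k y] by auto
  show "face X (m + 1) k (degen X m i y) = degen X (m - 1) (i - 1) (face X m k y)"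
    unfolding face_def degen_def using assms
    by (auto simp: monomap_def intro!: act_act_eq)
qed

lemma face_degen_high:
  assumes "i + 1 < k" "k \<le> m + 1" "y \<in> simplices X m"
  shows "face X (m + 1) k (degen X m i y) \<in> degenerate X m"
proof (rule degenerateI)
  show "i \<le> m - 1" "m = m - 1 + 1" "face X m (k - 1) y \<in> simplices X (m - 1)"
    using assms face_closed[of m "k - 1" y] by auto
  show "face X (m + 1) k (degen X m i y) = degen X (m - 1) i (face X m (k - 1) y)"
    unfolding face_def degen_def using assms
    by (auto simp: monomap_def intro!: act_act_eq)
qed

lemma face_degen_mid:
  assumes "k = i \<or> k = i + 1" "i \<le> m" "y \<in> simplices X m"
  shows "face X (m + 1) k (degen X m i y) = y"
proof -
  have "face X (m + 1) k (degen X m i y) = front m m y"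
    unfolding face_def degen_def using assms
    by (auto simp: monomap_def intro!: act_act_eq1)
  then show ?thesis using act_id[OF assms(3)] by simp
qed

lemma face_face:
  assumes "l < k" "k \<le> n" "2 \<le> n" "x \<in> simplices X n"
  shows "face X (n - 1) l (face X n k x) = face X (n - 1) (k - 1) (face X n l x)"
  unfolding face_def using assms by (auto simp: monomap_def intro!: act_act_eq)

lemma front_degen_high:
  assumes "i < p" "p \<le> m + 1" "y \<in> simplices X m"
  shows "front p (m + 1) (degen X m i y) \<in> degenerate X p"
proof (rule degenerateI)
  show "i \<le> p - 1" "p = p - 1 + 1" "front (p - 1) m y \<in> simplices X (p - 1)"
    using assms by (auto intro!: front_closed)
  show "front p (m + 1) (degen X m i y) = degen X (p - 1) i (front (p - 1) m y)"
    unfolding degen_def using assms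
    by (auto simp: monomap_def intro!: act_act_eq)
qed

lemma back_degen_low:
  assumes "p \<le> i" "i \<le> m" "y \<in> simplices X m"
  shows "back p (m + 1 - p) (m + 1) (degen X m i y) \<in> degenerate X (m + 1 - p)"
proof (rule degenerateI)
  show "i - p \<le> m - p" "m + 1 - p = m - p + 1" "back p (m - p) m y \<in> simplices X (m - p)"
    using assms by (auto intro!: back_closed)
  show "back p (m + 1 - p) (m + 1) (degen X m i y) = degen X (m - p) (i - p) (back p (m - p) m y)"
    unfolding degen_def \<open>m + 1 - p = m - p + 1\<close> using assms
    by (auto simp: monomap_def intro!: act_act_eq)
qed

lemma cochainsD:
  assumes "\<phi> \<in> cochains X"
  shows "\<And>p x. x \<notin> simplices X p \<Longrightarrow> \<phi> p x = 0" "\<And>p x. x \<in> degenerate X p \<Longrightarrow> \<phi> p x = 0"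
    "finite {p. \<phi> p \<noteq> (\<lambda>_. 0)}"
  using assms unfolding cochains_def by blast+

lemma cochain_bound:
  assumes "\<phi> \<in> cochains X" obtains N where "\<And>p x. p > N \<Longrightarrow> \<phi> p x = 0"
proof -
  obtain N where "\<forall>p\<in>{p. \<phi> p \<noteq> (\<lambda>_. 0)}. p \<le> N"
    using cochainsD(3)[OF assms] finite_nat_set_iff_bounded_le by blast
  then have "\<phi> p = (\<lambda>_. 0)" if "p > N" for p using that by force
  then have "\<phi> p x = 0" if "p > N" for p x using that by simp
  then show ?thesis by (rule that)
qed

lemma cochainsI:
  assumes "\<And>p x. x \<notin> simplices X p \<Longrightarrow> \<phi> p x = 0" "\<And>p x. x \<in> degenerate X p \<Longrightarrow> \<phi> p x = 0"
    and "\<And>p x. p > N \<Longrightarrow> \<phi> p x = 0"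
  shows "\<phi> \<in> cochains X"
proof -
  have "{p. \<phi> p \<noteq> (\<lambda>_. 0)} \<subseteq> {..N}" using assms(3) by fastforce
  then show ?thesis unfolding cochains_def using assms(1,2) finite_subset by blast
qed

lemma C_simps:
  "carrier C = cochains X"
  "\<phi> \<otimes>\<^bsub>C\<^esub> \<psi> = (\<lambda>n x. if x \<in> simplices X n
     then \<Sum>p\<le>n. \<phi> p (front p n x) * \<psi> (n - p) (back p (n - p) n x) else 0)"
  "\<one>\<^bsub>C\<^esub> = (\<lambda>p x. if p = 0 \<and> x \<in> simplices X 0 then 1 else 0)"
  "\<zero>\<^bsub>C\<^esub> = (\<lambda>p x. 0)"
  "\<phi> \<oplus>\<^bsub>C\<^esub> \<psi> = (\<lambda>p x. \<phi> p x + \<psi> p x)"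
  "grade C i = {\<phi> \<in> cochains X. \<forall>p. int p \<noteq> i \<longrightarrow> \<phi> p = (\<lambda>_. 0)}"
  "dif C \<phi> = (\<lambda>n x. if n \<ge> 1 \<and> x \<in> simplices X n
     then \<Sum>i\<le>n. (- 1) ^ i * \<phi> (n - 1) (face X n i x) else 0)"
  by (simp_all add: cochain_ring_def)

lemma cochain_add: "\<phi> \<in> cochains X \<Longrightarrow> \<psi> \<in> cochains X \<Longrightarrow> (\<lambda>p x. \<phi> p x + \<psi> p x) \<in> cochains X"
proof -
  assume *: "\<phi> \<in> cochains X" "\<psi> \<in> cochains X"
  obtain M N where "\<And>p x. p > M \<Longrightarrow> \<phi> p x = 0" "\<And>p x. p > N \<Longrightarrow> \<psi> p x = 0"
    using * cochain_bound by metis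
  then show ?thesis using * by (intro cochainsI[of _ "max M N"]) (simp_all add: cochainsD)
qed

lemma cochain_scale: "\<phi> \<in> cochains X \<Longrightarrow> (\<lambda>p x. c * \<phi> p x) \<in> cochains X"
proof -
  assume *: "\<phi> \<in> cochains X"
  obtain M where "\<And>p x. p > M \<Longrightarrow> \<phi> p x = 0" using * cochain_bound by metis
  then show ?thesis using * by (intro cochainsI[of _ M]) (simp_all add: cochainsD)
qed

lemma cochain_uminus: "\<phi> \<in> cochains X \<Longrightarrow> (\<lambda>p x. - \<phi> p x) \<in> cochains X"
  using cochain_scale[of \<phi> "-1"] by simp

lemma cochain_zero: "(\<lambda>p x. 0) \<in> cochains X"
  by (rule cochainsI[of _ 0]) simp_all

text \<open>On a degenerate simplex s_i y the front face of dimension \<open>p\<close> is degenerate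
  if \<open>i < p\<close>, and otherwise the complementary back face is, so every term of the
  product vanishes.\<close>

lemma cochain_mult: "\<phi> \<in> cochains X \<Longrightarrow> \<psi> \<in> cochains X \<Longrightarrow> \<phi> \<otimes>\<^bsub>C\<^esub> \<psi> \<in> cochains X"
proof -
  assume *: "\<phi> \<in> cochains X" "\<psi> \<in> cochains X"
  obtain M N where MN: "\<And>p x. p > M \<Longrightarrow> \<phi> p x = 0" "\<And>p x. p > N \<Longrightarrow> \<psi> p x = 0"
    using * cochain_bound by metis
  show ?thesis
  proof (rule cochainsI[of _ "M + N"])
    fix n x assume n: "n > M + N"
    have "\<phi> p y * \<psi> (n - p) z = 0" if "p \<le> n" for p y z
      using MN(1)[of p] MN(2)[of "n - p"] n that by (cases "p > M") auto
    then have "(\<Sum>p\<le>n. \<phi> p (front p n x) * \<psi> (n - p) (back p (n - p) n x)) = 0"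
      by (intro sum.neutral ballI) blast
    then show "(\<phi> \<otimes>\<^bsub>C\<^esub> \<psi>) n x = 0" by (simp add: C_simps)
  next
    fix n x assume "x \<in> degenerate X n"
    then obtain m i y where d: "n = m + 1" "i \<le> m" "y \<in> simplices X m" "x = degen X m i y"
      by (rule degenerateE)
    have "\<phi> p (front p n x) * \<psi> (n - p) (back p (n - p) n x) = 0" if "p \<le> n" for p
    proof (cases "i < p")
      case True
      then show ?thesis using front_degen_high[OF True _ d(3)] that cochainsD(2)[OF *(1)] d by simp
    next
      case False
      then show ?thesis using back_degen_low[of p i m y] cochainsD(2)[OF *(2)] d by simp
    qed
    then have "(\<Sum>p\<le>n. \<phi> p (front p n x) * \<psi> (n - p) (back p (n - p) n x)) = 0"
      by (intro sum.neutral ballI) blast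
    then show "(\<phi> \<otimes>\<^bsub>C\<^esub> \<psi>) n x = 0" by (simp add: C_simps)
  qed (simp add: C_simps)
qed

lemma cochain_one: "\<one>\<^bsub>C\<^esub> \<in> cochains X"
  by (rule cochainsI[of _ 0]) (auto simp: C_simps elim!: degenerateE)

text \<open>All faces of s_i y are degenerate except those with index \<open>i\<close> and
  \<open>i + 1\<close>. These two both equal y and enter with opposite signs.\<close>

lemma cochain_dif:
  assumes "\<phi> \<in> cochains X" shows "dif C \<phi> \<in> cochains X"
proof -
  obtain M where M: "\<And>p x. p > M \<Longrightarrow> \<phi> p x = 0" using assms cochain_bound by metis
  show ?thesis
  proof (rule cochainsI[of _ "M + 1"])
    fix n x assume "n > M + 1"
    then show "dif C \<phi> n x = 0" using M[of "n - 1"] by (simp add: C_simps)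
  next
    fix n x assume "x \<in> degenerate X n"
    then obtain m i y where d: "n = m + 1" "i \<le> m" "y \<in> simplices X m" "x = degen X m i y"
      by (rule degenerateE)
    have "\<phi> m (face X n k x) = 0" if "k \<le> n" "k \<notin> {i, i + 1}" for k
      using cochainsD(2)[OF assms] face_degen_low[of k i m y] face_degen_high[of i k m y] d that
      by (cases "k < i") auto
    then have "(\<Sum>k\<le>n. (- 1) ^ k * \<phi> m (face X n k x)) = (\<Sum>k\<in>{i, i + 1}. (- 1) ^ k * \<phi> m (face X n k x))"
      using d by (intro sum.mono_neutral_right) auto
    also have "\<dots> = 0" using d face_degen_mid[of _ i m y] by simp
    finally show "dif C \<phi> n x = 0" using d by (simp add: C_simps)
  qed (simp add: C_simps)
qed

lemma cochain_mult_assoc: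
  "(\<phi> \<otimes>\<^bsub>C\<^esub> \<psi>) \<otimes>\<^bsub>C\<^esub> \<chi> = \<phi> \<otimes>\<^bsub>C\<^esub> (\<psi> \<otimes>\<^bsub>C\<^esub> \<chi>)"
proof (intro ext)
  fix n x
  show "((\<phi> \<otimes>\<^bsub>C\<^esub> \<psi>) \<otimes>\<^bsub>C\<^esub> \<chi>) n x = (\<phi> \<otimes>\<^bsub>C\<^esub> (\<psi> \<otimes>\<^bsub>C\<^esub> \<chi>)) n x"
  proof (cases "x \<in> simplices X n")
    case x: True
    define G where "G r s t = \<phi> r (front r n x) * \<psi> s (back r s n x) * \<chi> t (back (r + s) t n x)" for r s t
    have "((\<phi> \<otimes>\<^bsub>C\<^esub> \<psi>) \<otimes>\<^bsub>C\<^esub> \<chi>) n x = (\<Sum>p\<le>n. \<Sum>r\<le>p. G r (p - r) (n - p))"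
    proof -
      have "front r p (front p n x) = front r n x \<and> back r (p - r) p (front p n x) = back r (p - r) n x"
        if "r \<le> p" "p \<le> n" for r p
        using that x by (auto simp: monomap_def intro!: act_act_eq1)
      then show ?thesis using x
        by (simp add: C_simps front_closed sum_distrib_right G_def)
    qed
    also have "\<dots> = (\<Sum>(p, r)\<in>(SIGMA p:{..n}. {..p}). G r (p - r) (n - p))"
      by (rule sum.Sigma) auto
    \<comment> \<open>Both bracketings sum over all r + s + t = n; here \<open>p\<close> is the
      total r + s and is traded for \<open>s\<close>.\<close>
    also have "\<dots> = (\<Sum>(r, s)\<in>(SIGMA r:{..n}. {..n - r}). G r s (n - r - s))"
      by (rule sum.reindex_bij_witness[of _ "\<lambda>(r, s). (r + s, r)" "\<lambda>(p, r). (r, p - r)"]) auto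
    also have "\<dots> = (\<Sum>r\<le>n. \<Sum>s\<le>n - r. G r s (n - r - s))"
      by (rule sum.Sigma[symmetric]) auto
    also have "\<dots> = (\<phi> \<otimes>\<^bsub>C\<^esub> (\<psi> \<otimes>\<^bsub>C\<^esub> \<chi>)) n x"
    proof -
      have "front s (n - r) (back r (n - r) n x) = back r s n x \<and>
          back s (n - r - s) (n - r) (back r (n - r) n x) = back (r + s) (n - r - s) n x"
        if "r \<le> n" "s \<le> n - r" for r s
        using that x by (auto simp: monomap_def intro!: act_act_eq1)
      then show ?thesis using x
        by (simp add: C_simps back_closed sum_distrib_left G_def mult.assoc)
    qed
    finally show ?thesis .
  qed (simp add: C_simps)
qed

lemma ring_C: "ring C"
proof (rule ringI)
  show "abelian_group C"
  proof (rule abelian_groupI)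
    fix \<phi> assume "\<phi> \<in> carrier C"
    then show "\<exists>\<psi>\<in>carrier C. \<psi> \<oplus>\<^bsub>C\<^esub> \<phi> = \<zero>\<^bsub>C\<^esub>"
      by (intro bexI[of _ "\<lambda>p x. - \<phi> p x"]) (simp_all add: C_simps cochain_uminus)
  qed (simp_all add: C_simps cochain_add cochain_zero algebra_simps)
  show "Group.monoid C"
  proof (rule monoidI)
    fix \<phi> assume \<phi>: "\<phi> \<in> carrier C"
    show "\<one>\<^bsub>C\<^esub> \<otimes>\<^bsub>C\<^esub> \<phi> = \<phi>"
    proof (intro ext)
      fix n x
      show "(\<one>\<^bsub>C\<^esub> \<otimes>\<^bsub>C\<^esub> \<phi>) n x = \<phi> n x"
      proof (cases "x \<in> simplices X n")
        case x: True
        have "(\<one>\<^bsub>C\<^esub> \<otimes>\<^bsub>C\<^esub> \<phi>) n x = (\<Sum>p\<le>n. if p = 0 then \<phi> n (front n n x) else 0)"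
          unfolding C_simps if_P[OF x] using x front_closed[of 0 n x] by (intro sum.cong) (auto simp: plus_0_id)
        then show ?thesis using act_id[OF x] by simp
      qed (use \<phi> cochainsD in \<open>simp add: C_simps\<close>)
    qed
    show "\<phi> \<otimes>\<^bsub>C\<^esub> \<one>\<^bsub>C\<^esub> = \<phi>"
    proof (intro ext)
      fix n x
      show "(\<phi> \<otimes>\<^bsub>C\<^esub> \<one>\<^bsub>C\<^esub>) n x = \<phi> n x"
      proof (cases "x \<in> simplices X n")
        case x: True
        have "(\<phi> \<otimes>\<^bsub>C\<^esub> \<one>\<^bsub>C\<^esub>) n x = (\<Sum>p\<le>n. if p = n then \<phi> n (front n n x) else 0)"
          unfolding C_simps if_P[OF x] using x back_closed[of n 0 n x] by (intro sum.cong) auto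
        then show ?thesis using act_id[OF x] by simp
      qed (use \<phi> cochainsD in \<open>simp add: C_simps\<close>)
    qed
  next
    fix \<phi> \<psi> assume "\<phi> \<in> carrier C" "\<psi> \<in> carrier C"
    then show "\<phi> \<otimes>\<^bsub>C\<^esub> \<psi> \<in> carrier C" using cochain_mult by (simp add: C_simps(1))
  next
    show "\<one>\<^bsub>C\<^esub> \<in> carrier C" using cochain_one by (simp add: C_simps(1))
  qed (rule cochain_mult_assoc)
qed (auto simp: C_simps algebra_simps sum.distrib fun_eq_iff)

sublocale C: ring C by (rule ring_C)

lemma C_uminus: "\<phi> \<in> cochains X \<Longrightarrow> \<ominus>\<^bsub>C\<^esub> \<phi> = (\<lambda>p x. - \<phi> p x)"
  by (rule C.minus_equality) (simp_all add: C_simps cochain_uminus)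

lemma grade_C_subgroup: "additive_subgroup (grade C i) C"
  unfolding additive_subgroup_def
proof (rule C.add.subgroupI)
  show "grade C i \<subseteq> carrier C" by (auto simp: C_simps)
  show "grade C i \<noteq> {}" using cochain_zero by (auto simp: C_simps)
  show "\<ominus>\<^bsub>C\<^esub> \<phi> \<in> grade C i" if "\<phi> \<in> grade C i" for \<phi>
    using that cochain_uminus[of \<phi>] by (simp add: C_simps(6) C_uminus fun_eq_iff)
  show "\<phi> \<oplus>\<^bsub>C\<^esub> \<psi> \<in> grade C i" if "\<phi> \<in> grade C i" "\<psi> \<in> grade C i" for \<phi> \<psi>
    using that cochain_add by (auto simp: C_simps fun_eq_iff)
qed

sublocale C: pregraded_ring C
  by (intro pregraded_ring.intro pregraded_ring_axioms.intro C.ring_axioms grade_C_subgroup)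

lemma grade_C_iff: "\<phi> \<in> grade C i \<longleftrightarrow> \<phi> \<in> cochains X \<and> (\<forall>p x. int p \<noteq> i \<longrightarrow> \<phi> p x = 0)"
  by (auto simp: C_simps fun_eq_iff)

lemma cochain_restrict: "\<phi> \<in> cochains X \<Longrightarrow> (\<lambda>p x. if P p then \<phi> p x else 0) \<in> cochains X"
proof -
  assume *: "\<phi> \<in> cochains X"
  obtain M where "\<And>p x. p > M \<Longrightarrow> \<phi> p x = 0" using * cochain_bound by metis
  then show ?thesis using * by (intro cochainsI[of _ M]) (simp_all add: cochainsD)
qed

lemma C_decomposition: "\<phi> \<in> cochains X \<Longrightarrow> \<exists>c. decomposition C \<phi> c"
proof -
  assume \<phi>: "\<phi> \<in> cochains X"
  have "finite S \<Longrightarrow> \<exists>c. decomposition C (\<lambda>p x. if p \<in> S then \<phi> p x else 0) c" for S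
  proof (induction S rule: finite_induct)
    case empty
    then show ?case using C.decomposition_homogeneous[OF C.zero_grade] by (auto simp: C_simps)
  next
    case (insert s S)
    let ?f = "\<lambda>p x. if p = s then \<phi> p x else 0"
    have "?f \<in> grade C (int s)" using \<phi> cochain_restrict[of \<phi> "\<lambda>p. p = s"] by (auto simp: grade_C_iff)
    from C.decomposition_homogeneous[OF this] insert(3) C.decomposition_add
    have "\<exists>c. decomposition C (?f \<oplus>\<^bsub>C\<^esub> (\<lambda>p x. if p \<in> S then \<phi> p x else 0)) c" by blast
    moreover have "?f \<oplus>\<^bsub>C\<^esub> (\<lambda>p x. if p \<in> S then \<phi> p x else 0) = (\<lambda>p x. if p \<in> insert s S then \<phi> p x else 0)"
      using insert(2) by (auto simp: C_simps fun_eq_iff)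
    ultimately show ?case by simp
  qed
  from this[OF cochainsD(3)[OF \<phi>]] show ?thesis
    by (rule back_subst[of "\<lambda>f. \<exists>c. decomposition C f c"]) (auto simp: fun_eq_iff)
qed

lemma cochain_dif_dif: "dif C (dif C \<phi>) = (\<lambda>p x. 0)"
proof (intro ext)
  fix n x
  show "dif C (dif C \<phi>) n x = 0"
  proof (cases "2 \<le> n \<and> x \<in> simplices X n")
    case True
    then have n: "2 \<le> n" and x: "x \<in> simplices X n" by auto
    obtain m where m: "n = Suc (Suc m)" using n by (metis add_2_eq_Suc le_Suc_ex)
    define G where "G k l = (- 1) ^ (k + l) * \<phi> (n - 2) (face X (n - 1) l (face X n k x))" for k l
    let ?P = "{..n} \<times> {..n - 1}"
    have "dif C (dif C \<phi>) n x = (\<Sum>k\<le>n. \<Sum>l\<le>n - 1. G k l)"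
      using n x face_closed[of n _ x]
      by (simp add: C_simps sum_distrib_left G_def power_add mult.assoc m del: sum.atMost_Suc)
    also have "\<dots> = (\<Sum>(k, l)\<in>?P. G k l)" by (simp add: sum.cartesian_product)
    also have "\<dots> = (\<Sum>(k, l)\<in>{(k, l) \<in> ?P. l < k} \<union> {(k, l) \<in> ?P. k \<le> l}. G k l)"
      by (rule sum.cong) auto
    also have "\<dots> = (\<Sum>(k, l)\<in>{(k, l) \<in> ?P. l < k}. G k l) + (\<Sum>(k, l)\<in>{(k, l) \<in> ?P. k \<le> l}. G k l)"
      by (intro sum.union_disjoint finite_subset[of "{(k, l) \<in> ?P. _ k l}" ?P]) auto
    \<comment> \<open>The identity \<open>face_face\<close> pairs (k, l) for l < k with (l, k - 1).
      The sum of the two indices drops by one, so paired terms cancel.\<close>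
    also have "(\<Sum>(k, l)\<in>{(k, l) \<in> ?P. l < k}. G k l) = (\<Sum>(k, l)\<in>{(k, l) \<in> ?P. k \<le> l}. - G k l)"
    proof (rule sum.reindex_bij_witness[of _ "\<lambda>(k, l). (l + 1, k)" "\<lambda>(k, l). (l, k - 1)"])
      fix a assume "a \<in> {(k, l) \<in> ?P. l < k}"
      then obtain k l where a: "a = (k, l)" "l < k" "k \<le> n" by auto
      then have "(- 1 :: int) ^ (k + l) = - ((- 1) ^ (l + (k - 1)))"
        by (cases k) (simp_all add: add.commute)
      then show "(case case a of (k, l) \<Rightarrow> (l, k - 1) of (k, l) \<Rightarrow> - G k l) = (case a of (k, l) \<Rightarrow> G k l)"
        using a face_face[OF a(2,3) n x] by (simp add: G_def)
    qed (use n in auto)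
    finally show ?thesis by (simp add: sum_negf case_prod_unfold)
  next
    case False
    then show ?thesis by (auto simp: C_simps)
  qed
qed

text \<open>With \<open>\<phi>\<close> concentrated in degree \<open>p\<close>, the faces of
  \<open>x\<close> with index at most \<open>p\<close> act on the front factor and the others on the
  back factor. The right-hand side has two further terms, from the last face of the longer front and
  the first face of the longer back; both are plus or minus \<open>u * w\<close>, and they
  cancel.\<close>

lemma cochain_Leibniz:
  assumes \<phi>: "\<phi> \<in> grade C i" and \<psi>: "\<psi> \<in> cochains X"
  shows "dif C (\<phi> \<otimes>\<^bsub>C\<^esub> \<psi>) n x = (dif C \<phi> \<otimes>\<^bsub>C\<^esub> \<psi>) n x + sign i * (\<phi> \<otimes>\<^bsub>C\<^esub> dif C \<psi>) n x"
proof (cases "\<exists>p. i = int p \<and> p \<le> n \<and> x \<in> simplices X n")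
  \<comment> \<open>Either \<open>x\<close> is not a simplex, or the degree \<open>i\<close> is
    negative or exceeds \<open>n\<close>; then all three terms vanish.\<close>
  case False
  have z: "\<phi> p y = 0" if "int p \<noteq> i" for p y using \<phi> that by (simp add: grade_C_iff)
  show ?thesis
  proof (cases "x \<in> simplices X n")
    case True
    then have z': "\<phi> p y = 0" if "p \<le> n" for p y using False True that by (intro z) auto
    then have s0: "(\<Sum>p\<le>m. \<phi> p (f p) * g p) = 0" if "m \<le> n" for m f g
      using that by (intro sum.neutral) auto
    have d0: "dif C \<phi> p y = 0" if "p \<le> n" for p y using z'[of "p - 1"] that by (simp add: C_simps)
    have "(\<phi> \<otimes>\<^bsub>C\<^esub> \<psi>) (n - 1) y = 0" for y
      unfolding C_simps(2)[of \<phi> \<psi>] using s0[of "n - 1"] by simp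
    then have "dif C (\<phi> \<otimes>\<^bsub>C\<^esub> \<psi>) n x = 0"
      unfolding C_simps(7)[of "\<phi> \<otimes>\<^bsub>C\<^esub> \<psi>"] by simp
    moreover have "(\<phi> \<otimes>\<^bsub>C\<^esub> dif C \<psi>) n x = 0" by (simp add: C_simps(2)[of \<phi> "dif C \<psi>"] s0)
    moreover have "(dif C \<phi> \<otimes>\<^bsub>C\<^esub> \<psi>) n x = 0"
      unfolding C_simps(2)[of "dif C \<phi>" \<psi>] by (auto intro!: sum.neutral simp: d0)
    ultimately show ?thesis by simp
  qed (simp add: C_simps)
next
  case True
  then obtain p where p: "i = int p" "p \<le> n" and x: "x \<in> simplices X n" by blast
  have z: "\<phi> r y = 0" if "r \<noteq> p" for r y using \<phi> that p by (simp add: grade_C_iff)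
  have conv: "(\<Sum>r\<le>m. \<phi> r (f r) * g r) = (if p \<le> m then \<phi> p (f p) * g p else 0)" for m f g
  proof -
    have "(\<Sum>r\<le>m. \<phi> r (f r) * g r) = (\<Sum>r\<le>m. if r = p then \<phi> p (f p) * g p else 0)"
      using z by (intro sum.cong) auto
    then show ?thesis by simp
  qed
  have zd: "dif C \<phi> r y = 0" if "r \<noteq> p + 1" for r y
    using z[of "r - 1"] that by (auto simp: C_simps)
  have convd: "(\<Sum>r\<le>m. dif C \<phi> r (f r) * g r) = (if p + 1 \<le> m then dif C \<phi> (p + 1) (f (p + 1)) * g (p + 1) else 0)" for m f g
  proof -
    have "(\<Sum>r\<le>m. dif C \<phi> r (f r) * g r) = (\<Sum>r\<le>m. if r = p + 1 then dif C \<phi> (p + 1) (f (p + 1)) * g (p + 1) else 0)"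
      using zd by (intro sum.cong) auto
    then show ?thesis by simp
  qed
  have s: "sign i = (- 1) ^ p" by (simp add: sign_def p)
  define u where "u = \<phi> p (front p n x)"
  have R2: "(\<phi> \<otimes>\<^bsub>C\<^esub> dif C \<psi>) n x = u * dif C \<psi> (n - p) (back p (n - p) n x)"
    using x p by (simp add: C_simps(2)[of \<phi> "dif C \<psi>"] conv u_def)
  have R1: "(dif C \<phi> \<otimes>\<^bsub>C\<^esub> \<psi>) n x = (if p + 1 \<le> n then
      dif C \<phi> (p + 1) (front (p + 1) n x) * \<psi> (n - (p + 1)) (back (p + 1) (n - (p + 1)) n x) else 0)"
    using x by (simp add: C_simps(2)[of "dif C \<phi>" \<psi>] convd)
  have L: "dif C (\<phi> \<otimes>\<^bsub>C\<^esub> \<psi>) n x = (if p + 1 \<le> n then \<Sum>k\<le>n. (- 1) ^ k *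
      (\<phi> p (front p (n - 1) (face X n k x)) * \<psi> (n - 1 - p) (back p (n - 1 - p) (n - 1) (face X n k x))) else 0)"
  proof -
    have "p \<le> n - 1 \<longleftrightarrow> p + 1 \<le> n" if "1 \<le> n" using that by linarith
    then show ?thesis using x face_closed[of n _ x] unfolding C_simps(7)[of "\<phi> \<otimes>\<^bsub>C\<^esub> \<psi>"]
      by (cases "1 \<le> n") (simp_all add: C_simps(2)[of \<phi> \<psi>] conv)
  qed
  show ?thesis
  proof (cases "p + 1 \<le> n")
    case False
    then have "p = n" using p by simp
    then have "dif C \<psi> (n - p) y = 0" for y by (simp add: C_simps)
    then show ?thesis using False unfolding L R1 R2 by simp
  next
    case pn: True
    define m where "m = n - 1 - p"
    have m: "n = p + 1 + m" using pn unfolding m_def by simp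
    define w where "w = \<psi> m (back (p + 1) m n x)"
    define a where "a k = \<phi> p (face X (p + 1) k (front (p + 1) n x))" for k
    define b where "b k = \<psi> m (face X (m + 1) k (back p (m + 1) n x))" for k
    have f1: "front p (n - 1) (face X n k x) = face X (p + 1) k (front (p + 1) n x)"
      "back p m (n - 1) (face X n k x) = back (p + 1) m n x" if "k \<le> p" for k
      unfolding face_def using that x m by (auto simp: monomap_def intro!: act_act_eq act_act_eq1)
    have f2: "front p (n - 1) (face X n k x) = front p n x"
      "back p m (n - 1) (face X n k x) = face X (m + 1) (k - p) (back p (m + 1) n x)" if "p < k" "k \<le> n" for k
      unfolding face_def using that x m by (auto simp: monomap_def intro!: act_act_eq act_act_eq1)
    have f3: "face X (p + 1) (p + 1) (front (p + 1) n x) = front p n x"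
      unfolding face_def using x m by (auto simp: monomap_def intro!: act_act_eq1)
    have f4: "face X (m + 1) 0 (back p (m + 1) n x) = back (p + 1) m n x"
      unfolding face_def using x m by (auto simp: monomap_def intro!: act_act_eq1)
    have fr: "front (p + 1) n x \<in> simplices X (p + 1)" and bk: "back p (m + 1) n x \<in> simplices X (m + 1)"
      using x m by (auto intro!: front_closed back_closed)
    have "{..n} = {..p} \<union> {p<..n}" using p by auto
    then have "dif C (\<phi> \<otimes>\<^bsub>C\<^esub> \<psi>) n x =
      (\<Sum>k\<le>p. (- 1) ^ k * (\<phi> p (front p (n - 1) (face X n k x)) * \<psi> m (back p m (n - 1) (face X n k x)))) +
      (\<Sum>k\<in>{p<..n}. (- 1) ^ k * (\<phi> p (front p (n - 1) (face X n k x)) * \<psi> m (back p m (n - 1) (face X n k x))))"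
      using pn unfolding L m_def[symmetric] by (simp add: sum.union_disjoint ivl_disj_int)
    also have "\<dots> = (\<Sum>k\<le>p. (- 1) ^ k * (a k * w)) + (\<Sum>k\<in>{p<..n}. (- 1) ^ k * (u * b (k - p)))"
      using f1 f2 by (intro arg_cong2[of _ _ _ _ "(+)"] sum.cong) (auto simp: a_def b_def w_def u_def)
    also have "(\<Sum>k\<in>{p<..n}. (- 1) ^ k * (u * b (k - p))) = (\<Sum>k\<in>{1..m + 1}. (- 1) ^ (p + k) * (u * b k))"
      by (rule sum.reindex_bij_witness[of _ "\<lambda>k. p + k" "\<lambda>k. k - p"]) (auto simp: m)
    finally have L': "dif C (\<phi> \<otimes>\<^bsub>C\<^esub> \<psi>) n x = (\<Sum>k\<le>p. (- 1) ^ k * a k) * w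
        + (- 1) ^ p * u * (\<Sum>k\<in>{1..m + 1}. (- 1) ^ k * b k)"
      by (simp add: sum_distrib_left sum_distrib_right power_add mult_ac del: sum.cl_ivl_Suc)
    have "dif C \<phi> (p + 1) (front (p + 1) n x) = (\<Sum>k\<le>p + 1. (- 1) ^ k * a k)"
      using fr by (simp add: C_simps a_def)
    also have "\<dots> = (\<Sum>k\<le>p. (- 1) ^ k * a k) + (- 1) ^ (p + 1) * u"
      using f3 by (simp add: a_def u_def)
    finally have R1': "(dif C \<phi> \<otimes>\<^bsub>C\<^esub> \<psi>) n x = ((\<Sum>k\<le>p. (- 1) ^ k * a k) + (- 1) ^ (p + 1) * u) * w"
      using pn unfolding R1 w_def by (simp add: m)
    have "{..m + 1} = insert 0 {1..m + 1}" by auto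
    then have "(\<Sum>k\<le>m + 1. (- 1) ^ k * b k) = b 0 + (\<Sum>k\<in>{1..m + 1}. (- 1) ^ k * b k)"
      by simp
    moreover have "b 0 = w" unfolding b_def w_def f4 ..
    moreover have "dif C \<psi> (n - p) (back p (n - p) n x) = (\<Sum>k\<le>m + 1. (- 1) ^ k * b k)"
      using bk by (simp add: C_simps b_def m)
    ultimately have R2': "(\<phi> \<otimes>\<^bsub>C\<^esub> dif C \<psi>) n x = u * (w + (\<Sum>k\<in>{1..m + 1}. (- 1) ^ k * b k))"
      unfolding R2 by simp
    show ?thesis unfolding L' R1' R2' s by (simp add: algebra_simps)
  qed
qed

lemma dg_ring_C: "dg_ring C"
proof (intro dg_ring.intro dg_ring_axioms.intro)
  fix i \<phi> \<psi> assume \<phi>: "\<phi> \<in> grade C i" and \<psi>: "\<psi> \<in> carrier C"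
  have c: "\<phi> \<otimes>\<^bsub>C\<^esub> dif C \<psi> \<in> carrier C"
    using \<phi> \<psi> cochain_mult[OF _ cochain_dif] by (simp add: C_simps(1) grade_C_iff)
  have "[sign i] \<cdot>\<^bsub>C\<^esub> (\<phi> \<otimes>\<^bsub>C\<^esub> dif C \<psi>) = (\<lambda>n x. sign i * (\<phi> \<otimes>\<^bsub>C\<^esub> dif C \<psi>) n x)"
    unfolding C.sign_cases[OF c] using c by (simp add: C_uminus C_simps(1) sign_def)
  then show "dif C (\<phi> \<otimes>\<^bsub>C\<^esub> \<psi>) = dif C \<phi> \<otimes>\<^bsub>C\<^esub> \<psi> \<oplus>\<^bsub>C\<^esub> [sign i] \<cdot>\<^bsub>C\<^esub> (\<phi> \<otimes>\<^bsub>C\<^esub> dif C \<psi>)"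
    using cochain_Leibniz[OF \<phi>] \<psi> by (simp add: C_simps(1,5) fun_eq_iff)
next
  fix i \<phi> assume "\<phi> \<in> grade C i"
  then show "dif C \<phi> \<in> grade C (i + 1)"
    using cochain_dif unfolding grade_C_iff by (auto simp: C_simps(7))
next
  fix i j \<phi> \<psi> assume \<phi>: "\<phi> \<in> grade C i" and \<psi>: "\<psi> \<in> grade C j"
  have "\<phi> p y * \<psi> (n - p) z = 0" if "int n \<noteq> i + j" "p \<le> n" for n p y z
    using \<phi> \<psi> that by (cases "int p = i") (auto simp: grade_C_iff of_nat_diff)
  then have "(\<Sum>p\<le>n. \<phi> p (f p) * \<psi> (n - p) (g p)) = 0" if "int n \<noteq> i + j" for n f g
    using that by (intro sum.neutral ballI) simp
  then have "(\<phi> \<otimes>\<^bsub>C\<^esub> \<psi>) n x = 0" if "int n \<noteq> i + j" for n x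
    using that by (simp add: C_simps(2))
  then show "\<phi> \<otimes>\<^bsub>C\<^esub> \<psi> \<in> grade C (i + j)"
    using \<phi> \<psi> cochain_mult unfolding grade_C_iff by blast
next
  fix \<phi> assume "\<phi> \<in> carrier C"
  then have \<phi>: "\<phi> \<in> cochains X" by (simp add: C_simps)
  show "\<exists>!c. decomposition C \<phi> c"
  proof (rule C.direct_sumI[of "\<lambda>i \<phi> p x. if int p = i then \<phi> p x else 0"])
    show "\<exists>c. decomposition C \<phi> c" by (rule C_decomposition[OF \<phi>])
  qed (auto simp: C_simps fun_eq_iff intro: cochain_restrict)
qed (simp_all add: C.ring_axioms grade_C_subgroup grade_C_iff C_simps(1,4) cochain_one cochain_dif_dif,
     auto simp: C_simps(3,5,7) sum.distrib algebra_simps fun_eq_iff)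

sublocale C: dg_ring C by (rule dg_ring_C)

end

section \<open>Functoriality of cochains and the standard simplices\<close>

lemma dg_map_cochain_map:
  assumes "simplicial_set X" "simplicial_set Y"
    and hY: "\<And>p x. x \<in> simplices X p \<Longrightarrow> h p x \<in> simplices Y p"
    and h_act: "\<And>m n \<theta> x. monomap m n \<theta> \<Longrightarrow> x \<in> simplices X n \<Longrightarrow> h m (act X m n \<theta> x) = act Y m n \<theta> (h n x)"
  shows "dg_map (cochain_ring Y) (cochain_ring X) (cochain_map X h)"
proof -
  interpret X: simplicial_set X by fact
  interpret Y: simplicial_set Y by fact
  have face: "h (n - 1) (face X n k x) = face Y n k (h n x)" if "n \<ge> 1" "k \<le> n" "x \<in> simplices X n" for n k x
    unfolding face_def using that by (intro h_act) (auto simp: monomap_def)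
  have fr: "h p (X.front p n x) = Y.front p n (h n x)"
    and bk: "h (n - p) (X.back p (n - p) n x) = Y.back p (n - p) n (h n x)"
    if "p \<le> n" "x \<in> simplices X n" for p n x
    using that by (auto intro!: h_act simp: monomap_def)
  have deg: "h n x \<in> degenerate Y n" if x: "x \<in> degenerate X n" for n x
  proof -
    obtain m i y where d: "n = m + 1" "i \<le> m" "y \<in> simplices X m" "x = degen X m i y"
      using x by (rule X.degenerateE)
    have "h n x = degen Y m i (h m y)"
      unfolding d degen_def using d by (intro h_act) (auto simp: monomap_def)
    then show ?thesis using d hY by (intro Y.degenerateI[of i m "h m y"]) auto
  qed
  have cl: "cochain_map X h \<phi> \<in> cochains X" if \<phi>: "\<phi> \<in> cochains Y" for \<phi>
  proof -
    obtain N where "\<And>p x. p > N \<Longrightarrow> \<phi> p x = 0" using \<phi> Y.cochain_bound by metis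
    then show ?thesis using deg Y.cochainsD[OF \<phi>]
      by (intro X.cochainsI[of _ N]) (simp_all add: cochain_map_def)
  qed
  show ?thesis
  proof (rule dg_mapI)
    fix \<phi> i assume "\<phi> \<in> grade (cochain_ring Y) i"
    then show "cochain_map X h \<phi> \<in> grade (cochain_ring X) i"
      using cl unfolding X.grade_C_iff Y.grade_C_iff by (simp add: cochain_map_def)
  next
    fix \<phi> assume "\<phi> \<in> carrier (cochain_ring Y)"
    show "cochain_map X h (dif (cochain_ring Y) \<phi>) = dif (cochain_ring X) (cochain_map X h \<phi>)"
      using hY face X.face_closed
      by (auto simp: cochain_map_def X.C_simps Y.C_simps fun_eq_iff intro!: sum.cong)
  next
    fix \<phi> \<psi>
    show "cochain_map X h (\<phi> \<otimes>\<^bsub>cochain_ring Y\<^esub> \<psi>) = cochain_map X h \<phi> \<otimes>\<^bsub>cochain_ring X\<^esub> cochain_map X h \<psi>"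
      using hY fr bk X.front_closed X.back_closed
      by (auto simp: cochain_map_def X.C_simps Y.C_simps fun_eq_iff intro!: sum.cong)
  qed (auto simp: cl[unfolded cochain_map_def] X.C_simps Y.C_simps cochain_map_def fun_eq_iff hY)
qed

lemma simplicial_set_std_simplex: "simplicial_set (std_simplex q)"
proof
  fix m n \<theta> x assume \<theta>: "monomap m n \<theta>" and x: "x \<in> simplices (std_simplex q) n"
  then show "act (std_simplex q) m n \<theta> x \<in> simplices (std_simplex q) m"
    by (auto simp: std_simplex_def compose_def monomap_def mono_on_def PiE_iff)
next
  fix m n :: nat and \<theta> \<theta>' :: "nat \<Rightarrow> nat" and x assume "\<And>k. k \<le> m \<Longrightarrow> \<theta> k = \<theta>' k"
  then show "act (std_simplex q) m n \<theta> x = act (std_simplex q) m n \<theta>' x"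
    by (auto simp: std_simplex_def compose_def fun_eq_iff)
qed (auto simp: std_simplex_def compose_def monomap_def fun_eq_iff PiE_iff extensional_def)

interpretation std: simplicial_set "std_simplex q"
  by (rule simplicial_set_std_simplex)

lemma std_simplex_map_closed: "monomap m n \<theta> \<Longrightarrow> x \<in> simplices (std_simplex m) p \<Longrightarrow>
    std_simplex_map \<theta> p x \<in> simplices (std_simplex n) p"
  by (auto simp: std_simplex_map_def std_simplex_def compose_def monomap_def mono_on_def PiE_iff)

lemma dg_map_std_simplex_map:
  assumes "monomap m n \<theta>"
  shows "dg_map (cochain_ring (std_simplex n)) (cochain_ring (std_simplex m))
    (cochain_map (std_simplex m) (std_simplex_map \<theta>))"
proof (rule dg_map_cochain_map[OF simplicial_set_std_simplex simplicial_set_std_simplex])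
  show "std_simplex_map \<theta> p x \<in> simplices (std_simplex n) p" if "x \<in> simplices (std_simplex m) p" for p x
    using that assms by (simp add: std_simplex_map_closed)
qed (auto simp: std_simplex_map_def std_simplex_def compose_def monomap_def fun_eq_iff)

section \<open>Lifting out of semi-free DG rings\<close>

definition word_prod :: "('c, 'm) ring_scheme \<Rightarrow> ('x \<Rightarrow> 'c) \<Rightarrow> 'x list \<Rightarrow> 'c"
  where "word_prod C s w = foldr (\<lambda>x c. s x \<otimes>\<^bsub>C\<^esub> c) w \<one>\<^bsub>C\<^esub>"

text \<open>The value of a noncommutative polynomial at the elements \<open>s x\<close>, that is,
  the homomorphism given by the universal property of the free ring. An explicit formula makes
  visible that only the letters occurring in \<open>p\<close> matter.\<close>

definition free_eval :: "('c, 'm) ring_scheme \<Rightarrow> ('x \<Rightarrow> 'c) \<Rightarrow> ('x list \<Rightarrow>\<^sub>0 int) \<Rightarrow> 'c"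
  where "free_eval C s p = finsum C (\<lambda>w. [Poly_Mapping.lookup p w] \<cdot>\<^bsub>C\<^esub> word_prod C s w) (Poly_Mapping.keys p)"

lemma word_prod_cong: "(\<And>x. x \<in> set w \<Longrightarrow> s x = s' x) \<Longrightarrow> word_prod C s w = word_prod C s' w"
  unfolding word_prod_def by (rule foldr_cong) auto

lemma free_ring_simps:
  "carrier (free_ring X deg) = {p. Poly_Mapping.keys p \<subseteq> lists X}"
  "p \<otimes>\<^bsub>free_ring X deg\<^esub> q = frag_extend (\<lambda>v. frag_extend (\<lambda>w. frag_of (v @ w)) q) p"
  "\<one>\<^bsub>free_ring X deg\<^esub> = frag_of []"
  "\<zero>\<^bsub>free_ring X deg\<^esub> = 0"
  "p \<oplus>\<^bsub>free_ring X deg\<^esub> q = p + q"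
  "grade (free_ring X deg) i = {p. Poly_Mapping.keys p \<subseteq> lists X \<and> (\<forall>w\<in>Poly_Mapping.keys p. sum_list (map deg w) = i)}"
  by (simp_all add: free_ring_def free_Abelian_group_def)

context ring
begin

lemma int_pow_zero: "[(0::int)] \<cdot> a = \<zero>"
  by (simp add: add_pow_def)

context
  fixes s :: "'x \<Rightarrow> 'a"
  assumes s: "\<And>x. s x \<in> carrier R"
begin

lemma word_prod_closed: "word_prod R s w \<in> carrier R"
  unfolding word_prod_def by (induction w) (auto simp: s)

lemma word_prod_append: "word_prod R s (v @ w) = word_prod R s v \<otimes> word_prod R s w"
  by (induction v) (use word_prod_closed in \<open>auto simp: word_prod_def s m_assoc\<close>)

lemma free_eval_superset:
  assumes "finite K" "Poly_Mapping.keys p \<subseteq> K"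
  shows "free_eval R s p = finsum R (\<lambda>w. [Poly_Mapping.lookup p w] \<cdot> word_prod R s w) K"
  unfolding free_eval_def using assms
  by (intro add.finprod_mono_neutral_cong_left)
    (auto simp: word_prod_closed in_keys_iff int_pow_zero)

lemma free_eval_closed: "free_eval R s p \<in> carrier R"
  unfolding free_eval_def by (auto simp: word_prod_closed)

lemma free_eval_add: "free_eval R s (p + q) = free_eval R s p \<oplus> free_eval R s q"
proof -
  let ?K = "Poly_Mapping.keys p \<union> Poly_Mapping.keys q"
  have "free_eval R s r = finsum R (\<lambda>w. [Poly_Mapping.lookup r w] \<cdot> word_prod R s w) ?K"
    if "r \<in> {p, q, p + q}" for r
    using that keys_add[of p q] by (intro free_eval_superset) auto
  then show ?thesis
    by (simp add: lookup_add add.int_pow_mult[symmetric] word_prod_closed finsum_addf[symmetric] Pi_iff)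
qed

lemma free_eval_0: "free_eval R s 0 = \<zero>"
  by (simp add: free_eval_def)

lemma free_eval_diff: "free_eval R s (p - q) = free_eval R s p \<ominus> free_eval R s q"
proof -
  have "free_eval R s p = free_eval R s (p - q) \<oplus> free_eval R s q"
    using free_eval_add[of "p - q" q] by simp
  then show ?thesis using free_eval_closed by (simp add: a_minus_def a_assoc r_neg)
qed

lemma free_eval_of: "free_eval R s (frag_of w) = word_prod R s w"
  by (simp add: free_eval_def word_prod_closed add.int_pow_1)

lemma free_eval_mult: "free_eval R s (frag_extend (\<lambda>v. frag_extend (\<lambda>w. frag_of (v @ w)) q) p)
    = free_eval R s p \<otimes> free_eval R s q"
proof -
  have 1: "free_eval R s (frag_extend (\<lambda>w. frag_of (v @ w)) q) = word_prod R s v \<otimes> free_eval R s q" for v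
  proof -
    have "Poly_Mapping.keys q \<subseteq> UNIV" by simp
    then show ?thesis
      by (induction q rule: frag_induction)
        (simp_all add: free_eval_0 word_prod_closed free_eval_of word_prod_append frag_extend_diff
          free_eval_diff free_eval_closed r_distr a_minus_def r_minus)
  qed
  have "Poly_Mapping.keys p \<subseteq> UNIV" by simp
  then show ?thesis
    by (induction p rule: frag_induction)
      (simp_all add: free_eval_0 1 free_eval_of frag_extend_diff
        free_eval_diff free_eval_closed l_distr a_minus_def l_minus)
qed

end

lemma free_eval_cong:
  assumes "\<And>x w. w \<in> Poly_Mapping.keys p \<Longrightarrow> x \<in> set w \<Longrightarrow> s x = s' x" "\<And>x. s' x \<in> carrier R"
  shows "free_eval R s p = free_eval R s' p"
proof -
  have "word_prod R s w = word_prod R s' w" if "w \<in> Poly_Mapping.keys p" for w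
    using assms that by (intro word_prod_cong) blast
  then show ?thesis unfolding free_eval_def
    by (intro add.finprod_cong') (auto simp: word_prod_closed[of s'] assms(2))
qed

end

lemma (in dg_ring) int_pow_grade: "a \<in> grade A i \<Longrightarrow> [(k::int)] \<cdot> a \<in> grade A i"
  using add.subgroup_int_pow_closed[of "grade A i" a k] grade_subgroup
  by (simp add: additive_subgroup_def)

text \<open>A relation with closure conditions takes the place of a subring of the product, so that
  the DG ring \<open>A \<times> C\<close> never has to be constructed.\<close>

locale dg_correspondence = A: dg_ring A + C: dg_ring C
  for A :: "'a dg_ring" and C :: "'c dg_ring" and \<rho> :: "'a \<Rightarrow> 'c \<Rightarrow> bool" +
  assumes \<rho>_one: "\<rho> \<one>\<^bsub>A\<^esub> \<one>\<^bsub>C\<^esub>"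
    and \<rho>_diff: "\<rho> a c \<Longrightarrow> \<rho> b c' \<Longrightarrow> a \<in> carrier A \<Longrightarrow> b \<in> carrier A \<Longrightarrow> c \<in> carrier C \<Longrightarrow> c' \<in> carrier C \<Longrightarrow>
      \<rho> (a \<ominus>\<^bsub>A\<^esub> b) (c \<ominus>\<^bsub>C\<^esub> c')"
    and \<rho>_mult: "\<rho> a c \<Longrightarrow> \<rho> b c' \<Longrightarrow> a \<in> carrier A \<Longrightarrow> b \<in> carrier A \<Longrightarrow> c \<in> carrier C \<Longrightarrow> c' \<in> carrier C \<Longrightarrow>
      \<rho> (a \<otimes>\<^bsub>A\<^esub> b) (c \<otimes>\<^bsub>C\<^esub> c')"
    and \<rho>_dif: "\<rho> a c \<Longrightarrow> a \<in> carrier A \<Longrightarrow> c \<in> carrier C \<Longrightarrow> \<rho> (dif A a) (dif C c)"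

text \<open>The pairs related by \<open>\<rho>\<close> form a sub-DG-ring of \<open>A \<times> C\<close>; here its projection to \<open>A\<close> is a
  surjective quasi-isomorphism. The lifting theorem below says that for semi-free \<open>A\<close> this
  projection has a section.\<close>

locale acyclic_correspondence = dg_correspondence A C \<rho>
  for A :: "'a dg_ring" and C :: "'c dg_ring" and \<rho> :: "'a \<Rightarrow> 'c \<Rightarrow> bool" +
  assumes \<rho>_surj: "a \<in> grade A i \<Longrightarrow> \<exists>c\<in>grade C i. \<rho> a c"
    and \<rho>_acyclic: "c \<in> grade C i \<Longrightarrow> dif C c = \<zero>\<^bsub>C\<^esub> \<Longrightarrow> \<rho> \<zero>\<^bsub>A\<^esub> c \<Longrightarrow> \<exists>c'\<in>grade C (i - 1). \<rho> \<zero>\<^bsub>A\<^esub> c' \<and> dif C c' = c"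

text \<open>The fibre product of \<open>A\<close> and \<open>C\<close> over \<open>D\<close>. The
  lifting and filling conditions used later are conjunctions of such equations.\<close>

lemma dg_correspondence_eq:
  assumes "dg_ring A" "dg_ring C" "dg_ring D" and h: "dg_map A D h" and \<pi>: "dg_map C D \<pi>"
  shows "dg_correspondence A C (\<lambda>a c. \<pi> c = h a)"
proof -
  interpret h: dg_hom_pair A D h using assms by (intro dg_hom_pair.intro dg_hom_pair_axioms.intro)
  interpret \<pi>: dg_hom_pair C D \<pi> using assms by (intro dg_hom_pair.intro dg_hom_pair_axioms.intro)
  show ?thesis
    by (intro dg_correspondence.intro dg_correspondence_axioms.intro assms(1,2))
      (simp_all add: h.hD \<pi>.hD h.h_minus \<pi>.h_minus)
qed

lemma dg_correspondence_Ball: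
  assumes "dg_ring A" "dg_ring C" "\<And>k. k \<in> K \<Longrightarrow> dg_correspondence A C (\<rho> k)"
  shows "dg_correspondence A C (\<lambda>a c. \<forall>k\<in>K. \<rho> k a c)"
  by (intro dg_correspondence.intro dg_correspondence_axioms.intro assms(1,2) ballI;
      use dg_correspondence.\<rho>_one[OF assms(3)] dg_correspondence.\<rho>_diff[OF assms(3)]
        dg_correspondence.\<rho>_mult[OF assms(3)] dg_correspondence.\<rho>_dif[OF assms(3)] in blast)

lemma dg_correspondence_conj:
  assumes "dg_correspondence A C \<rho>" "dg_correspondence A C \<rho>'"
  shows "dg_correspondence A C (\<lambda>a c. \<rho> a c \<and> \<rho>' a c)"
proof -
  interpret \<rho>: dg_correspondence A C \<rho> by fact
  interpret \<rho>': dg_correspondence A C \<rho>' by fact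
  show ?thesis
    by (intro dg_correspondence.intro dg_correspondence_axioms.intro \<rho>.A.dg_ring_axioms \<rho>.C.dg_ring_axioms)
      (blast intro: \<rho>.\<rho>_one \<rho>.\<rho>_diff \<rho>.\<rho>_mult \<rho>.\<rho>_dif \<rho>'.\<rho>_one \<rho>'.\<rho>_diff \<rho>'.\<rho>_mult \<rho>'.\<rho>_dif)+
qed

locale lifting_problem = acyclic_correspondence A C \<rho>
  for A :: "'a dg_ring" and C :: "'c dg_ring" and \<rho> :: "'a \<Rightarrow> 'c \<Rightarrow> bool" +
  fixes X :: "'x set" and deg F \<phi>
  assumes filtration: "set_filtration X F"
    and \<phi>_iso: "\<phi> \<in> ring_iso (free_ring X deg) A"
    and \<phi>_grade: "\<phi> ` grade (free_ring X deg) i = grade A i"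
    and \<phi>_dif: "j \<ge> 0 \<Longrightarrow> x \<in> F j \<Longrightarrow> dif A (\<phi> (frag_of [x])) \<in> \<phi> ` free_ring_filtration F deg (j - 1)"
begin

abbreviation "P \<equiv> free_ring X deg"
definition "\<psi> = inv_into (carrier P) \<phi>"

lemma \<phi>_bij: "bij_betw \<phi> (carrier P) (carrier A)"
  using \<phi>_iso by (simp add: ring_iso_def)

lemma \<psi>_\<phi>: "p \<in> carrier P \<Longrightarrow> \<psi> (\<phi> p) = p"
  unfolding \<psi>_def using \<phi>_bij by (simp add: bij_betw_def)

lemma \<phi>_\<psi>: "a \<in> carrier A \<Longrightarrow> \<phi> (\<psi> a) = a" and \<psi>_closed: "a \<in> carrier A \<Longrightarrow> \<psi> a \<in> carrier P"
  unfolding \<psi>_def using \<phi>_bij by (auto simp: bij_betw_def f_inv_into_f inv_into_into)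

lemma \<phi>_hom:
  "p \<in> carrier P \<Longrightarrow> \<phi> p \<in> carrier A"
  "p \<in> carrier P \<Longrightarrow> q \<in> carrier P \<Longrightarrow> \<phi> (p \<oplus>\<^bsub>P\<^esub> q) = \<phi> p \<oplus>\<^bsub>A\<^esub> \<phi> q"
  "p \<in> carrier P \<Longrightarrow> q \<in> carrier P \<Longrightarrow> \<phi> (p \<otimes>\<^bsub>P\<^esub> q) = \<phi> p \<otimes>\<^bsub>A\<^esub> \<phi> q"
  "\<phi> \<one>\<^bsub>P\<^esub> = \<one>\<^bsub>A\<^esub>"
  using \<phi>_iso by (auto simp: ring_iso_def ring_hom_def)

lemma P_add_closed: "p \<in> carrier P \<Longrightarrow> q \<in> carrier P \<Longrightarrow> p \<oplus>\<^bsub>P\<^esub> q \<in> carrier P"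
  using keys_add[of p q] by (auto simp: free_ring_simps simp del: lists_eq_set)

lemma P_mult_closed: "p \<in> carrier P \<Longrightarrow> q \<in> carrier P \<Longrightarrow> p \<otimes>\<^bsub>P\<^esub> q \<in> carrier P"
proof -
  assume p: "p \<in> carrier P" and q: "q \<in> carrier P"
  have sub: "Poly_Mapping.keys (frag_extend (\<lambda>w. frag_of (v @ w)) q) \<subseteq> lists X" if "v \<in> lists X" for v
    using keys_frag_extend[of "\<lambda>w. frag_of (v @ w)" q] q that by (fastforce simp: free_ring_simps)
  show ?thesis
    using keys_frag_extend[of "\<lambda>v. frag_extend (\<lambda>w. frag_of (v @ w)) q" p] p sub
    unfolding free_ring_simps mem_Collect_eq by blast
qed

lemma \<psi>_hom:
  assumes "a \<in> carrier A" "b \<in> carrier A"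
  shows "\<psi> (a \<oplus>\<^bsub>A\<^esub> b) = \<psi> a + \<psi> b" "\<psi> (a \<otimes>\<^bsub>A\<^esub> b) = \<psi> a \<otimes>\<^bsub>P\<^esub> \<psi> b"
proof -
  show "\<psi> (a \<oplus>\<^bsub>A\<^esub> b) = \<psi> a + \<psi> b"
    using \<psi>_\<phi>[OF P_add_closed, of "\<psi> a" "\<psi> b"] assms by (simp add: \<phi>_hom \<psi>_closed \<phi>_\<psi>) (simp add: free_ring_simps)
  show "\<psi> (a \<otimes>\<^bsub>A\<^esub> b) = \<psi> a \<otimes>\<^bsub>P\<^esub> \<psi> b"
    using \<psi>_\<phi>[OF P_mult_closed, of "\<psi> a" "\<psi> b"] assms by (simp add: \<phi>_hom \<psi>_closed \<phi>_\<psi>)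
qed

lemma \<psi>_one: "\<psi> \<one>\<^bsub>A\<^esub> = frag_of []"
  using \<psi>_\<phi>[of "\<one>\<^bsub>P\<^esub>"] by (simp add: \<phi>_hom) (simp add: free_ring_simps)

text \<open>The ring homomorphism on \<open>A\<close> with value \<open>s x\<close> at the generator
  \<open>x\<close>, transported from the free ring along \<open>\<phi>\<close>. It respects degrees
  and differentials only under conditions on \<open>s\<close>.\<close>

definition "E s a = free_eval C s (\<psi> a)"

lemma E_hom:
  assumes s: "\<And>x. s x \<in> carrier C"
  shows "E s a \<in> carrier C"
    "a \<in> carrier A \<Longrightarrow> b \<in> carrier A \<Longrightarrow> E s (a \<oplus>\<^bsub>A\<^esub> b) = E s a \<oplus>\<^bsub>C\<^esub> E s b"
    "a \<in> carrier A \<Longrightarrow> b \<in> carrier A \<Longrightarrow> E s (a \<otimes>\<^bsub>A\<^esub> b) = E s a \<otimes>\<^bsub>C\<^esub> E s b"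
    "E s \<one>\<^bsub>A\<^esub> = \<one>\<^bsub>C\<^esub>"
  unfolding E_def using s
  by (simp_all add: C.free_eval_closed \<psi>_hom \<psi>_one C.free_eval_add C.free_eval_of
      free_ring_simps C.free_eval_mult) (simp add: word_prod_def)

lemma E_zero: "(\<And>x. s x \<in> carrier C) \<Longrightarrow> E s \<zero>\<^bsub>A\<^esub> = \<zero>\<^bsub>C\<^esub>"
  using E_hom(2)[of s "\<zero>\<^bsub>A\<^esub>" "\<zero>\<^bsub>A\<^esub>"] E_hom(1)[of s "\<zero>\<^bsub>A\<^esub>"] by (simp add: C.add.r_cancel_one)

lemma E_uminus: "(\<And>x. s x \<in> carrier C) \<Longrightarrow> a \<in> carrier A \<Longrightarrow> E s (\<ominus>\<^bsub>A\<^esub> a) = \<ominus>\<^bsub>C\<^esub> E s a"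
  using E_hom(2)[of s "\<ominus>\<^bsub>A\<^esub> a" a] E_hom(1)[of s]
  by (simp add: A.l_neg E_zero C.minus_equality[symmetric])

lemma E_diff: "(\<And>x. s x \<in> carrier C) \<Longrightarrow> a \<in> carrier A \<Longrightarrow> b \<in> carrier A \<Longrightarrow> E s (a \<ominus>\<^bsub>A\<^esub> b) = E s a \<ominus>\<^bsub>C\<^esub> E s b"
  by (simp add: a_minus_def E_hom E_uminus)

definition "gen x = \<phi> (frag_of [x])"
definition "wrd w = \<phi> (frag_of w)"

lemma wrd_closed: "w \<in> lists X \<Longrightarrow> wrd w \<in> carrier A"
  unfolding wrd_def by (rule \<phi>_hom(1)) (simp add: free_ring_simps)

lemma gen_grade: "x \<in> X \<Longrightarrow> gen x \<in> grade A (deg x)"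
  unfolding gen_def \<phi>_grade[symmetric] by (rule imageI) (simp add: free_ring_simps)

lemma gen_closed: "x \<in> X \<Longrightarrow> gen x \<in> carrier A"
  using gen_grade A.grade_carrier by blast

lemma wrd_Nil: "wrd [] = \<one>\<^bsub>A\<^esub>"
  using \<phi>_hom(4) by (simp add: wrd_def free_ring_simps)

lemma wrd_Cons: "x \<in> X \<Longrightarrow> w \<in> lists X \<Longrightarrow> wrd (x # w) = gen x \<otimes>\<^bsub>A\<^esub> wrd w"
  using \<phi>_hom(3)[of "frag_of [x]" "frag_of w"] by (simp add: wrd_def gen_def free_ring_simps)

lemma E_wrd: "(\<And>x. s x \<in> carrier C) \<Longrightarrow> w \<in> lists X \<Longrightarrow> E s (wrd w) = word_prod C s w"
  unfolding E_def wrd_def by (subst \<psi>_\<phi>) (simp_all add: free_ring_simps C.free_eval_of)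

lemma E_gen: "(\<And>x. s x \<in> carrier C) \<Longrightarrow> x \<in> X \<Longrightarrow> E s (gen x) = s x"
  using E_wrd[of s "[x]"] by (simp add: gen_def wrd_def word_prod_def)

text \<open>Induction over the subring generated by \<open>Y\<close>, with words built up from the
  left. During the construction a property is known only for the generators treated so far, and
  \<open>Y\<close> is the set of these.\<close>

lemma subring_induct:
  assumes Y: "Y \<subseteq> X" and p: "Poly_Mapping.keys p \<subseteq> lists Y"
    and one: "Q \<one>\<^bsub>A\<^esub>"
    and mult: "\<And>x a. x \<in> Y \<Longrightarrow> a \<in> carrier A \<Longrightarrow> Q a \<Longrightarrow> Q (gen x \<otimes>\<^bsub>A\<^esub> a)"
    and diff: "\<And>a b. a \<in> carrier A \<Longrightarrow> b \<in> carrier A \<Longrightarrow> Q a \<Longrightarrow> Q b \<Longrightarrow> Q (a \<ominus>\<^bsub>A\<^esub> b)"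
  shows "Q (\<phi> p)"
proof -
  have w: "Q (wrd w)" if "w \<in> lists Y" for w
    using that
  proof (induction w)
    case (Cons x w)
    then have "w \<in> lists X" "x \<in> X" using Y by auto
    then show ?case using Cons mult[of x "wrd w"] by (simp add: wrd_Cons wrd_closed)
  qed (simp add: wrd_Nil one)
  have z: "\<phi> 0 = \<zero>\<^bsub>A\<^esub>"
    using \<phi>_hom(2)[of 0 0] \<phi>_hom(1)[of 0] by (simp add: free_ring_simps A.add.r_cancel_one)
  have \<phi>d: "\<phi> (a - b) = \<phi> a \<ominus>\<^bsub>A\<^esub> \<phi> b" if "a \<in> carrier P" "b \<in> carrier P" for a b
  proof -
    have c: "a - b \<in> carrier P" using that keys_diff[of a b] by (auto simp: free_ring_simps simp del: lists_eq_set)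
    have "\<phi> a = \<phi> (a - b) \<oplus>\<^bsub>A\<^esub> \<phi> b" using \<phi>_hom(2)[OF c that(2)] by (simp add: free_ring_simps)
    then show ?thesis using \<phi>_hom(1) c that by (simp add: a_minus_def A.a_assoc A.r_neg)
  qed
  have YX: "lists Y \<subseteq> lists X" using Y by (rule lists_mono)
  have "p \<in> carrier P \<and> Q (\<phi> p)" using p
  proof (induction p rule: frag_induction)
    case zero
    have "Q (\<one>\<^bsub>A\<^esub> \<ominus>\<^bsub>A\<^esub> \<one>\<^bsub>A\<^esub>)" using one diff by simp
    then show ?case by (simp add: z free_ring_simps a_minus_def A.r_neg)
  next
    case (one w)
    then show ?case using w YX by (auto simp: wrd_def free_ring_simps simp del: lists_eq_set)
  next
    case (diff a b)
    then show ?case using \<phi>d[of a b] assms(5)[of "\<phi> a" "\<phi> b"] keys_diff[of a b]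
      by (auto simp: free_ring_simps \<phi>_hom(1)[unfolded free_ring_simps mem_Collect_eq] simp del: lists_eq_set)
  qed
  then show ?thesis ..
qed

lemma \<rho>_E:
  assumes s: "\<And>x. s x \<in> carrier C" and Y: "Y \<subseteq> X" "\<And>y. y \<in> Y \<Longrightarrow> \<rho> (gen y) (s y)"
    and p: "Poly_Mapping.keys p \<subseteq> lists Y"
  shows "\<rho> (\<phi> p) (E s (\<phi> p))"
  using Y(1) p
proof (rule subring_induct)
  show "\<rho> \<one>\<^bsub>A\<^esub> (E s \<one>\<^bsub>A\<^esub>)" using s by (simp add: E_hom \<rho>_one)
  show "\<rho> (gen x \<otimes>\<^bsub>A\<^esub> a) (E s (gen x \<otimes>\<^bsub>A\<^esub> a))" if "x \<in> Y" "a \<in> carrier A" "\<rho> a (E s a)" for x a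
  proof -
    have "x \<in> X" using that Y by blast
    then show ?thesis using that s Y(2)[of x]
      by (simp add: E_hom gen_closed E_gen \<rho>_mult)
  qed
  show "\<rho> (a \<ominus>\<^bsub>A\<^esub> b) (E s (a \<ominus>\<^bsub>A\<^esub> b))"
    if "a \<in> carrier A" "b \<in> carrier A" "\<rho> a (E s a)" "\<rho> b (E s b)" for a b
    using that s by (simp add: E_diff E_hom \<rho>_diff)
qed

text \<open>Both \<open>dif C \<circ> E s\<close> and \<open>E s \<circ> dif A\<close> are
  derivations along \<open>E s\<close>, so agreement on the generators in \<open>Y\<close> spreads
  to the subring generated by them. The degrees of the values \<open>s y\<close> enter through the
  signs of the Leibniz rule.\<close>

lemma E_dif:
  assumes s: "\<And>x. s x \<in> carrier C" and Y: "Y \<subseteq> X" "\<And>y. y \<in> Y \<Longrightarrow> s y \<in> grade C (deg y)"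
    "\<And>y. y \<in> Y \<Longrightarrow> dif C (s y) = E s (dif A (gen y))"
    and p: "Poly_Mapping.keys p \<subseteq> lists Y"
  shows "dif C (E s (\<phi> p)) = E s (dif A (\<phi> p))"
  using Y(1) p
proof (rule subring_induct)
  show "dif C (E s \<one>\<^bsub>A\<^esub>) = E s (dif A \<one>\<^bsub>A\<^esub>)" using s by (simp add: E_hom E_zero A.dif_one C.dif_one)
  show "dif C (E s (gen x \<otimes>\<^bsub>A\<^esub> a)) = E s (dif A (gen x \<otimes>\<^bsub>A\<^esub> a))"
    if "x \<in> Y" "a \<in> carrier A" "dif C (E s a) = E s (dif A a)" for x a
  proof -
    have x: "x \<in> X" using that Y by blast
    note c = gen_closed[OF x] A.dif_closed[OF gen_closed[OF x]] A.dif_closed[OF that(2)]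
    show ?thesis using that s Y(2,3)[of x] x c
      by (simp add: E_hom E_gen A.dif_mult[OF gen_grade] C.dif_mult[of _ "deg x"] A.sign_cases C.sign_cases E_uminus)
  qed
  show "dif C (E s (a \<ominus>\<^bsub>A\<^esub> b)) = E s (dif A (a \<ominus>\<^bsub>A\<^esub> b))"
    if "a \<in> carrier A" "b \<in> carrier A" "dif C (E s a) = E s (dif A a)" "dif C (E s b) = E s (dif A b)" for a b
    using that s by (simp add: E_diff E_hom A.dif_minus C.dif_minus A.dif_closed)
qed

lemma E_grade:
  assumes s: "\<And>x. s x \<in> grade C (deg x)" and a: "a \<in> grade A i"
  shows "E s a \<in> grade C i"
proof -
  obtain p where p: "p \<in> grade P i" "a = \<phi> p" using a \<phi>_grade[of i] by blast
  have "word_prod C s w \<in> grade C (sum_list (map deg w))" for w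
    by (induction w) (auto simp: word_prod_def C.grade_one intro!: C.grade_mult s)
  then have "word_prod C s w \<in> grade C i" if "w \<in> Poly_Mapping.keys p" for w
    using p(1) that by (metis (mono_tags, lifting) free_ring_simps(6) mem_Collect_eq)
  then have "free_eval C s p \<in> grade C i"
    unfolding free_eval_def by (intro C.finsum_grade) (auto intro: C.int_pow_grade)
  moreover have "\<psi> a = p" using p \<psi>_\<phi> by (auto simp: free_ring_simps simp del: lists_eq_set)
  ultimately show ?thesis by (simp add: E_def)
qed

text \<open>The first layer of the filtration containing \<open>x\<close>. Since
  \<open>F (- 1)\<close> is empty, a natural number suffices as index.\<close>

definition "rank x = (LEAST n. x \<in> F (int n))"

lemma rank: "x \<in> X \<Longrightarrow> x \<in> F (int (rank x))"
proof -
  assume "x \<in> X"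
  then obtain j where j: "j \<ge> -1" "x \<in> F j" "j \<noteq> -1"
    using filtration unfolding set_filtration_def by (metis UN_E atLeast_iff empty_iff)
  then have "x \<in> F (int (nat j))" by simp
  then show ?thesis unfolding rank_def by (rule LeastI)
qed

text \<open>The differential lowers the filtration, so it involves only generators of smaller rank.
  This makes the recursion over generators well-founded.\<close>

lemma dif_gen:
  assumes "x \<in> X"
  obtains p where "Poly_Mapping.keys p \<subseteq> lists {y \<in> X. rank y < rank x}" "dif A (gen x) = \<phi> p"
proof -
  obtain p where p: "p \<in> free_ring_filtration F deg (int (rank x) - 1)" "dif A (gen x) = \<phi> p"
    using \<phi>_dif[OF _ rank[OF assms]] unfolding gen_def by auto
  have "Poly_Mapping.keys p \<subseteq> lists {y \<in> X. rank y < rank x}"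
  proof (cases "rank x")
    \<comment> \<open>Here the polynomial lies in the layer of index -1, which is
      \<open>{0}\<close>, so it has no words at all.\<close>
    case 0
    then show ?thesis using p(1) by (simp add: free_ring_filtration_def)
  next
    case (Suc n)
    have "y \<in> X \<and> rank y < rank x" if "y \<in> F (int n)" for y
    proof -
      have "y \<in> X" using that filtration unfolding set_filtration_def by force
      moreover have "rank y \<le> n" unfolding rank_def using that by (rule Least_le)
      ultimately show ?thesis using Suc by simp
    qed
    then have "lists (F (int n)) \<subseteq> lists {y \<in> X. rank y < rank x}" by (intro lists_mono) blast
    then show ?thesis using p(1) Suc by (auto simp: free_ring_filtration_def free_ring_simps simp del: lists_eq_set)
  qed
  then show ?thesis using that p(2) by blast
qed

lemma E_dif_gen_cong:
  assumes "x \<in> X" "\<And>y. y \<in> X \<Longrightarrow> rank y < rank x \<Longrightarrow> s y = s' y" "\<And>y. s' y \<in> carrier C"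
  shows "E s (dif A (gen x)) = E s' (dif A (gen x))"
proof -
  obtain p where p: "Poly_Mapping.keys p \<subseteq> lists {y \<in> X. rank y < rank x}" "dif A (gen x) = \<phi> p"
    using dif_gen[OF assms(1)] by blast
  have "lists {y \<in> X. rank y < rank x} \<subseteq> lists X" by (rule lists_mono) blast
  then have "\<psi> (\<phi> p) = p" using p(1) by (intro \<psi>_\<phi>) (simp add: free_ring_simps del: lists_eq_set)
  moreover have "free_eval C s p = free_eval C s' p"
    using p(1) assms(2,3) by (intro C.free_eval_cong) auto
  ultimately show ?thesis by (simp add: E_def p(2))
qed

text \<open>\<open>E\<close> expects values at all generators, while at \<open>x\<close> only those
  of smaller rank have been chosen. The default zero, imposed also on values of the wrong degree,
  gives a well-graded assignment for an arbitrary \<open>f\<close>.\<close>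

definition "truncated f x = (\<lambda>y. if y \<in> X \<and> rank y < rank x \<and> f y \<in> grade C (deg y) then f y else \<zero>\<^bsub>C\<^esub>)"

lemma truncated_grade: "truncated f x y \<in> grade C (deg y)"
  by (simp add: truncated_def C.zero_grade)

text \<open>The obstruction argument: take any homogeneous \<open>r\<close> related to the
  generator. The error \<open>k\<close>, by which its differential misses the prescribed value, is a
  cocycle in the kernel, so it is the differential of some \<open>k'\<close> in the kernel, and
  \<open>r\<close> minus \<open>k'\<close> is the value sought.\<close>

lemma lift_generator:
  assumes x: "x \<in> X"
    and f: "\<And>y. y \<in> X \<Longrightarrow> rank y < rank x \<Longrightarrow>
      f y \<in> grade C (deg y) \<and> \<rho> (gen y) (f y) \<and> dif C (f y) = E (truncated f y) (dif A (gen y))"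
  shows "\<exists>r\<in>grade C (deg x). \<rho> (gen x) r \<and> dif C r = E (truncated f x) (dif A (gen x))"
proof -
  define s where "s = truncated f x"
  define Y where "Y = {y \<in> X. rank y < rank x}"
  have sg: "s y \<in> grade C (deg y)" for y by (simp add: s_def truncated_grade)
  then have sc: "s y \<in> carrier C" for y using C.grade_carrier by blast
  have sY: "s y = f y" if "y \<in> Y" for y using that f by (simp add: s_def truncated_def Y_def)
  have ds: "dif C (s y) = E s (dif A (gen y))" if "y \<in> Y" for y
  proof -
    have y: "y \<in> X" "rank y < rank x" using that by (auto simp: Y_def)
    have "E (truncated f y) (dif A (gen y)) = E s (dif A (gen y))"
      using y sc by (intro E_dif_gen_cong) (auto simp: s_def truncated_def)
    then show ?thesis using f[OF y] sY[OF that] by simp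
  qed
  have YX: "Y \<subseteq> X" by (auto simp: Y_def)
  obtain p where p: "Poly_Mapping.keys p \<subseteq> lists Y" "dif A (gen x) = \<phi> p"
    using dif_gen[OF x] unfolding Y_def by blast
  define a where "a = dif A (gen x)"
  have a: "a \<in> grade A (deg x + 1)" "a \<in> carrier A"
    using A.dif_grade[OF gen_grade[OF x]] A.dif_closed[OF gen_closed[OF x]] by (simp_all add: a_def)
  have \<rho>a: "\<rho> a (E s a)"
    unfolding a_def p(2) using sc YX p(1) f by (intro \<rho>_E[of s Y]) (auto simp: sY Y_def)
  have da: "dif C (E s a) = \<zero>\<^bsub>C\<^esub>"
  proof -
    have "dif C (E s a) = E s (dif A a)"
      unfolding a_def p(2) using sc YX p(1) sg ds by (intro E_dif[of s Y]) auto
    then show ?thesis using A.dif_dif[OF gen_closed[OF x]] E_zero[of s] sc by (simp add: a_def)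
  qed
  obtain r where r: "r \<in> grade C (deg x)" "\<rho> (gen x) r" using \<rho>_surj[OF gen_grade[OF x]] by blast
  note rc = C.grade_carrier[OF r(1)]
  define k where "k = dif C r \<ominus>\<^bsub>C\<^esub> E s a"
  have Ea: "E s a \<in> carrier C" using E_hom(1) sc by blast
  have "k \<in> grade C (deg x + 1)"
    unfolding k_def using r(1) E_grade[of s, OF sg a(1)] by (intro C.minus_grade C.dif_grade)
  moreover have "dif C k = \<zero>\<^bsub>C\<^esub>"
    unfolding k_def using rc Ea by (simp add: C.dif_minus C.dif_closed C.dif_dif da) (simp add: a_minus_def)
  \<comment> \<open>The differential of \<open>r\<close> and the value \<open>E s a\<close> are both
    related to \<open>a\<close>, so their difference is related to zero.\<close>
  moreover have "\<rho> \<zero>\<^bsub>A\<^esub> k"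
    using \<rho>_diff[OF \<rho>_dif[OF r(2) gen_closed[OF x] rc] \<rho>a] a rc Ea
    by (simp add: a_def k_def C.dif_closed a_minus_def A.r_neg)
  ultimately obtain k' where k': "k' \<in> grade C (deg x)" "\<rho> \<zero>\<^bsub>A\<^esub> k'" "dif C k' = k"
    using \<rho>_acyclic[of k "deg x + 1"] by auto
  note kc = C.grade_carrier[OF k'(1)]
  show ?thesis
  proof (rule bexI, intro conjI)
    show "r \<ominus>\<^bsub>C\<^esub> k' \<in> grade C (deg x)" using r k' by (intro C.minus_grade)
    show "\<rho> (gen x) (r \<ominus>\<^bsub>C\<^esub> k')"
      using \<rho>_diff[OF r(2) k'(2) gen_closed[OF x] _ rc kc] gen_closed[OF x] by (simp add: a_minus_def)
    have "dif C (r \<ominus>\<^bsub>C\<^esub> k') = dif C r \<ominus>\<^bsub>C\<^esub> (dif C r \<ominus>\<^bsub>C\<^esub> E s a)"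
      using rc kc by (simp add: C.dif_minus k'(3) k_def)
    also have "\<dots> = E s a" using Ea C.dif_closed[OF rc]
      by (simp add: a_minus_def C.minus_add C.a_assoc[symmetric] C.r_neg)
    finally show "dif C (r \<ominus>\<^bsub>C\<^esub> k') = E (truncated f x) (dif A (gen x))" by (simp add: s_def a_def)
  qed
qed

theorem section_exists: "\<exists>g\<in>dg_hom A C. \<forall>a\<in>carrier A. \<rho> a (g a)"
proof -
  have "\<exists>f. \<forall>x. x \<in> X \<longrightarrow> f x \<in> grade C (deg x) \<and> \<rho> (gen x) (f x) \<and> dif C (f x) = E (truncated f x) (dif A (gen x))"
  \<comment> \<open>The condition on \<open>f x\<close> refers to \<open>f\<close> only through
    \<open>truncated f x\<close>, hence only to generators of smaller rank, as recursive choice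
    requires.\<close>
  proof (rule dependent_wf_choice[of "measure rank"])
    fix f g :: "'x \<Rightarrow> 'c" and x r assume eq: "\<And>z. (z, x) \<in> measure rank \<Longrightarrow> f z = g z"
    have "truncated f x y = truncated g x y" for y
      using eq[of y] by (cases "rank y < rank x") (simp_all add: truncated_def)
    then have "truncated f x = truncated g x" by (rule ext)
    then show "(x \<in> X \<longrightarrow> r \<in> grade C (deg x) \<and> \<rho> (gen x) r \<and> dif C r = E (truncated f x) (dif A (gen x))) =
      (x \<in> X \<longrightarrow> r \<in> grade C (deg x) \<and> \<rho> (gen x) r \<and> dif C r = E (truncated g x) (dif A (gen x)))"
      by simp
  next
    fix x f assume "\<And>y. (y, x) \<in> measure rank \<Longrightarrow>
      y \<in> X \<longrightarrow> f y \<in> grade C (deg y) \<and> \<rho> (gen y) (f y) \<and> dif C (f y) = E (truncated f y) (dif A (gen y))"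
    then show "\<exists>r. x \<in> X \<longrightarrow> r \<in> grade C (deg x) \<and> \<rho> (gen x) r \<and> dif C r = E (truncated f x) (dif A (gen x))"
      using lift_generator[of x f] unfolding in_measure by blast
  qed simp
  then obtain f where f: "\<And>x. x \<in> X \<Longrightarrow>
      f x \<in> grade C (deg x) \<and> \<rho> (gen x) (f x) \<and> dif C (f x) = E (truncated f x) (dif A (gen x))"
    by blast
  have f1: "f x \<in> grade C (deg x)" and f2: "\<rho> (gen x) (f x)" if "x \<in> X" for x
    using f[OF that] by auto
  define s where "s x = (if x \<in> X then f x else \<zero>\<^bsub>C\<^esub>)" for x
  have sg: "s y \<in> grade C (deg y)" for y using f1 by (simp add: s_def C.zero_grade)
  then have sc: "s y \<in> carrier C" for y using C.grade_carrier by blast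
  have ds: "dif C (s y) = E s (dif A (gen y))" if "y \<in> X" for y
  proof -
    have "E (truncated f y) (dif A (gen y)) = E s (dif A (gen y))"
      using that sc f1 by (intro E_dif_gen_cong) (auto simp: s_def truncated_def)
    then show ?thesis using f[OF that] that by (simp add: s_def)
  qed
  have keys: "Poly_Mapping.keys (\<psi> a) \<subseteq> lists X" if "a \<in> carrier A" for a
    using \<psi>_closed[OF that] by (simp add: free_ring_simps)
  show ?thesis
  proof (rule bexI, rule ballI)
    fix a assume a: "a \<in> carrier A"
    have "\<rho> (gen y) (s y)" if "y \<in> X" for y using f2[OF that] that by (simp add: s_def)
    from \<rho>_E[of s X "\<psi> a", OF sc subset_refl this keys[OF a]]
    have "\<rho> (\<phi> (\<psi> a)) (E s (\<phi> (\<psi> a)))" .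
    then show "\<rho> a (restrict (E s) (carrier A) a)" using a by (simp add: \<phi>_\<psi>)
  next
    have "dg_map A C (restrict (E s) (carrier A))"
    proof (rule dg_mapI)
      fix a i assume a: "a \<in> grade A i"
      show "restrict (E s) (carrier A) a \<in> grade C i"
        using E_grade[of s, OF sg a] A.grade_carrier[OF a] by simp
    next
      fix a assume a: "a \<in> carrier A"
      have "dif C (E s (\<phi> (\<psi> a))) = E s (dif A (\<phi> (\<psi> a)))"
        by (rule E_dif[of s X "\<psi> a", OF sc subset_refl sg ds keys[OF a]])
      then show "restrict (E s) (carrier A) (dif A a) = dif C (restrict (E s) (carrier A) a)"
        using a by (simp add: \<phi>_\<psi> A.dif_closed)
    qed (simp_all add: E_hom sc)
    then show "restrict (E s) (carrier A) \<in> dg_hom A C" by (simp add: dg_hom_iff)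
  qed
qed

end

theorem semi_free_lifting:
  assumes "semi_free A" "acyclic_correspondence A C \<rho>"
  shows "\<exists>g\<in>dg_hom A C. \<forall>a\<in>carrier A. \<rho> a (g a)"
proof -
  obtain X :: "'a set" and deg F \<phi> where *: "set_filtration X F \<and> \<phi> \<in> ring_iso (free_ring X deg) A \<and>
      (\<forall>i. \<phi> ` grade (free_ring X deg) i = grade A i) \<and>
      (\<forall>j\<ge>0. \<forall>x \<in> F j. dif A (\<phi> (frag_of [x])) \<in> \<phi> ` free_ring_filtration F deg (j - 1))"
    using assms(1) unfolding semi_free_def by (elim conjE exE) (rule that, intro conjI)
  have "lifting_problem A C \<rho> X deg F \<phi>"
    by (intro lifting_problem.intro lifting_problem_axioms.intro assms(2)) (use * in blast)+
  then show ?thesis by (rule lifting_problem.section_exists)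
qed

section \<open>Tensors as cochains with coefficients\<close>

context dg_pair
begin

text \<open>The extension \<open>h0\<close> of the biadditive map to the free abelian group vanishes
  on \<open>R\<close>, so it factors through the cosets.\<close>

lemma tensor_universal:
  fixes D :: "('c, 'm) ring_scheme"
  assumes "abelian_group D"
    and \<beta>: "\<And>a b. a \<in> carrier A \<Longrightarrow> b \<in> carrier B \<Longrightarrow> \<beta> a b \<in> carrier D"
    and left: "\<And>a a' b. a \<in> carrier A \<Longrightarrow> a' \<in> carrier A \<Longrightarrow> b \<in> carrier B \<Longrightarrow> \<beta> (a \<oplus>\<^bsub>A\<^esub> a') b = \<beta> a b \<oplus>\<^bsub>D\<^esub> \<beta> a' b"
    and right: "\<And>a b b'. a \<in> carrier A \<Longrightarrow> b \<in> carrier B \<Longrightarrow> b' \<in> carrier B \<Longrightarrow> \<beta> a (b \<oplus>\<^bsub>B\<^esub> b') = \<beta> a b \<oplus>\<^bsub>D\<^esub> \<beta> a b'"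
  shows "\<exists>h. (\<forall>s\<in>carrier T. h s \<in> carrier D) \<and>
    (\<forall>s\<in>carrier T. \<forall>t\<in>carrier T. h (s \<oplus>\<^bsub>T\<^esub> t) = h s \<oplus>\<^bsub>D\<^esub> h t) \<and>
    (\<forall>a\<in>carrier A. \<forall>b\<in>carrier B. h (pt a b) = \<beta> a b)"
proof -
  interpret D: abelian_group D by fact
  have "comm_group (add_monoid D)" by (rule D.a_comm_group)
  then obtain h0 where h0: "h0 \<in> hom (free_Abelian_group (carrier A \<times> carrier B)) (add_monoid D)"
    "\<And>p. p \<in> carrier A \<times> carrier B \<Longrightarrow> h0 (frag_of p) = (case p of (a, b) \<Rightarrow> \<beta> a b)"
    by (rule comm_group.free_Abelian_group_universal[of _ "\<lambda>(a, b). \<beta> a b" "carrier A \<times> carrier B"])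
      (use \<beta> in auto)
  have cl0: "h0 x \<in> carrier D" if "x \<in> F" for x
    using h0(1) that by (simp add: hom_def Pi_iff)
  have add0: "h0 (x + y) = h0 x \<oplus>\<^bsub>D\<^esub> h0 y" if "x \<in> F" "y \<in> F" for x y
    using h0(1) that by (simp add: hom_def)
  have z0: "h0 0 = \<zero>\<^bsub>D\<^esub>" using add0[of 0 0] cl0[of 0] by (simp add: D.add.r_cancel_one)
  have diff0: "h0 (x - y) = \<zero>\<^bsub>D\<^esub> \<longleftrightarrow> h0 x = h0 y" if "x \<in> F" "y \<in> F" for x y
  proof -
    have "x - y \<in> F" using that frag_subgroupD(2)[OF F_subgroup] by blast
    then show ?thesis using add0[of "x - y" y] cl0[of "x - y"] cl0[OF that(1)] cl0[OF that(2)] that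
      by (auto simp: D.add.r_cancel_one)
  qed
  have Rel0: "h0 r = \<zero>\<^bsub>D\<^esub>" if "r \<in> R" for r
  proof -
    have gen: "h0 (frag_of (a \<oplus>\<^bsub>A\<^esub> a', b) - frag_of (a, b) - frag_of (a', b)) = \<zero>\<^bsub>D\<^esub>"
      if "a \<in> carrier A" "a' \<in> carrier A" "b \<in> carrier B" for a a' b
    proof -
      have "h0 (frag_of (a \<oplus>\<^bsub>A\<^esub> a', b)) = h0 (frag_of (a, b) + frag_of (a', b))"
        using that by (simp add: add0 h0(2) left)
      then show ?thesis using that frag_subgroupD(4)[OF F_subgroup, of "frag_of (a, b)" "frag_of (a', b)"]
          diff0[of "frag_of (a \<oplus>\<^bsub>A\<^esub> a', b)" "frag_of (a, b) + frag_of (a', b)"]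
        by (simp add: diff_diff_add)
    qed
    have gen': "h0 (frag_of (a, b \<oplus>\<^bsub>B\<^esub> b') - frag_of (a, b) - frag_of (a, b')) = \<zero>\<^bsub>D\<^esub>"
      if "a \<in> carrier A" "b \<in> carrier B" "b' \<in> carrier B" for a b b'
    proof -
      have "h0 (frag_of (a, b \<oplus>\<^bsub>B\<^esub> b')) = h0 (frag_of (a, b) + frag_of (a, b'))"
        using that by (simp add: add0 h0(2) right)
      then show ?thesis using that frag_subgroupD(4)[OF F_subgroup, of "frag_of (a, b)" "frag_of (a, b')"]
          diff0[of "frag_of (a, b \<oplus>\<^bsub>B\<^esub> b')" "frag_of (a, b) + frag_of (a, b')"]
        by (simp add: diff_diff_add)
    qed
    from that show ?thesis unfolding tensor_rels_def
    proof (induction r rule: generate.induct)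
      case one
      then show ?case by (simp add: tensor_free_def z0)
    next
      case (incl h)
      then show ?case using gen gen' by blast
    next
      case (inv h)
      then have "h \<in> R" unfolding tensor_rels_def by (rule generate.incl)
      then have hF: "h \<in> F" using rels_F by blast
      then have "inv\<^bsub>tensor_free A B\<^esub> h = 0 - h" by (simp add: tensor_free_def)
      moreover have "h0 h = \<zero>\<^bsub>D\<^esub>" using inv gen gen' by blast
      moreover have "h0 (0 - h) = \<zero>\<^bsub>D\<^esub> \<longleftrightarrow> h0 0 = h0 h" using hF by (intro diff0) auto
      ultimately show ?case using z0 by simp
    next
      case (eng h1 h2)
      then have "h1 \<in> F" "h2 \<in> F" using rels_F unfolding tensor_rels_def by blast+
      then show ?case using eng by (simp add: tensor_free_def add0)
    qed
  qed
  \<comment> \<open>A coset is evaluated at an arbitrary representative; the choice is immaterial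
    because \<open>h0\<close> is zero on \<open>R\<close>.\<close>
  define h where "h s = h0 (SOME z. z \<in> s)" for s
  have h: "h (cl x) = h0 x" if x: "x \<in> F" for x
  proof -
    have "x \<in> cl x" by (simp add: mem_tensor_class rels)
    then have "(SOME z. z \<in> cl x) \<in> cl x" by (rule someI)
    then have d: "(SOME z. z \<in> cl x) - x \<in> R" by (simp add: mem_tensor_class)
    then have "(SOME z. z \<in> cl x) - x + x \<in> F" using frag_subgroupD(4)[OF F_subgroup _ x] rels_F by blast
    then have "(SOME z. z \<in> cl x) \<in> F" by (simp only: diff_add_cancel)
    then show ?thesis unfolding h_def using diff0[OF _ x] Rel0[OF d] by blast
  qed
  show ?thesis
  proof (intro exI conjI ballI)
    fix s t assume "s \<in> carrier T" "t \<in> carrier T"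
    then show "h (s \<oplus>\<^bsub>T\<^esub> t) = h s \<oplus>\<^bsub>D\<^esub> h t"
      by (elim class_cases) (simp only: class_add h frag_subgroupD(4)[OF F_subgroup] add0)
  next
    fix s assume "s \<in> carrier T"
    then show "h s \<in> carrier D" by (elim class_cases) (simp only: h cl0)
  next
    fix a b assume "a \<in> carrier A" "b \<in> carrier B"
    then show "h (pt a b) = \<beta> a b" unfolding pure_tensor_def by (simp add: h h0(2))
  qed
qed

end

lemma (in abelian_group) additive_finsum:
  fixes D :: "('c, 'm) ring_scheme"
  assumes "abelian_group D" and h: "\<And>s. s \<in> carrier G \<Longrightarrow> h s \<in> carrier D"
    "\<And>s t. s \<in> carrier G \<Longrightarrow> t \<in> carrier G \<Longrightarrow> h (s \<oplus> t) = h s \<oplus>\<^bsub>D\<^esub> h t"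
    and S: "finite S" "\<And>i. i \<in> S \<Longrightarrow> f i \<in> carrier G"
  shows "h (finsum G f S) = finsum D (\<lambda>i. h (f i)) S"
proof -
  interpret D: abelian_group D by fact
  have z: "h \<zero> = \<zero>\<^bsub>D\<^esub>" using h(2)[of \<zero> \<zero>] h(1)[of \<zero>] by (simp add: D.add.r_cancel_one)
  show ?thesis using S
  proof (induction S rule: finite_induct)
    case (insert i S)
    have "finsum G f (insert i S) = f i \<oplus> finsum G f S"
      "finsum D (\<lambda>i. h (f i)) (insert i S) = h (f i) \<oplus>\<^bsub>D\<^esub> finsum D (\<lambda>i. h (f i)) S"
      using insert h(1) by (auto intro!: finsum_insert D.finsum_insert)
    then show ?case using insert h(2) by (auto simp: finsum_closed)
  qed (simp add: z)
qed

lemma (in abelian_group) additive_int_pow: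
  fixes D :: "('c, 'm) ring_scheme" and k :: int
  assumes "abelian_group D" and h: "\<And>s. s \<in> carrier G \<Longrightarrow> h s \<in> carrier D"
    "\<And>s t. s \<in> carrier G \<Longrightarrow> t \<in> carrier G \<Longrightarrow> h (s \<oplus> t) = h s \<oplus>\<^bsub>D\<^esub> h t"
    and s: "s \<in> carrier G"
  shows "h ([k] \<cdot> s) = [k] \<cdot>\<^bsub>D\<^esub> h s"
proof -
  interpret D: abelian_group D by fact
  interpret h: group_hom "add_monoid G" "add_monoid D" h
    using h by (intro group_hom.intro group_hom_axioms.intro add.is_group D.add.is_group) (simp add: hom_def Pi_iff)
  show ?thesis using h.hom_int_pow[of s k] s by (simp add: add_pow_def)
qed

locale cochain_tensor = simplicial_set X + B: dg_ring B
  for X :: "'x sset" and B :: "'b dg_ring"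
begin

sublocale N: dg_pair "cochain_ring X" B
  by (intro dg_pair.intro dg_ring_C B.dg_ring_axioms)

abbreviation "N \<equiv> tensor (cochain_ring X) B"
abbreviation "pt \<equiv> pure_tensor (cochain_ring X) B"

text \<open>The value at the \<open>p\<close>-simplex \<open>x\<close> of an element of \<open>N(X, B)\<close>, regarded as a cochain with
  coefficients in \<open>B\<close>.\<close>

definition ev :: "nat \<Rightarrow> 'x \<Rightarrow> ((nat \<Rightarrow> 'x \<Rightarrow> int) \<times> 'b \<Rightarrow>\<^sub>0 int) set \<Rightarrow> 'b"
  where "ev p x = (SOME h. (\<forall>s\<in>carrier N. h s \<in> carrier B) \<and>
    (\<forall>s\<in>carrier N. \<forall>t\<in>carrier N. h (s \<oplus>\<^bsub>N\<^esub> t) = h s \<oplus>\<^bsub>B\<^esub> h t) \<and>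
    (\<forall>\<phi>\<in>carrier C. \<forall>b\<in>carrier B. h (pt \<phi> b) = [\<phi> p x] \<cdot>\<^bsub>B\<^esub> b))"

lemma ev_props: "(\<forall>s\<in>carrier N. ev p x s \<in> carrier B) \<and>
    (\<forall>s\<in>carrier N. \<forall>t\<in>carrier N. ev p x (s \<oplus>\<^bsub>N\<^esub> t) = ev p x s \<oplus>\<^bsub>B\<^esub> ev p x t) \<and>
    (\<forall>\<phi>\<in>carrier C. \<forall>b\<in>carrier B. ev p x (pt \<phi> b) = [\<phi> p x] \<cdot>\<^bsub>B\<^esub> b)"
proof -
  have "\<exists>h. (\<forall>s\<in>carrier N. h s \<in> carrier B) \<and>
    (\<forall>s\<in>carrier N. \<forall>t\<in>carrier N. h (s \<oplus>\<^bsub>N\<^esub> t) = h s \<oplus>\<^bsub>B\<^esub> h t) \<and>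
    (\<forall>\<phi>\<in>carrier C. \<forall>b\<in>carrier B. h (pt \<phi> b) = [\<phi> p x] \<cdot>\<^bsub>B\<^esub> b)"
    by (rule N.tensor_universal)
      (simp_all add: B.abelian_group_axioms C_simps B.add.int_pow_mult B.add.int_pow_distrib)
  then show ?thesis unfolding ev_def by (rule someI_ex)
qed

lemma ev_closed: "s \<in> carrier N \<Longrightarrow> ev p x s \<in> carrier B"
  and ev_add: "s \<in> carrier N \<Longrightarrow> t \<in> carrier N \<Longrightarrow> ev p x (s \<oplus>\<^bsub>N\<^esub> t) = ev p x s \<oplus>\<^bsub>B\<^esub> ev p x t"
  and ev_pure: "\<phi> \<in> cochains X \<Longrightarrow> b \<in> carrier B \<Longrightarrow> ev p x (pt \<phi> b) = [\<phi> p x] \<cdot>\<^bsub>B\<^esub> b"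
  using ev_props by (simp_all add: C_simps)

lemma ev_zero: "ev p x \<zero>\<^bsub>N\<^esub> = \<zero>\<^bsub>B\<^esub>"
  using ev_add[of "\<zero>\<^bsub>N\<^esub>" "\<zero>\<^bsub>N\<^esub>"] ev_closed[of "\<zero>\<^bsub>N\<^esub>"] by (simp add: B.add.r_cancel_one)

lemma ev_finsum: "finite S \<Longrightarrow> (\<And>i. i \<in> S \<Longrightarrow> f i \<in> carrier N) \<Longrightarrow>
    ev p x (finsum N f S) = finsum B (\<lambda>i. ev p x (f i)) S"
  by (rule N.T.additive_finsum[OF B.abelian_group_axioms]) (simp_all add: ev_closed ev_add)

definition nondeg :: "(nat \<times> 'x) set"
  where "nondeg = {(p, x). x \<in> simplices X p \<and> x \<notin> degenerate X p}"

text \<open>A homogeneous cochain vanishes on \<open>p\<close>-simplices unless its degree is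
  \<open>p\<close>, so the left factor absorbs exactly \<open>p\<close> of the total degree.\<close>

lemma ev_grade:
  assumes "s \<in> grade N n"
  shows "ev p x s \<in> grade B (n - int p)"
  using assms
proof (induction s rule: N.grade_T_induct)
  case (pure i \<phi> b)
  then have "ev p x (pt \<phi> b) = [\<phi> p x] \<cdot>\<^bsub>B\<^esub> b"
    by (simp add: ev_pure grade_C_iff B.grade_carrier)
  then show ?case using pure
    by (cases "int p = i") (auto simp: grade_C_iff B.int_pow_grade B.int_pow_zero B.zero_grade)
next
  case (add s t)
  then show ?case by (simp add: ev_add N.T.grade_carrier B.add_grade)
qed

definition delta :: "nat \<Rightarrow> 'x \<Rightarrow> nat \<Rightarrow> 'x \<Rightarrow> int"
  where "delta p x = (\<lambda>r y. if r = p \<and> y = x then 1 else 0)"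

lemma delta_grade: "(p, x) \<in> nondeg \<Longrightarrow> delta p x \<in> grade C (int p)"
  unfolding grade_C_iff nondeg_def
  by (auto simp: delta_def intro!: cochainsI[of _ p])

lemma delta_cochain: "(p, x) \<in> nondeg \<Longrightarrow> delta p x \<in> cochains X"
  using delta_grade grade_C_iff by blast

text \<open>Moving an integer across the tensor sign turns a multiple of a dual cochain into the
  dual cochain with a multiplied coefficient in \<open>B\<close>.\<close>

lemma pt_scale:
  assumes "\<phi> \<in> cochains X" "b \<in> carrier B"
  shows "pt (\<lambda>p x. k * \<phi> p x) b = pt \<phi> ([k] \<cdot>\<^bsub>B\<^esub> b)"
proof -
  have e: "[k] \<cdot>\<^bsub>C\<^esub> \<phi> = (\<lambda>p x. k * \<phi> p x)" for k :: int
  proof (induction k rule: int_induct[of _ 0])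
    case base
    then show ?case using assms by (simp add: C.int_pow_zero) (simp add: C_simps)
  next
    case (step1 i)
    have "[(i + 1)] \<cdot>\<^bsub>C\<^esub> \<phi> = [i] \<cdot>\<^bsub>C\<^esub> \<phi> \<oplus>\<^bsub>C\<^esub> \<phi>"
      using assms C.add.int_pow_mult[of \<phi> i 1] by (simp add: C_simps(1) C.add.int_pow_1)
    then show ?case by (simp add: step1 C_simps algebra_simps)
  next
    case (step2 i)
    have "[(i - 1)] \<cdot>\<^bsub>C\<^esub> \<phi> = [i] \<cdot>\<^bsub>C\<^esub> \<phi> \<oplus>\<^bsub>C\<^esub> \<ominus>\<^bsub>C\<^esub> \<phi>"
      using assms C.add.int_pow_mult[of \<phi> i "-1"] by (simp add: C_simps(1) C.add.int_pow_neg C.add.int_pow_1)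
    then show ?case using assms by (simp add: step2 C_uminus C_simps algebra_simps)
  qed
  have "pt ([k] \<cdot>\<^bsub>C\<^esub> \<phi>) b = [k] \<cdot>\<^bsub>N\<^esub> pt \<phi> b"
    using assms by (intro C.additive_int_pow[of N "\<lambda>\<phi>. pt \<phi> b"] N.T.abelian_group_axioms)
      (simp_all add: N.pt_closed N.pt_add_left C_simps(1))
  moreover have "pt \<phi> ([k] \<cdot>\<^bsub>B\<^esub> b) = [k] \<cdot>\<^bsub>N\<^esub> pt \<phi> b"
    using assms by (intro B.additive_int_pow[of N "\<lambda>b. pt \<phi> b"] N.T.abelian_group_axioms)
      (simp_all add: N.pt_closed N.pt_add_right C_simps(1))
  ultimately show ?thesis by (simp add: e)
qed

text \<open>The cochain with prescribed values at the nondegenerate simplices. When there are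
  finitely many of them it is inverse to evaluation, which identifies \<open>N\<close> with the
  \<open>B\<close>-valued functions on \<open>nondeg\<close>.\<close>

definition build :: "(nat \<Rightarrow> 'x \<Rightarrow> 'b) \<Rightarrow> ((nat \<Rightarrow> 'x \<Rightarrow> int) \<times> 'b \<Rightarrow>\<^sub>0 int) set"
  where "build e = finsum N (\<lambda>(p, x). pt (delta p x) (e p x)) nondeg"

lemma pt_delta_closed: "(p, x) \<in> nondeg \<Longrightarrow> b \<in> carrier B \<Longrightarrow> pt (delta p x) b \<in> carrier N"
  by (rule N.pt_closed) (simp_all add: delta_cochain C_simps(1))

context
  assumes fin: "finite nondeg"
begin

lemma build_grade:
  assumes "\<And>p x. (p, x) \<in> nondeg \<Longrightarrow> e p x \<in> grade B (n - int p)"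
  shows "build e \<in> grade N n"
  unfolding build_def
proof (rule N.T.finsum_grade[OF fin])
  fix i assume i: "i \<in> nondeg"
  obtain p x where px: "i = (p, x)" by (cases i)
  show "(case i of (p, x) \<Rightarrow> pt (delta p x) (e p x)) \<in> grade N n"
    using N.pt_grade[OF delta_grade assms, of p x p x] i by (simp add: px)
qed

lemma ev_build:
  assumes e: "\<And>p x. (p, x) \<in> nondeg \<Longrightarrow> e p x \<in> carrier B" and px: "(p, x) \<in> nondeg"
  shows "ev p x (build e) = e p x"
proof -
  have "ev p x (build e) = finsum B (\<lambda>(r, y). ev p x (pt (delta r y) (e r y))) nondeg"
    unfolding build_def using e
    by (subst ev_finsum[OF fin]) (auto simp: pt_delta_closed case_prod_unfold)
  also have "\<dots> = finsum B (\<lambda>i. if (p, x) = i then (\<lambda>(r, y). e r y) i else \<zero>\<^bsub>B\<^esub>) nondeg"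
  proof (rule B.finsum_cong')
    fix i assume i: "i \<in> nondeg"
    obtain r y where ry: "i = (r, y)" by (cases i)
    show "(case i of (r, y) \<Rightarrow> ev p x (pt (delta r y) (e r y))) = (if (p, x) = i then (\<lambda>(r, y). e r y) i else \<zero>\<^bsub>B\<^esub>)"
      using e i unfolding ry by (simp add: ev_pure delta_cochain) (auto simp: delta_def B.int_pow_zero B.add.int_pow_1)
  qed (use e in auto)
  also have "\<dots> = e p x"
    using e by (subst B.add.finprod_singleton[OF px fin]) auto
  finally show ?thesis .
qed

lemma build_ev:
  assumes "s \<in> carrier N"
  shows "s = build (\<lambda>p x. ev p x s)"
  using assms
proof (induction s rule: N.tensor_induct)
  case (pure i j \<phi> b)
  have \<phi>: "\<phi> \<in> cochains X" using pure(1) by (simp add: grade_C_iff)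
  have b: "b \<in> carrier B" using pure(2) by (rule B.grade_carrier)
  have r: "(\<lambda>p x. if (p, x) \<in> S then \<phi> p x else 0) \<in> cochains X" for S
  proof -
    obtain M where "\<And>p x. p > M \<Longrightarrow> \<phi> p x = 0" using \<phi> cochain_bound by metis
    then show ?thesis using \<phi> by (intro cochainsI[of _ M]) (simp_all add: cochainsD)
  qed
  \<comment> \<open>The cochain is enlarged one simplex at a time, each step adding the multiple
    \<open>\<phi> p x\<close> of the dual cochain of that simplex.\<close>
  have "finite S \<Longrightarrow> S \<subseteq> nondeg \<Longrightarrow>
    pt (\<lambda>p x. if (p, x) \<in> S then \<phi> p x else 0) b = finsum N (\<lambda>(p, x). pt (delta p x) (ev p x (pt \<phi> b))) S" for S
  proof (induction S rule: finite_induct)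
    case empty
    then show ?case using N.pt_zero_left[OF b] by (simp add: C_simps)
  next
    case (insert i S)
    obtain p x where px: "i = (p, x)" by (cases i)
    have d: "delta p x \<in> cochains X" using insert px by (intro delta_cochain) auto
    let ?f = "\<lambda>(p, x). pt (delta p x) (ev p x (pt \<phi> b))"
    have e: "ev r y (pt \<phi> b) \<in> carrier B" for r y
      using \<phi> b by (intro ev_closed N.pt_closed) (simp_all add: C_simps(1))
    have "(\<lambda>r y. if (r, y) \<in> insert i S then \<phi> r y else 0) =
      (\<lambda>r y. \<phi> p x * delta p x r y) \<oplus>\<^bsub>C\<^esub> (\<lambda>p x. if (p, x) \<in> S then \<phi> p x else 0)"
      using insert(2) px by (auto simp: C_simps delta_def fun_eq_iff)
    then have "pt (\<lambda>r y. if (r, y) \<in> insert i S then \<phi> r y else 0) b =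
      pt (\<lambda>r y. \<phi> p x * delta p x r y) b \<oplus>\<^bsub>N\<^esub> finsum N ?f S"
      using insert b r[of S] cochain_scale[OF d] by (simp add: N.pt_add_left C_simps(1))
    also have "pt (\<lambda>r y. \<phi> p x * delta p x r y) b = ?f i"
      using d b \<phi> by (simp add: pt_scale ev_pure px)
    also have "?f i \<oplus>\<^bsub>N\<^esub> finsum N ?f S = finsum N ?f (insert i S)"
      using insert e by (intro N.T.finsum_insert[symmetric]) (auto simp: px pt_delta_closed)
    finally show ?case .
  qed
  from this[OF fin subset_refl]
  have "pt (\<lambda>p x. if (p, x) \<in> nondeg then \<phi> p x else 0) b = build (\<lambda>p x. ev p x (pt \<phi> b))"
    by (simp add: build_def)
  moreover have "(\<lambda>p x. if (p, x) \<in> nondeg then \<phi> p x else 0) = \<phi>"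
    using cochainsD[OF \<phi>] by (auto simp: nondeg_def fun_eq_iff)
  ultimately show ?case by simp
next
  case (add s t)
  have "build (\<lambda>p x. ev p x (s \<oplus>\<^bsub>N\<^esub> t)) =
    finsum N (\<lambda>i. (\<lambda>(p, x). pt (delta p x) (ev p x s)) i \<oplus>\<^bsub>N\<^esub> (\<lambda>(p, x). pt (delta p x) (ev p x t)) i) nondeg"
    unfolding build_def using add(1,2)
    by (intro N.T.finsum_cong') (auto simp: ev_add N.pt_add_right delta_cochain C_simps(1) ev_closed pt_delta_closed)
  also have "\<dots> = build (\<lambda>p x. ev p x s) \<oplus>\<^bsub>N\<^esub> build (\<lambda>p x. ev p x t)"
    unfolding build_def using add(1,2) by (intro N.T.finsum_addf) (auto simp: ev_closed pt_delta_closed)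
  finally show ?case using add(3,4) by simp
qed

lemma support_expansion:
  assumes s: "s \<in> carrier N" and K: "K \<subseteq> nondeg"
    and z: "\<And>p x. (p, x) \<in> nondeg \<Longrightarrow> (p, x) \<notin> K \<Longrightarrow> ev p x s = \<zero>\<^bsub>B\<^esub>"
  shows "s = finsum N (\<lambda>(p, x). pt (delta p x) (ev p x s)) K"
proof -
  have "finsum N (\<lambda>(p, x). pt (delta p x) (ev p x s)) K = build (\<lambda>p x. ev p x s)"
    unfolding build_def using s K z fin
    by (intro N.T.add.finprod_mono_neutral_cong_left)
      (auto simp: pt_delta_closed ev_closed N.pt_zero_right delta_cochain C_simps(1))
  then show ?thesis using build_ev[OF s] by simp
qed

text \<open>Equality of tensors is tested on values; through this criterion later arguments about
  cylinders avoid representatives in the free abelian group.\<close>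

lemma ev_eqI:
  assumes "s \<in> carrier N" "t \<in> carrier N" "\<And>p x. (p, x) \<in> nondeg \<Longrightarrow> ev p x s = ev p x t"
  shows "s = t"
proof -
  have "build (\<lambda>p x. ev p x s) = build (\<lambda>p x. ev p x t)"
    unfolding build_def using assms
    by (intro N.T.finsum_cong') (auto simp: pt_delta_closed ev_closed)
  then show ?thesis using build_ev assms(1,2) by simp
qed

end

end

section \<open>Cylinders\<close>

abbreviation coface :: "nat \<Rightarrow> nat \<Rightarrow> nat"
  where "coface i \<equiv> (\<lambda>k. if k < i then k else k + 1)"

lemma monomap_coface: "1 \<le> n \<Longrightarrow> i \<le> n \<Longrightarrow> monomap (n - 1) n (coface i)"
  by (auto simp: monomap_def)

lemma std_simplicesD:
  assumes "x \<in> simplices (std_simplex q) p"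
  shows "\<And>k. k \<le> p \<Longrightarrow> x k \<le> q" "\<And>j k. j \<le> k \<Longrightarrow> k \<le> p \<Longrightarrow> x j \<le> x k" "x \<in> extensional {0..p}"
  using assms by (auto simp: std_simplex_def mono_on_def PiE_iff)

lemma std_simplicesI:
  assumes "\<And>k. k \<le> p \<Longrightarrow> x k \<le> q" "\<And>j k. j \<le> k \<Longrightarrow> k \<le> p \<Longrightarrow> x j \<le> x k" "x \<in> extensional {0..p}"
  shows "x \<in> simplices (std_simplex q) p"
  using assms by (auto simp: std_simplex_def mono_on_def PiE_iff)

lemma std_act: "act (std_simplex q) m n \<theta> x = (\<lambda>k\<in>{0..m}. x (\<theta> k))"
  by (simp add: std_simplex_def compose_def)

lemma std_map: "std_simplex_map \<theta> p x = (\<lambda>k\<in>{0..p}. \<theta> (x k))"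
  by (simp add: std_simplex_map_def compose_def)

lemma std_nondegenerate_less:
  assumes x: "x \<in> simplices (std_simplex q) p" "x \<notin> degenerate (std_simplex q) p" and ij: "i < j" "j \<le> p"
  shows "x i < x j"
proof -
  note D = std_simplicesD[OF x(1)]
  have "x i \<noteq> x (Suc i)" if i: "i < p" for i
  proof
    assume eq: "x i = x (Suc i)"
    \<comment> \<open>If two consecutive vertices coincide, then x = s_i d_(i+1) x, which exhibits
      \<open>x\<close> as degenerate.\<close>
    have "x = degen (std_simplex q) (p - 1) i (face (std_simplex q) p (i + 1) x)"
    proof
      fix k show "x k = degen (std_simplex q) (p - 1) i (face (std_simplex q) p (i + 1) x) k"
      proof (cases "k \<le> p")
        case True
        have "k = i + 1 \<or> k \<le> i \<or> (i + 1 < k \<and> k - 1 + 1 = k \<and> \<not> k - 1 < i + 1)" by auto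
        then show ?thesis using i True eq
          by (auto simp: degen_def face_def std_act)
      next
        case False
        then show ?thesis using i D(3) by (simp add: degen_def face_def std_act extensional_def)
      qed
    qed
    then have "x \<in> degenerate (std_simplex q) p"
      using i std.face_closed[of p "i + 1" x q] x(1)
      by (intro std.degenerateI[of i "p - 1" "face (std_simplex q) p (i + 1) x"]) auto
    then show False using x(2) by blast
  qed
  then have step: "x i < x (Suc i)" if "i < p" for i
    using D(2)[of i "Suc i"] that by (simp add: le_neq_implies_less)
  show ?thesis using ij
  proof (induction j)
    case (Suc j)
    then show ?case using step[of j] by (cases "i = j") auto
  qed simp
qed

lemma std_nondegenerateI:
  assumes "\<And>i j. i < j \<Longrightarrow> j \<le> p \<Longrightarrow> x i < x j"
  shows "x \<notin> degenerate (std_simplex q) p"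
proof
  assume "x \<in> degenerate (std_simplex q) p"
  then obtain m i y where d: "p = m + 1" "i \<le> m" "x = degen (std_simplex q) m i y"
    by (rule std.degenerateE)
  then have "x i = x (i + 1)" by (simp add: degen_def std_act)
  then show False using assms[of i "i + 1"] d by simp
qed

text \<open>A nondegenerate simplex is strictly increasing, hence the sorted enumeration of its
  vertex set. Simplices can therefore be classified by the vertices they contain.\<close>

lemma std_nondegenerate_unique:
  assumes x: "x \<in> simplices (std_simplex q) p" "x \<notin> degenerate (std_simplex q) p"
    and y: "y \<in> simplices (std_simplex q) r" "y \<notin> degenerate (std_simplex q) r"
    and im: "x ` {0..p} = y ` {0..r}"
  shows "p = r \<and> x = y"
proof -
  have srt: "sorted (map x [0..<Suc p]) \<and> distinct (map x [0..<Suc p])"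
    if "x \<in> simplices (std_simplex q) p" "x \<notin> degenerate (std_simplex q) p" for x p
  proof
    show "sorted (map x [0..<Suc p])"
      unfolding sorted_iff_nth_mono using std_simplicesD(2)[OF that(1)] by (simp del: upt_Suc)
    show "distinct (map x [0..<Suc p])"
    proof -
      have "inj_on x {0..p}"
        using std_nondegenerate_less[OF that] by (intro linorder_inj_onI') force
      then show ?thesis by (simp add: distinct_map atLeast0AtMost lessThan_Suc_atMost[symmetric] atLeast0LessThan del: upt_Suc)
    qed
  qed
  have "{0..<Suc m} = {0..m}" for m by auto
  then have "set (map x [0..<Suc p]) = set (map y [0..<Suc r])"
    using im by (simp del: upt_Suc)
  then have e: "map x [0..<Suc p] = map y [0..<Suc r]"
    using srt[OF x] srt[OF y] by (intro sorted_distinct_set_unique) auto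
  then have pr: "p = r" using map_eq_imp_length_eq[OF e] by simp
  have "x k = y k" for k
  proof (cases "k \<le> p")
    case True
    then show ?thesis using e pr by (simp add: map_eq_conv del: upt_Suc)
  next
    case False
    then show ?thesis using std_simplicesD(3)[OF x(1)] std_simplicesD(3)[OF y(1)] pr by (simp add: extensional_def)
  qed
  then show ?thesis using pr by auto
qed

abbreviation top_simplex :: "nat \<Rightarrow> nat \<Rightarrow> nat"
  where "top_simplex q \<equiv> (\<lambda>k\<in>{0..q}. k)"

text \<open>Left inverse of the coface map on simplices that miss the vertex \<open>i\<close>.\<close>

definition drop_vertex :: "nat \<Rightarrow> nat \<Rightarrow> (nat \<Rightarrow> nat) \<Rightarrow> nat \<Rightarrow> nat"
  where "drop_vertex i p x = (\<lambda>k\<in>{0..p}. if x k < i then x k else x k - 1)"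

lemma drop_vertex_closed:
  assumes "x \<in> simplices (std_simplex n) p" "i \<le> n" "1 \<le> n" "i \<notin> x ` {0..p}"
  shows "drop_vertex i p x \<in> simplices (std_simplex (n - 1)) p"
proof (rule std_simplicesI)
  note D = std_simplicesD[OF assms(1)]
  fix k assume k: "k \<le> p"
  have "x k \<noteq> i" using assms(4) k by auto
  then show "drop_vertex i p x k \<le> n - 1"
    using D(1)[OF k] assms(2,3) k by (auto simp: drop_vertex_def)
next
  note D = std_simplicesD[OF assms(1)]
  fix j k assume jk: "j \<le> k" "k \<le> p"
  have "x k \<noteq> i" "x j \<noteq> i" using assms(4) jk by auto
  then show "drop_vertex i p x j \<le> drop_vertex i p x k"
    using D(2)[OF jk] jk by (auto simp: drop_vertex_def)
qed (simp add: drop_vertex_def)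

lemma coface_drop_vertex:
  assumes "x \<in> simplices (std_simplex n) p" "i \<notin> x ` {0..p}"
  shows "std_simplex_map (coface i) p (drop_vertex i p x) = x"
proof
  fix k
  have "k \<le> p \<Longrightarrow> x k \<noteq> i" using assms(2) by auto
  then show "std_simplex_map (coface i) p (drop_vertex i p x) k = x k"
    using std_simplicesD(3)[OF assms(1)]
    by (cases "k \<le> p") (auto simp: std_map drop_vertex_def extensional_def)
qed

lemma drop_vertex_coface:
  assumes "y \<in> simplices (std_simplex n) p"
  shows "drop_vertex i p (std_simplex_map (coface i) p y) = y"
  using std_simplicesD(3)[OF assms]
  by (auto simp: std_map drop_vertex_def extensional_def fun_eq_iff)

lemma coface_misses: "i \<notin> std_simplex_map (coface i) p y ` {0..p}"
  by (auto simp: std_map)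

locale cylinders = B: dg_ring B for B :: "'b dg_ring"

sublocale cylinders \<subseteq> cyl: cochain_tensor "std_simplex q" B for q
  by (intro cochain_tensor.intro simplicial_set_std_simplex B.dg_ring_axioms)

lemma Cyl_tensor: "Cyl q B = tensor (cochain_ring (std_simplex q)) B"
  by (simp add: Cyl_def N_ring_def)

context cylinders
begin

lemma finite_nondeg: "finite (cyl.nondeg q)"
proof (rule finite_imageD)
  show "finite ((\<lambda>(p, x). x ` {0..p}) ` cyl.nondeg q)"
  proof (rule finite_subset)
    show "(\<lambda>(p, x). x ` {0..p}) ` cyl.nondeg q \<subseteq> Pow {0..q}"
      using std_simplicesD(1) by (fastforce simp: cyl.nondeg_def)
  qed simp
  show "inj_on (\<lambda>(p, x). x ` {0..p}) (cyl.nondeg q)"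
  proof (rule inj_onI)
    fix i j assume *: "i \<in> cyl.nondeg q" "j \<in> cyl.nondeg q"
      "(case i of (p, x) \<Rightarrow> x ` {0..p}) = (case j of (p, x) \<Rightarrow> x ` {0..p})"
    obtain p x r y where "i = (p, x)" "j = (r, y)" by (cases i, cases j)
    then show "i = j" using std_nondegenerate_unique[of x q p y r] * by (simp add: cyl.nondeg_def)
  qed
qed

lemma dg_ring_Cyl: "dg_ring (Cyl q B)"
  unfolding Cyl_tensor by (rule cyl.N.dg_ring_T)

lemma dg_map_Cyl_act:
  assumes "monomap m n \<theta>"
  shows "dg_map (Cyl n B) (Cyl m B) (Cyl_act B m \<theta>)"
  unfolding Cyl_tensor Cyl_act_def
  using assms by (intro dg_map_tensor_map cyl.N.dg_pair_axioms dg_map_std_simplex_map B.dg_map_id)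

text \<open>Under evaluation the simplicial action is the pullback of cochains along
  \<open>\<theta>\<close>. It is the source of all later computations of faces.\<close>

lemma ev_Cyl_act:
  assumes \<theta>: "monomap m n \<theta>" and s: "s \<in> carrier (Cyl n B)" and x: "x \<in> simplices (std_simplex m) p"
  shows "cyl.ev m p x (Cyl_act B m \<theta> s) = cyl.ev n p (std_simplex_map \<theta> p x) s"
  using s unfolding Cyl_tensor
proof (induction s rule: cyl.N.tensor_induct)
  case (pure i j \<phi> b)
  let ?h = "cochain_map (std_simplex m) (std_simplex_map \<theta>)"
  note h = dg_map_std_simplex_map[OF \<theta>]
  have \<phi>: "\<phi> \<in> carrier (cochain_ring (std_simplex n))" by (rule cyl.C.grade_carrier[OF pure(1)])
  have b: "b \<in> carrier B" by (rule B.grade_carrier[OF pure(2)])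
  have "Cyl_act B m \<theta> (cyl.pt n \<phi> b) = cyl.pt m (?h \<phi>) b"
    unfolding Cyl_act_def by (rule dg_map_tensor_map(2)[OF cyl.N.dg_pair_axioms cyl.N.dg_pair_axioms h B.dg_map_id \<phi> b])
  then show ?case using dg_mapD(3)[OF h \<phi>] \<phi> b x
    by (simp add: cyl.ev_pure cyl.C_simps(1) cochain_map_def)
next
  case (add s t)
  note act = dg_mapD[OF dg_map_Cyl_act[OF \<theta>], unfolded Cyl_tensor]
  show ?case using add by (simp add: act cyl.ev_add)
qed

lemma Cyl_eqI:
  assumes "s \<in> carrier (Cyl q B)" "t \<in> carrier (Cyl q B)"
    "\<And>p x. (p, x) \<in> cyl.nondeg q \<Longrightarrow> cyl.ev q p x s = cyl.ev q p x t"
  shows "s = t"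
  by (rule cyl.ev_eqI[OF finite_nondeg]) (use assms in \<open>simp_all add: Cyl_tensor\<close>)

lemma nondeg_simplices: "(p, x) \<in> cyl.nondeg q \<Longrightarrow> x \<in> simplices (std_simplex q) p"
  by (simp add: cyl.nondeg_def)

lemma Cyl_act_act:
  assumes \<theta>: "monomap m n \<theta>" and \<eta>: "monomap l m \<eta>" and s: "s \<in> carrier (Cyl n B)"
  shows "Cyl_act B l \<eta> (Cyl_act B m \<theta> s) = Cyl_act B l (\<lambda>k. \<theta> (\<eta> k)) s"
proof (rule Cyl_eqI)
  have \<theta>\<eta>: "monomap l n (\<lambda>k. \<theta> (\<eta> k))" using \<theta> \<eta> by (simp add: monomap_def)
  note a = dg_mapD(3)[OF dg_map_Cyl_act[OF \<theta>] s]
  show "Cyl_act B l \<eta> (Cyl_act B m \<theta> s) \<in> carrier (Cyl l B)"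
    by (rule dg_mapD(3)[OF dg_map_Cyl_act[OF \<eta>] a])
  show "Cyl_act B l (\<lambda>k. \<theta> (\<eta> k)) s \<in> carrier (Cyl l B)"
    by (rule dg_mapD(3)[OF dg_map_Cyl_act[OF \<theta>\<eta>] s])
  fix p x assume "(p, x) \<in> cyl.nondeg l"
  then have x: "x \<in> simplices (std_simplex l) p" by (rule nondeg_simplices)
  have "std_simplex_map \<theta> p (std_simplex_map \<eta> p x) = std_simplex_map (\<lambda>k. \<theta> (\<eta> k)) p x"
    by (auto simp: std_map)
  then show "cyl.ev l p x (Cyl_act B l \<eta> (Cyl_act B m \<theta> s)) = cyl.ev l p x (Cyl_act B l (\<lambda>k. \<theta> (\<eta> k)) s)"
    using x by (simp add: ev_Cyl_act[OF \<eta> a] ev_Cyl_act[OF \<theta> s] ev_Cyl_act[OF \<theta>\<eta> s] std_simplex_map_closed[OF \<eta>])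
qed

lemma Cyl_act_id:
  assumes s: "s \<in> carrier (Cyl n B)"
  shows "Cyl_act B n (\<lambda>k. k) s = s"
proof (rule Cyl_eqI)
  have i: "monomap n n (\<lambda>k. k)" by (simp add: monomap_def)
  show "Cyl_act B n (\<lambda>k. k) s \<in> carrier (Cyl n B)"
    by (rule dg_mapD(3)[OF dg_map_Cyl_act[OF i] s])
  fix p x assume "(p, x) \<in> cyl.nondeg n"
  then have x: "x \<in> simplices (std_simplex n) p" by (rule nondeg_simplices)
  have "std_simplex_map (\<lambda>k. k) p x = x"
    using std_simplicesD(3)[OF x] by (auto simp: std_map extensional_def)
  then show "cyl.ev n p x (Cyl_act B n (\<lambda>k. k) s) = cyl.ev n p x s"
    using ev_Cyl_act[OF i s x] by simp
qed (rule s)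

lemma Cyl_act_cong:
  assumes "\<And>k. k \<le> m \<Longrightarrow> \<theta> k = \<theta>' k"
  shows "Cyl_act B m \<theta> = Cyl_act B m \<theta>'"
proof -
  have "cochain_map (std_simplex m) (std_simplex_map \<theta>) = cochain_map (std_simplex m) (std_simplex_map \<theta>')"
  proof (intro ext)
    fix \<phi> p x
    have "std_simplex_map \<theta> p x = std_simplex_map \<theta>' p x" if "x \<in> simplices (std_simplex m) p"
      using std_simplicesD(1)[OF that] assms by (auto simp: std_map)
    then show "cochain_map (std_simplex m) (std_simplex_map \<theta>) \<phi> p x = cochain_map (std_simplex m) (std_simplex_map \<theta>') \<phi> p x"
      by (simp add: cochain_map_def)
  qed
  then show ?thesis by (simp add: Cyl_act_def)
qed

lemma SHom_simps:
  "simplices (SHom A B) q = dg_hom A (Cyl q B)"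
  "act (SHom A B) m n \<theta> g = compose (carrier A) (Cyl_act B m \<theta>) g"
  by (simp_all add: SHom_def)

lemma simplicial_set_SHom:
  assumes "dg_ring A"
  shows "simplicial_set (SHom A B)"
proof
  fix m n \<theta> g assume "monomap m n \<theta>" "g \<in> simplices (SHom A B) n"
  then show "act (SHom A B) m n \<theta> g \<in> simplices (SHom A B) m"
    using dg_ring.dg_hom_compose[OF assms _ dg_map_Cyl_act] by (simp add: SHom_simps)
next
  fix m n \<theta> l \<eta> g assume *: "monomap m n \<theta>" "monomap l m \<eta>" "g \<in> simplices (SHom A B) n"
  show "act (SHom A B) l m \<eta> (act (SHom A B) m n \<theta> g) = act (SHom A B) l n (\<lambda>k. \<theta> (\<eta> k)) g"
    unfolding SHom_simps compose_def using *
    by (intro restrict_ext) (simp add: Cyl_act_act SHom_simps dg_hom_iff dg_mapD(3)[of A "Cyl n B" g])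
next
  fix m n :: nat and \<theta> \<theta>' :: "nat \<Rightarrow> nat" and g assume "\<And>k. k \<le> m \<Longrightarrow> \<theta> k = \<theta>' k"
  then have "Cyl_act B m \<theta> = Cyl_act B m \<theta>'" by (rule Cyl_act_cong)
  then show "act (SHom A B) m n \<theta> g = act (SHom A B) m n \<theta>' g"
    by (simp only: SHom_simps)
next
  fix n g assume "g \<in> simplices (SHom A B) n"
  then have g: "g \<in> dg_hom A (Cyl n B)" by (simp add: SHom_simps)
  show "act (SHom A B) n n (\<lambda>k. k) g = g"
    unfolding SHom_simps compose_def
  proof (rule extensionalityI[of _ "carrier A"])
    show "g \<in> extensional (carrier A)" using g by (simp add: dg_hom_iff)
    fix a assume "a \<in> carrier A"
    then show "(\<lambda>a\<in>carrier A. Cyl_act B n (\<lambda>k. k) (g a)) a = g a"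
      using g by (simp add: Cyl_act_id dg_hom_iff dg_mapD(3)[of A "Cyl n B" g])
  qed simp
qed

text \<open>A simplex lying in the faces \<open>i\<close> and \<open>j\<close> misses both vertices,
  so it comes from a simplex \<open>z\<close> of the common face of codimension 2, where the
  hypothesis \<open>comp\<close> equates the two values.\<close>

lemma face_compatible:
  assumes n: "1 \<le> n" and ij: "i < j" "j \<le> n"
    and s: "s \<in> carrier (Cyl (n - 1) B)" and t: "t \<in> carrier (Cyl (n - 1) B)"
    and comp: "2 \<le> n \<Longrightarrow> Cyl_act B (n - 2) (coface (j - 1)) s = Cyl_act B (n - 2) (coface i) t"
    and y: "y \<in> simplices (std_simplex (n - 1)) p" and y': "y' \<in> simplices (std_simplex (n - 1)) p"
    and eq: "std_simplex_map (coface i) p y = std_simplex_map (coface j) p y'"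
  shows "cyl.ev (n - 1) p y s = cyl.ev (n - 1) p y' t"
proof (cases "n = 1")
  \<comment> \<open>The two faces of the 1-simplex are different points, so they share no simplex
    and the equation \<open>eq\<close> is contradictory.\<close>
  case True
  have "std_simplex_map (coface i) p y 0 = std_simplex_map (coface j) p y' 0" using eq by simp
  then show ?thesis using True ij std_simplicesD(1)[OF y, of 0] std_simplicesD(1)[OF y', of 0]
    by (simp add: std_map)
next
  case False
  then have n2: "2 \<le> n" using n by simp
  have eqk: "coface i (y k) = coface j (y' k)" if "k \<le> p" for k
    using fun_cong[OF eq, of k] that by (simp add: std_map)
  define z where "z = drop_vertex i p y'"
  have miss: "i \<notin> y' ` {0..p}"
  proof
    assume "i \<in> y' ` {0..p}"
    then obtain k where "k \<le> p" "y' k = i" by auto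
    then show False using eqk[of k] ij by (auto split: if_splits)
  qed
  have z: "z \<in> simplices (std_simplex (n - 2)) p"
    using drop_vertex_closed[OF y' _ _ miss] ij n2 by (simp add: z_def numeral_2_eq_2)
  have zy': "std_simplex_map (coface i) p z = y'"
    unfolding z_def by (rule coface_drop_vertex[OF y' miss])
  have zy: "std_simplex_map (coface (j - 1)) p z = y"
  proof
    fix k show "std_simplex_map (coface (j - 1)) p z k = y k"
    proof (cases "k \<le> p")
      case True
      then have "y' k = coface i (z k)" using fun_cong[OF zy', of k] by (simp add: std_map)
      then show ?thesis using eqk[OF True] True ij by (auto simp: std_map split: if_splits)
    next
      case False
      then show ?thesis using std_simplicesD(3)[OF y] by (simp add: std_map extensional_def)
    qed
  qed
  have m: "monomap (n - 2) (n - 1) (coface (j - 1))" "monomap (n - 2) (n - 1) (coface i)"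
    using ij n2 by (auto simp: monomap_def)
  have "cyl.ev (n - 1) p y s = cyl.ev (n - 2) p z (Cyl_act B (n - 2) (coface (j - 1)) s)"
    using ev_Cyl_act[OF m(1) s z] zy by simp
  also have "\<dots> = cyl.ev (n - 1) p y' t"
    using ev_Cyl_act[OF m(2) t z] zy' comp[OF n2] by simp
  finally show ?thesis .
qed

text \<open>A nondegenerate simplex missing a vertex \<open>i\<close> in \<open>J\<close> lies in
  the face \<open>i\<close>, where its value is prescribed; compatibility makes the choice of
  \<open>i\<close> immaterial. Simplices containing all of \<open>J\<close> are free and receive the
  value \<open>e\<close>. With \<open>J\<close> all vertices this extends from the boundary, with
  three vertices of the 3-simplex from a horn.\<close>

lemma cochain_filler:
  assumes n: "1 \<le> n" and J: "J \<subseteq> {..n}"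
    and s: "\<And>i. i \<in> J \<Longrightarrow> s i \<in> grade (Cyl (n - 1) B) m"
    and comp: "\<And>i j. i \<in> J \<Longrightarrow> j \<in> J \<Longrightarrow> i < j \<Longrightarrow> 2 \<le> n \<Longrightarrow>
      Cyl_act B (n - 2) (coface (j - 1)) (s i) = Cyl_act B (n - 2) (coface i) (s j)"
    and e: "\<And>p x. (p, x) \<in> cyl.nondeg n \<Longrightarrow> e p x \<in> grade B (m - int p)"
  shows "\<exists>c\<in>grade (Cyl n B) m. (\<forall>i\<in>J. Cyl_act B (n - 1) (coface i) c = s i) \<and>
    (\<forall>p x. (p, x) \<in> cyl.nondeg n \<longrightarrow> J \<subseteq> x ` {0..p} \<longrightarrow> cyl.ev n p x c = e p x)"
proof -
  have sc: "s i \<in> carrier (Cyl (n - 1) B)" if "i \<in> J" for i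
    using s[OF that] cyl.N.T.grade_carrier unfolding Cyl_tensor by blast
  have compat: "cyl.ev (n - 1) p y (s i) = cyl.ev (n - 1) p y' (s j)"
    if "i \<in> J" "j \<in> J" "y \<in> simplices (std_simplex (n - 1)) p" "y' \<in> simplices (std_simplex (n - 1)) p"
      "std_simplex_map (coface i) p y = std_simplex_map (coface j) p y'" for i j p y y'
  proof (cases i j rule: linorder_cases)
    case less
    have "j \<le> n" using that J by auto
    from face_compatible[OF n less this sc[OF that(1)] sc[OF that(2)] comp[OF that(1,2) less] that(3,4,5)]
    show ?thesis .
  next
    case equal
    have "drop_vertex i p (std_simplex_map (coface i) p y) = drop_vertex i p (std_simplex_map (coface i) p y')"
      using that(5) unfolding equal by (rule arg_cong)
    then have "y = y'" unfolding drop_vertex_coface[OF that(3)] drop_vertex_coface[OF that(4)] .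
    then show ?thesis using equal by simp
  next
    case greater
    have "i \<le> n" using that J by auto
    from face_compatible[OF n greater this sc[OF that(2)] sc[OF that(1)] comp[OF that(2,1) greater] that(4,3) that(5)[symmetric]]
    show ?thesis ..
  qed
  define pick where "pick p x = (SOME i. i \<in> J \<and> i \<notin> x ` {0..p})" for p :: nat and x :: "nat \<Rightarrow> nat"
  have pick: "pick p x \<in> J \<and> pick p x \<notin> x ` {0..p}" if nJ: "\<not> J \<subseteq> x ` {0..p}" for p x
  proof -
    have "\<exists>i. i \<in> J \<and> i \<notin> x ` {0..p}" using nJ by blast
    then show ?thesis unfolding pick_def by (rule someI_ex)
  qed
  define w where "w p x = (if J \<subseteq> x ` {0..p} then e p x
    else cyl.ev (n - 1) p (drop_vertex (pick p x) p x) (s (pick p x)))" for p x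
  have w: "w p x \<in> grade B (m - int p)" if "(p, x) \<in> cyl.nondeg n" for p x
    using e[OF that] pick[of x p] s cyl.ev_grade by (auto simp: w_def Cyl_tensor)
  define c where "c = cyl.build n w"
  have c: "c \<in> grade (Cyl n B) m"
    unfolding c_def Cyl_tensor using w by (intro cyl.build_grade finite_nondeg)
  then have cc: "c \<in> carrier (Cyl n B)" using cyl.N.T.grade_carrier unfolding Cyl_tensor by blast
  have evc: "cyl.ev n p x c = w p x" if "(p, x) \<in> cyl.nondeg n" for p x
    unfolding c_def using that w by (intro cyl.ev_build finite_nondeg) (auto intro: B.grade_carrier)
  have "Cyl_act B (n - 1) (coface i) c = s i" if i: "i \<in> J" for i
  proof (rule Cyl_eqI)
    have m: "monomap (n - 1) n (coface i)" using i J n by (intro monomap_coface) auto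
    show "Cyl_act B (n - 1) (coface i) c \<in> carrier (Cyl (n - 1) B)"
      by (rule dg_mapD(3)[OF dg_map_Cyl_act[OF m] cc])
    show "s i \<in> carrier (Cyl (n - 1) B)" by (rule sc[OF i])
    fix p y assume py: "(p, y) \<in> cyl.nondeg (n - 1)"
    then have y: "y \<in> simplices (std_simplex (n - 1)) p" by (rule nondeg_simplices)
    define x where "x = std_simplex_map (coface i) p y"
    have x: "x \<in> simplices (std_simplex n) p" unfolding x_def by (rule std_simplex_map_closed[OF m y])
    have "y j < y k" if "j < k" "k \<le> p" for j k
      using std_nondegenerate_less[OF y _ that] py by (simp add: cyl.nondeg_def)
    then have "x \<notin> degenerate (std_simplex n) p"
      by (intro std_nondegenerateI) (force simp: x_def std_map)
    then have px: "(p, x) \<in> cyl.nondeg n" using x by (simp add: cyl.nondeg_def)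
    have nJ: "\<not> J \<subseteq> x ` {0..p}" using coface_misses i unfolding x_def by blast
    note pk = pick[OF nJ]
    have le: "pick p x \<le> n" using pk J by auto
    have eq: "std_simplex_map (coface (pick p x)) p (drop_vertex (pick p x) p x) = std_simplex_map (coface i) p y"
      using coface_drop_vertex[OF x conjunct2[OF pk]] unfolding x_def .
    have "cyl.ev (n - 1) p (drop_vertex (pick p x) p x) (s (pick p x)) = cyl.ev (n - 1) p y (s i)"
      by (rule compat[OF conjunct1[OF pk] i drop_vertex_closed[OF x le n conjunct2[OF pk]] y eq])
    then show "cyl.ev (n - 1) p y (Cyl_act B (n - 1) (coface i) c) = cyl.ev (n - 1) p y (s i)"
      using ev_Cyl_act[OF m cc y] evc[OF px] nJ by (simp add: x_def[symmetric] w_def)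
  qed
  moreover have "cyl.ev n p x c = e p x" if "(p, x) \<in> cyl.nondeg n" "J \<subseteq> x ` {0..p}" for p x
    using evc[OF that(1)] that(2) by (simp add: w_def)
  ultimately show ?thesis using c by blast
qed

end

section \<open>Lifting against boundary inclusions and filling horns\<close>

context cylinders
begin

lemma nondeg_less: "(p, x) \<in> cyl.nondeg q \<Longrightarrow> i < j \<Longrightarrow> j \<le> p \<Longrightarrow> x i < x j"
  using std_nondegenerate_less[of x q p i j] by (simp add: cyl.nondeg_def)

lemma nondegI:
  assumes "x \<in> simplices (std_simplex q) p" "\<And>i j. i < j \<Longrightarrow> j \<le> p \<Longrightarrow> x i < x j"
  shows "(p, x) \<in> cyl.nondeg q"
  using assms std_nondegenerateI[of p x q] by (simp add: cyl.nondeg_def)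

lemma nondeg_dim:
  assumes "(p, x) \<in> cyl.nondeg q" shows "p \<le> q"
proof -
  have "k \<le> p \<Longrightarrow> k \<le> x k" for k
  proof (induction k)
    case (Suc k)
    then show ?case using nondeg_less[OF assms, of k "Suc k"] by simp
  qed simp
  from this[of p] show ?thesis using std_simplicesD(1)[OF nondeg_simplices[OF assms], of p] by simp
qed

lemma nondeg_unique:
  assumes "(p, x) \<in> cyl.nondeg q" "(r, y) \<in> cyl.nondeg q" "x ` {0..p} = y ` {0..r}"
  shows "p = r \<and> x = y"
  using assms std_nondegenerate_unique[of x q p y r] by (simp add: cyl.nondeg_def)

lemma top_nondeg: "(n, top_simplex n) \<in> cyl.nondeg n"
  by (rule nondegI) (auto intro!: std_simplicesI)

lemma nondeg_image: "(p, x) \<in> cyl.nondeg q \<Longrightarrow> x ` {0..p} \<subseteq> {0..q}"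
  using std_simplicesD(1)[OF nondeg_simplices] by auto

lemma nondeg_full:
  assumes px: "(p, x) \<in> cyl.nondeg n" and full: "{..n} \<subseteq> x ` {0..p}"
  shows "p = n \<and> x = top_simplex n"
proof (rule nondeg_unique[OF px top_nondeg])
  have "x ` {0..p} = {0..n}" using full nondeg_image[OF px] by auto
  then show "x ` {0..p} = top_simplex n ` {0..n}" by simp
qed

lemma cochain_eqI:
  assumes "\<phi> \<in> cochains (std_simplex q)" "\<psi> \<in> cochains (std_simplex q)"
    "\<And>p x. (p, x) \<in> cyl.nondeg q \<Longrightarrow> \<phi> p x = \<psi> p x"
  shows "\<phi> = \<psi>"
proof (intro ext)
  fix p x
  show "\<phi> p x = \<psi> p x"
    using assms(3)[of p x] std.cochainsD(1,2)[OF assms(1), of x p] std.cochainsD(1,2)[OF assms(2), of x p]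
    by (cases "(p, x) \<in> cyl.nondeg q") (auto simp: cyl.nondeg_def)
qed

text \<open>There are no nondegenerate simplices of dimension \<open>n + 1\<close> in the
  \<open>n\<close>-simplex, so the differential of the top dual cochain has nowhere to live.\<close>

lemma dif_delta_top: "dif (cochain_ring (std_simplex n)) (cyl.delta n (top_simplex n)) = (\<lambda>p x. 0)"
proof (rule cochain_eqI)
  have d: "dif (cochain_ring (std_simplex n)) (cyl.delta n (top_simplex n)) \<in> grade (cochain_ring (std_simplex n)) (int n + 1)"
    by (rule cyl.C.dif_grade[OF cyl.delta_grade[OF top_nondeg]])
  then show "dif (cochain_ring (std_simplex n)) (cyl.delta n (top_simplex n)) \<in> cochains (std_simplex n)"
    by (simp add: std.grade_C_iff)
  fix p x assume "(p, x) \<in> cyl.nondeg n"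
  then show "dif (cochain_ring (std_simplex n)) (cyl.delta n (top_simplex n)) p x = 0"
    using nondeg_dim[of p x n] d by (simp add: std.grade_C_iff)
qed (rule std.cochain_zero)

lemma delta_carrier: "(p, x) \<in> cyl.nondeg q \<Longrightarrow> cyl.delta p x \<in> carrier (cochain_ring (std_simplex q))"
  by (simp add: cyl.delta_cochain std.C_simps(1))

lemma dif_pt_top:
  assumes b: "b \<in> carrier B"
  shows "dif (Cyl n B) (cyl.pt n (cyl.delta n (top_simplex n)) b) =
    [sign (int n)] \<cdot>\<^bsub>Cyl n B\<^esub> cyl.pt n (cyl.delta n (top_simplex n)) (dif B b)"
proof -
  have "cyl.pt n (\<lambda>p x. 0) b = \<zero>\<^bsub>tensor (cochain_ring (std_simplex n)) B\<^esub>"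
    using cyl.N.pt_zero_left[OF b, of n] by (simp add: std.C_simps(4))
  then show ?thesis
    unfolding Cyl_tensor cyl.N.dif_pure[OF cyl.delta_grade[OF top_nondeg] b] dif_delta_top
    using b by (simp add: cyl.N.T.sign_closed cyl.N.pt_closed delta_carrier top_nondeg B.dif_closed)
qed

end

text \<open>The form in which a surjective quasi-isomorphism \<open>v\<close> enters the lifting
  arguments: surjectivity in each degree and an acyclic kernel.\<close>

locale acyclic_fibration = S: cylinders B' + T: cylinders B
  for B' :: "'d dg_ring" and B :: "'b dg_ring" and v :: "'d \<Rightarrow> 'b" +
  assumes v: "dg_map B' B v"
    and v_surj: "b \<in> grade B i \<Longrightarrow> \<exists>b'\<in>grade B' i. v b' = b"
    and v_acyclic: "c \<in> grade B' i \<Longrightarrow> dif B' c = \<zero>\<^bsub>B'\<^esub> \<Longrightarrow> v c = \<zero>\<^bsub>B\<^esub> \<Longrightarrow>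
      \<exists>c'\<in>grade B' (i - 1). v c' = \<zero>\<^bsub>B\<^esub> \<and> dif B' c' = c"
begin

sublocale v: dg_hom_pair B' B v
  by (intro dg_hom_pair.intro dg_hom_pair_axioms.intro S.B.dg_ring_axioms T.B.dg_ring_axioms v)

lemma dg_map_Cyl_map: "dg_map (Cyl q B') (Cyl q B) (Cyl_map B v q)"
  unfolding Cyl_tensor Cyl_map_def
  by (intro dg_map_tensor_map S.cyl.N.dg_pair_axioms T.cyl.N.dg_pair_axioms S.cyl.C.dg_map_id v)

lemma Cyl_map_pure:
  assumes "\<phi> \<in> carrier (cochain_ring (std_simplex q))" "b \<in> carrier B'"
  shows "Cyl_map B v q (S.cyl.pt q \<phi> b) = T.cyl.pt q \<phi> (v b)"
  unfolding Cyl_map_def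
  by (rule dg_map_tensor_map(2)[OF S.cyl.N.dg_pair_axioms T.cyl.N.dg_pair_axioms S.cyl.C.dg_map_id v assms])

lemma ev_Cyl_map:
  assumes s: "s \<in> carrier (Cyl q B')"
  shows "T.cyl.ev q p x (Cyl_map B v q s) = v (S.cyl.ev q p x s)"
  using s unfolding Cyl_tensor
proof (induction s rule: S.cyl.N.tensor_induct)
  case (pure i j \<phi> b)
  have \<phi>: "\<phi> \<in> carrier (cochain_ring (std_simplex q))" by (rule S.cyl.C.grade_carrier[OF pure(1)])
  have b: "b \<in> carrier B'" by (rule S.B.grade_carrier[OF pure(2)])
  have "v ([\<phi> p x] \<cdot>\<^bsub>B'\<^esub> b) = [\<phi> p x] \<cdot>\<^bsub>B\<^esub> v b"
    using b by (intro S.B.additive_int_pow T.B.abelian_group_axioms) (simp_all add: v.hD)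
  then show ?case using \<phi> b
    by (simp add: Cyl_map_pure S.cyl.ev_pure T.cyl.ev_pure std.C_simps(1) v.hD)
next
  case (add s t)
  note m = dg_mapD[OF dg_map_Cyl_map[of q], unfolded Cyl_tensor]
  show ?case using add by (simp add: m T.cyl.ev_add S.cyl.ev_add S.cyl.ev_closed v.hD)
qed

lemma Cyl_map_act:
  assumes \<theta>: "monomap m n \<theta>" and s: "s \<in> carrier (Cyl n B')"
  shows "Cyl_map B v m (Cyl_act B' m \<theta> s) = Cyl_act B m \<theta> (Cyl_map B v n s)"
proof (rule T.Cyl_eqI)
  note a = dg_mapD(3)[OF S.dg_map_Cyl_act[OF \<theta>] s] and b = dg_mapD(3)[OF dg_map_Cyl_map s]
  show "Cyl_map B v m (Cyl_act B' m \<theta> s) \<in> carrier (Cyl m B)" by (rule dg_mapD(3)[OF dg_map_Cyl_map a])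
  show "Cyl_act B m \<theta> (Cyl_map B v n s) \<in> carrier (Cyl m B)" by (rule dg_mapD(3)[OF T.dg_map_Cyl_act[OF \<theta>] b])
  fix p x assume "(p, x) \<in> T.cyl.nondeg m"
  then have "x \<in> simplices (std_simplex m) p" by (rule T.nondeg_simplices)
  then show "T.cyl.ev m p x (Cyl_map B v m (Cyl_act B' m \<theta> s)) = T.cyl.ev m p x (Cyl_act B m \<theta> (Cyl_map B v n s))"
    using ev_Cyl_map[OF a] T.ev_Cyl_act[OF \<theta> b] S.ev_Cyl_act[OF \<theta> s] ev_Cyl_map[OF s] by simp
qed

theorem boundary_lifting:
  assumes A: "semi_free A" and n: "1 \<le> n"
    and g: "\<And>i. i \<le> n \<Longrightarrow> g i \<in> dg_hom A (Cyl (n - 1) B')" and h: "h \<in> dg_hom A (Cyl n B)"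
    and comp: "\<And>i j a. i < j \<Longrightarrow> j \<le> n \<Longrightarrow> 2 \<le> n \<Longrightarrow> a \<in> carrier A \<Longrightarrow>
      Cyl_act B' (n - 2) (coface (j - 1)) (g i a) = Cyl_act B' (n - 2) (coface i) (g j a)"
    and comp_v: "\<And>i a. i \<le> n \<Longrightarrow> a \<in> carrier A \<Longrightarrow>
      Cyl_map B v (n - 1) (g i a) = Cyl_act B (n - 1) (coface i) (h a)"
  shows "\<exists>k\<in>dg_hom A (Cyl n B'). \<forall>a\<in>carrier A.
    (\<forall>i\<in>{..n}. Cyl_act B' (n - 1) (coface i) (k a) = g i a) \<and> Cyl_map B v n (k a) = h a"
proof (rule semi_free_lifting[OF A])
  have dA: "dg_ring A" using A by (simp add: semi_free_def)
  then interpret A: dg_ring A .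
  interpret Cn: dg_ring "Cyl n B'" by (rule S.dg_ring_Cyl)
  have g': "dg_map A (Cyl (n - 1) B') (g i)" if "i \<le> n" for i using g[OF that] by (simp add: dg_hom_iff)
  have h': "dg_map A (Cyl n B) h" using h by (simp add: dg_hom_iff)
  have mono: "monomap (n - 1) n (coface i)" if "i \<le> n" for i using n that by (rule monomap_coface)
  interpret hh: dg_hom_pair A "Cyl n B" h
    by (intro dg_hom_pair.intro dg_hom_pair_axioms.intro dA T.dg_ring_Cyl h')
  have g0: "g i \<zero>\<^bsub>A\<^esub> = \<zero>\<^bsub>Cyl (n - 1) B'\<^esub>" if "i \<le> n" for i
    using that by (intro dg_hom_pair.h_zero dg_hom_pair.intro dg_hom_pair_axioms.intro dA S.dg_ring_Cyl g')
  let ?\<rho> = "\<lambda>a c. (\<forall>i\<in>{..n}. Cyl_act B' (n - 1) (coface i) c = g i a) \<and> Cyl_map B v n c = h a"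
  \<comment> \<open>Each condition, on a face or on the image under \<open>v\<close>, says that two
    homomorphisms agree, so the relation is an intersection of fibre products.\<close>
  have corr: "dg_correspondence A (Cyl n B') ?\<rho>"
    by (intro dg_correspondence_conj dg_correspondence_Ball dg_correspondence_eq[of _ _ "Cyl (n - 1) B'"]
        dg_correspondence_eq[of _ _ "Cyl n B"] dA S.dg_ring_Cyl T.dg_ring_Cyl dg_map_Cyl_map h')
      (simp_all only: atMost_iff g' S.dg_map_Cyl_act mono)
  let ?t = "top_simplex n"
  let ?d = "S.cyl.delta n ?t"
  show "acyclic_correspondence A (Cyl n B') ?\<rho>"
  proof (intro acyclic_correspondence.intro acyclic_correspondence_axioms.intro corr)
    fix a m assume a: "a \<in> grade A m"
    have ac: "a \<in> carrier A" by (rule A.grade_carrier[OF a])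
    have ha: "h a \<in> grade (Cyl n B) m" using dg_mapD(1)[OF h' a] .
    \<comment> \<open>A homogeneous preimage of the required value under \<open>v\<close>. The
      filler uses it only at simplices containing every vertex, that is, at the top simplex.\<close>
    define e where "e p x = (SOME b'. b' \<in> grade B' (m - int p) \<and> v b' = T.cyl.ev n p x (h a))" for p x
    have e: "e p x \<in> grade B' (m - int p) \<and> v (e p x) = T.cyl.ev n p x (h a)" for p x
    proof -
      have "\<exists>b'. b' \<in> grade B' (m - int p) \<and> v b' = T.cyl.ev n p x (h a)"
        using v_surj[OF T.cyl.ev_grade[OF ha[unfolded Cyl_tensor], of p x]] by blast
      then show ?thesis unfolding e_def by (rule someI_ex)
    qed
    have "\<exists>c\<in>grade (Cyl n B') m. (\<forall>i\<in>{..n}. Cyl_act B' (n - 1) (coface i) c = g i a) \<and>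
      (\<forall>p x. (p, x) \<in> S.cyl.nondeg n \<longrightarrow> {..n} \<subseteq> x ` {0..p} \<longrightarrow> S.cyl.ev n p x c = e p x)"
    proof (rule S.cochain_filler[OF n subset_refl])
      show "g i a \<in> grade (Cyl (n - 1) B') m" if "i \<in> {..n}" for i using dg_mapD(1)[OF g' a] that by simp
    qed (use comp ac e in auto)
    then obtain c where c: "c \<in> grade (Cyl n B') m" "\<And>i. i \<le> n \<Longrightarrow> Cyl_act B' (n - 1) (coface i) c = g i a"
      "\<And>p x. (p, x) \<in> S.cyl.nondeg n \<Longrightarrow> {..n} \<subseteq> x ` {0..p} \<Longrightarrow> S.cyl.ev n p x c = e p x"
      by auto
    note cc = Cn.grade_carrier[OF c(1)]
    have "Cyl_map B v n c = h a"
    proof (rule T.Cyl_eqI)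
      show "Cyl_map B v n c \<in> carrier (Cyl n B)" by (rule dg_mapD(3)[OF dg_map_Cyl_map cc])
      show hc: "h a \<in> carrier (Cyl n B)" by (rule dg_mapD(3)[OF h' ac])
      fix p x assume px: "(p, x) \<in> T.cyl.nondeg n"
      then have x: "x \<in> simplices (std_simplex n) p" by (rule T.nondeg_simplices)
      show "T.cyl.ev n p x (Cyl_map B v n c) = T.cyl.ev n p x (h a)"
      proof (cases "{..n} \<subseteq> x ` {0..p}")
        case True
        then show ?thesis using ev_Cyl_map[OF cc] c(3)[OF px] e by simp
      next
        case False
        then obtain i where i: "i \<le> n" "i \<notin> x ` {0..p}" by auto
        define y where "y = drop_vertex i p x"
        have y: "y \<in> simplices (std_simplex (n - 1)) p"
          unfolding y_def by (rule drop_vertex_closed[OF x i(1) n i(2)])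
        have yx: "std_simplex_map (coface i) p y = x" unfolding y_def by (rule coface_drop_vertex[OF x i(2)])
        have "T.cyl.ev n p x (Cyl_map B v n c) = v (S.cyl.ev (n - 1) p y (g i a))"
          using ev_Cyl_map[OF cc] S.ev_Cyl_act[OF mono[OF i(1)] cc y] yx c(2)[OF i(1)] by simp
        also have "\<dots> = T.cyl.ev (n - 1) p y (Cyl_act B (n - 1) (coface i) (h a))"
          using ev_Cyl_map[OF dg_mapD(3)[OF g'[OF i(1)] ac]] comp_v[OF i(1) ac] by simp
        also have "\<dots> = T.cyl.ev n p x (h a)"
          using T.ev_Cyl_act[OF mono[OF i(1)] hc y] yx by simp
        finally show ?thesis .
      qed
    qed
    then show "\<exists>c\<in>grade (Cyl n B') m. ?\<rho> a c" using c by auto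
  next
    fix c m assume c: "c \<in> grade (Cyl n B') m" "dif (Cyl n B') c = \<zero>\<^bsub>Cyl n B'\<^esub>" "?\<rho> \<zero>\<^bsub>A\<^esub> c"
    note cc = Cn.grade_carrier[OF c(1)]
    \<comment> \<open>A nondegenerate simplex other than the top one lies in some face, and the
      faces of \<open>c\<close> are the values of the \<open>g i\<close> at zero.\<close>
    have z: "S.cyl.ev n p x c = \<zero>\<^bsub>B'\<^esub>" if px: "(p, x) \<in> S.cyl.nondeg n" and ne: "(p, x) \<noteq> (n, ?t)" for p x
    proof -
      have x: "x \<in> simplices (std_simplex n) p" using px by (rule S.nondeg_simplices)
      have "\<not> {..n} \<subseteq> x ` {0..p}" using S.nondeg_full[OF px] ne by auto
      then obtain i where i: "i \<le> n" "i \<notin> x ` {0..p}" by auto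
      note y = drop_vertex_closed[OF x i(1) n i(2)]
      have "S.cyl.ev n p x c = S.cyl.ev (n - 1) p (drop_vertex i p x) (g i \<zero>\<^bsub>A\<^esub>)"
        using S.ev_Cyl_act[OF mono[OF i(1)] cc y] coface_drop_vertex[OF x i(2)] c(3) i(1) by simp
      then show ?thesis using S.cyl.ev_zero[of "n - 1"] by (simp add: g0[OF i(1)] Cyl_tensor)
    qed
    define b where "b = S.cyl.ev n n ?t c"
    have b: "b \<in> grade B' (m - int n)" unfolding b_def using S.cyl.ev_grade c(1) unfolding Cyl_tensor by blast
    note bc = S.B.grade_carrier[OF b]
    have cb: "c = S.cyl.pt n ?d b"
      using S.cyl.support_expansion[OF S.finite_nondeg, of c n "{(n, ?t)}"] cc z S.top_nondeg
      by (simp add: Cyl_tensor b_def S.cyl.pt_delta_closed S.cyl.ev_closed)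
    have ev_pt: "S.cyl.ev n n ?t (S.cyl.pt n ?d b) = b" if "b \<in> carrier B'" for b
      using that by (simp add: S.cyl.ev_pure S.cyl.delta_cochain S.top_nondeg) (simp add: S.cyl.delta_def S.B.add.int_pow_1)
    have db: "dif B' b = \<zero>\<^bsub>B'\<^esub>"
    proof -
      have "[sign (int n)] \<cdot>\<^bsub>Cyl n B'\<^esub> S.cyl.pt n ?d (dif B' b) = \<zero>\<^bsub>Cyl n B'\<^esub>"
        using c(2) S.dif_pt_top[OF bc, of n] unfolding cb by simp
      moreover have p: "S.cyl.pt n ?d (dif B' b) \<in> carrier (Cyl n B')"
        unfolding Cyl_tensor by (rule S.cyl.pt_delta_closed[OF S.top_nondeg S.B.dif_closed[OF bc]])
      ultimately have "S.cyl.pt n ?d (dif B' b) = \<zero>\<^bsub>Cyl n B'\<^esub>"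
        by (auto simp: Cn.sign_cases split: if_splits)
      then show ?thesis using ev_pt[OF S.B.dif_closed[OF bc]] S.cyl.ev_zero[of n n ?t] by (simp add: Cyl_tensor)
    qed
    have vb: "v b = \<zero>\<^bsub>B\<^esub>"
      unfolding b_def using ev_Cyl_map[OF cc, of n ?t] c(3) T.cyl.ev_zero[of n n ?t] hh.h_zero
      by (simp add: Cyl_tensor)
    obtain b' where b': "b' \<in> grade B' (m - int n - 1)" "v b' = \<zero>\<^bsub>B\<^esub>" "dif B' b' = b"
      using v_acyclic[OF b db vb] by blast
    note bc' = S.B.grade_carrier[OF b'(1)]
    \<comment> \<open>The sign compensates the one that the differential acquires in passing the top
      dual cochain, which has degree \<open>n\<close>.\<close>
    define c' where "c' = [sign (int n)] \<cdot>\<^bsub>Cyl n B'\<^esub> S.cyl.pt n ?d b'"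
    have ptg: "S.cyl.pt n ?d b' \<in> grade (Cyl n B') (m - 1)"
      using S.cyl.N.pt_grade[OF S.cyl.delta_grade[OF S.top_nondeg[of n]] b'(1)] by (simp add: Cyl_tensor algebra_simps)
    note ptc = Cn.grade_carrier[OF ptg]
    have c'g: "c' \<in> grade (Cyl n B') (m - 1)" unfolding c'_def by (rule Cn.int_pow_grade[OF ptg])
    have dc': "dif (Cyl n B') c' = c"
      unfolding c'_def Cn.sign_cases[OF ptc] cb
      using ptc S.dif_pt_top[OF bc', of n] Cn.sign_cases[of "S.cyl.pt n ?d b" "int n"] cc[unfolded cb] b'(3)
      by (simp add: Cn.dif_uminus)
    have evc': "S.cyl.ev n p x c' = \<zero>\<^bsub>B'\<^esub>" if "(p, x) \<noteq> (n, ?t)" for p x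
    proof -
      have "S.cyl.ev n p x c' = [sign (int n)] \<cdot>\<^bsub>B'\<^esub> S.cyl.ev n p x (S.cyl.pt n ?d b')"
        unfolding c'_def Cyl_tensor using ptc
        by (intro S.cyl.N.T.additive_int_pow S.B.abelian_group_axioms) (simp_all add: S.cyl.ev_closed S.cyl.ev_add Cyl_tensor)
      also have "S.cyl.ev n p x (S.cyl.pt n ?d b') = \<zero>\<^bsub>B'\<^esub>"
        using bc' that by (simp add: S.cyl.ev_pure S.cyl.delta_cochain S.top_nondeg) (auto simp: S.cyl.delta_def S.B.int_pow_zero)
      finally show ?thesis by (simp add: S.B.sign_cases)
    qed
    note cc' = Cn.grade_carrier[OF c'g]
    have "Cyl_act B' (n - 1) (coface i) c' = g i \<zero>\<^bsub>A\<^esub>" if i: "i \<le> n" for i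
      unfolding g0[OF i]
    proof (rule S.Cyl_eqI)
      show "Cyl_act B' (n - 1) (coface i) c' \<in> carrier (Cyl (n - 1) B')"
        by (rule dg_mapD(3)[OF S.dg_map_Cyl_act[OF mono[OF i]] cc'])
      show "\<zero>\<^bsub>Cyl (n - 1) B'\<^esub> \<in> carrier (Cyl (n - 1) B')" unfolding Cyl_tensor by simp
      fix p y assume "(p, y) \<in> S.cyl.nondeg (n - 1)"
      then have y: "y \<in> simplices (std_simplex (n - 1)) p" by (rule S.nondeg_simplices)
      have "(p, std_simplex_map (coface i) p y) \<noteq> (n, ?t)"
      proof
        assume "(p, std_simplex_map (coface i) p y) = (n, ?t)"
        then have "std_simplex_map (coface i) p y ` {0..p} = {0..n}" by auto
        then show False using coface_misses[of i p y] i by auto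
      qed
      then show "S.cyl.ev (n - 1) p y (Cyl_act B' (n - 1) (coface i) c') = S.cyl.ev (n - 1) p y \<zero>\<^bsub>Cyl (n - 1) B'\<^esub>"
        using S.ev_Cyl_act[OF mono[OF i] cc' y] evc' S.cyl.ev_zero[of "n - 1" p y] by (simp add: Cyl_tensor)
    qed
    moreover have "Cyl_map B v n c' = h \<zero>\<^bsub>A\<^esub>"
    proof -
      interpret m: dg_hom_pair "Cyl n B'" "Cyl n B" "Cyl_map B v n"
        by (intro dg_hom_pair.intro dg_hom_pair_axioms.intro S.dg_ring_Cyl T.dg_ring_Cyl dg_map_Cyl_map)
      have "Cyl_map B v n (S.cyl.pt n ?d b') = \<zero>\<^bsub>Cyl n B\<^esub>"
        using Cyl_map_pure[OF S.delta_carrier[OF S.top_nondeg] bc'] b'(2)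
          T.cyl.N.pt_zero_right[OF S.delta_carrier[OF S.top_nondeg]] by (simp add: Cyl_tensor)
      then show ?thesis unfolding c'_def Cn.sign_cases[OF ptc] using ptc
        by (simp add: m.h_uminus hh.h_zero)
    qed
    ultimately show "\<exists>c'\<in>grade (Cyl n B') (m - 1). ?\<rho> \<zero>\<^bsub>A\<^esub> c' \<and> dif (Cyl n B') c' = c"
      using c'g dc' by (intro bexI[of _ c']) auto
  qed
qed

end

section \<open>Filling inner horns of the 3-simplex\<close>

text \<open>The face of the 3-simplex opposite to the vertex 1, the one missing from the horn \<open>\<Lambda>\<^sup>3\<^sub>1\<close>.\<close>

definition inner_face :: "nat \<Rightarrow> nat"
  where "inner_face = (\<lambda>k\<in>{0..2}. if k = 0 then 0 else k + 1)"

text \<open>A simplex lies outside the horn exactly if it meets each of the vertices 0, 2, 3. This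
  leaves only the whole 3-simplex and the missing face.\<close>

lemma horn_vertices:
  fixes I :: "nat set"
  assumes "{0, 2, 3} \<subseteq> I" "I \<subseteq> {0..3}"
  shows "{..3} \<subseteq> I \<or> I = {0, 2, 3}"
proof -
  have e: "{..3::nat} = {0, 1, 2, 3}" "{0..3::nat} = {0, 1, 2, 3}"
    by (simp_all add: numeral_3_eq_3 numeral_2_eq_2 atMost_Suc atLeast0AtMost insert_commute)
  show ?thesis using assms unfolding e by (cases "1 \<in> I") auto
qed

context cylinders
begin

lemma nondeg_top_dim:
  assumes nx: "(n, x) \<in> cyl.nondeg n" shows "x = top_simplex n"
proof -
  have "inj_on x {0..n}"
    by (rule linorder_inj_onI') (use nondeg_less[OF nx] in force)
  then have "card (x ` {0..n}) = card {0..n}" by (rule card_image)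
  then have "x ` {0..n} = {0..n}" using nondeg_image[OF nx] by (intro card_subset_eq) simp_all
  then have "{..n} \<subseteq> x ` {0..n}" by (simp add: atLeast0AtMost)
  then show ?thesis using nondeg_full[OF nx] by simp
qed

lemma inner_face_eq: "inner_face = (\<lambda>k\<in>{0..2}. coface 1 k)"
  unfolding inner_face_def by (rule restrict_ext) simp

lemma inner_face_image: "inner_face ` {0..2} = {0, 2, 3}"
proof -
  have "{0..2::nat} = {0, 1, 2}" by auto
  then show ?thesis by (simp add: inner_face_def insert_commute eval_nat_numeral)
qed

lemma inner_face_nondeg: "(2, inner_face) \<in> cyl.nondeg 3"
  unfolding inner_face_def by (rule nondegI) (auto intro!: std_simplicesI)

lemma nondeg_horn:
  assumes px: "(p, x) \<in> cyl.nondeg 3" and im: "{0, 2, 3} \<subseteq> x ` {0..p}"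
  shows "(p, x) \<in> {(2, inner_face), (3, top_simplex 3)}"
  using horn_vertices[OF im nondeg_image[OF px]]
proof
  assume "{..3} \<subseteq> x ` {0..p}"
  from nondeg_full[OF px this] show ?thesis by simp
next
  assume "x ` {0..p} = {0, 2, 3}"
  then have "x ` {0..p} = inner_face ` {0..2}" unfolding inner_face_image .
  from nondeg_unique[OF px inner_face_nondeg this] show ?thesis by simp
qed

text \<open>Evaluated at the top simplex, only the face with index 1 contributes. The minus sign is
  that of the index.\<close>

lemma dif_delta_inner_face:
  "dif (cochain_ring (std_simplex 3)) (cyl.delta 2 inner_face) = (\<lambda>p x. - cyl.delta 3 (top_simplex 3) p x)"
proof (rule cochain_eqI)
  have d: "dif (cochain_ring (std_simplex 3)) (cyl.delta 2 inner_face) \<in> grade (cochain_ring (std_simplex 3)) 3"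
    using cyl.C.dif_grade[OF cyl.delta_grade[OF inner_face_nondeg]] by simp
  then show "dif (cochain_ring (std_simplex 3)) (cyl.delta 2 inner_face) \<in> cochains (std_simplex 3)"
    by (simp add: std.grade_C_iff)
  show "(\<lambda>p x. - cyl.delta 3 (top_simplex 3) p x) \<in> cochains (std_simplex 3)"
    by (rule std.cochain_uminus[OF cyl.delta_cochain[OF top_nondeg]])
  fix p x assume px: "(p, x) \<in> cyl.nondeg 3"
  show "dif (cochain_ring (std_simplex 3)) (cyl.delta 2 inner_face) p x = - cyl.delta 3 (top_simplex 3) p x"
  proof (cases "p = 3")
    case False
    then show ?thesis using d by (simp add: std.grade_C_iff cyl.delta_def)
  next
    case p: True
    then have x: "x = top_simplex 3" using nondeg_top_dim px by blast
    have f: "face (std_simplex 3) 3 i (top_simplex 3) = (\<lambda>k\<in>{0..2}. coface i k)" if "i \<le> 3" for i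
      using that by (auto simp: face_def std_act fun_eq_iff)
    have ne: "(\<lambda>k\<in>{0..2}. coface i k) \<noteq> inner_face" if "i \<in> {0, 2, 3}" for i
    proof
      assume "(\<lambda>k\<in>{0..2}. coface i k) = inner_face"
      then have "(\<lambda>k\<in>{0..2}. coface i k) k = inner_face k" for k by simp
      from this[of 0] this[of 1] show False using that by (auto simp: inner_face_def)
    qed
    have ts: "top_simplex 3 \<in> simplices (std_simplex 3) 3" by (rule nondeg_simplices[OF top_nondeg])
    have "dif (cochain_ring (std_simplex 3)) (cyl.delta 2 inner_face) 3 (top_simplex 3)
      = (\<Sum>i\<le>3. (- 1) ^ i * cyl.delta 2 inner_face 2 (face (std_simplex 3) 3 i (top_simplex 3)))"
      unfolding std.C_simps(7) using ts by (simp del: restrict_apply)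
    also have "\<dots> = (\<Sum>i\<le>(3::nat). if i = 1 then - 1 else 0)"
    proof (rule sum.cong)
      fix i :: nat assume "i \<in> {..3}"
      then have i: "i \<le> 3" by simp
      show "(- 1) ^ i * cyl.delta 2 inner_face 2 (face (std_simplex 3) 3 i (top_simplex 3)) = (if i = 1 then - 1 else 0)"
      proof (cases "i = 1")
        case True
        then show ?thesis unfolding f[OF i] by (simp only: inner_face_eq[symmetric] cyl.delta_def) simp
      next
        case False
        then have "i = 0 \<or> i = 2 \<or> i = 3" using i by linarith
        then have "(\<lambda>k\<in>{0..2}. coface i k) \<noteq> inner_face" by (intro ne) blast
        then show ?thesis unfolding f[OF i] using False by (simp add: cyl.delta_def)
      qed
    qed simp
    also have "\<dots> = - 1" by simp
    finally show ?thesis using p x by (simp add: cyl.delta_def)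
  qed
qed

text \<open>An element of the kernel has the form \<open>?de\<close> tensor \<open>b2\<close> plus
  \<open>?dt\<close> tensor \<open>b\<close>. The differential maps the first summand onto the
  second up to sign, which makes the kernel contractible without any condition on
  \<open>B\<close>.\<close>

theorem horn_filling:
  assumes A: "semi_free A"
    and g: "\<And>i. i \<in> {0, 2, 3} \<Longrightarrow> g i \<in> dg_hom A (Cyl 2 B)"
    and comp: "\<And>i j a. i \<in> {0, 2, 3} \<Longrightarrow> j \<in> {0, 2, 3} \<Longrightarrow> i < j \<Longrightarrow> a \<in> carrier A \<Longrightarrow>
      Cyl_act B 1 (coface (j - 1)) (g i a) = Cyl_act B 1 (coface i) (g j a)"
  shows "\<exists>k\<in>dg_hom A (Cyl 3 B). \<forall>a\<in>carrier A. \<forall>i\<in>{0, 2, 3}. Cyl_act B 2 (coface i) (k a) = g i a"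
proof (rule semi_free_lifting[OF A])
  have dA: "dg_ring A" using A by (simp add: semi_free_def)
  then interpret A: dg_ring A .
  interpret C3: dg_ring "Cyl 3 B" by (rule dg_ring_Cyl)
  let ?J = "{0, 2, 3} :: nat set"
  have g': "dg_map A (Cyl 2 B) (g i)" if "i \<in> ?J" for i using g[OF that] by (simp add: dg_hom_iff)
  have mono: "monomap 2 3 (coface i)" if "i \<in> ?J" for i using monomap_coface[of 3 i] that by auto
  have g0: "g i \<zero>\<^bsub>A\<^esub> = \<zero>\<^bsub>Cyl 2 B\<^esub>" if "i \<in> ?J" for i
    using that by (intro dg_hom_pair.h_zero dg_hom_pair.intro dg_hom_pair_axioms.intro dA dg_ring_Cyl g')
  let ?\<rho> = "\<lambda>a c. \<forall>i\<in>?J. Cyl_act B 2 (coface i) c = g i a"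
  have corr: "dg_correspondence A (Cyl 3 B) ?\<rho>"
    by (intro dg_correspondence_Ball dg_correspondence_eq[of _ _ "Cyl 2 B"] dA dg_ring_Cyl)
      (simp_all only: g' dg_map_Cyl_act mono)
  let ?t = "top_simplex 3"
  let ?dt = "cyl.delta 3 ?t" and ?de = "cyl.delta 2 inner_face"
  have neq: "(2::nat, inner_face) \<noteq> (3, ?t)" by simp
  show "acyclic_correspondence A (Cyl 3 B) ?\<rho>"
  proof (intro acyclic_correspondence.intro acyclic_correspondence_axioms.intro corr)
    fix a m assume a: "a \<in> grade A m"
    have ac: "a \<in> carrier A" by (rule A.grade_carrier[OF a])
    \<comment> \<open>The values at the top simplex and at the missing face are unconstrained; zero
      is taken for both.\<close>
    have "\<exists>c\<in>grade (Cyl 3 B) m. (\<forall>i\<in>?J. Cyl_act B (3 - 1) (coface i) c = g i a) \<and>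
      (\<forall>p x. (p, x) \<in> cyl.nondeg 3 \<longrightarrow> ?J \<subseteq> x ` {0..p} \<longrightarrow> cyl.ev 3 p x c = (\<lambda>p x. \<zero>\<^bsub>B\<^esub>) p x)"
    proof (rule cochain_filler)
      show "g i a \<in> grade (Cyl (3 - 1) B) m" if "i \<in> ?J" for i
        using dg_mapD(1)[OF g'[OF that] a] by simp
      show "Cyl_act B (3 - 2) (coface (j - 1)) (g i a) = Cyl_act B (3 - 2) (coface i) (g j a)"
        if "i \<in> ?J" "j \<in> ?J" "i < j" for i j using comp[OF that ac] by simp
    qed (auto simp: B.zero_grade)
    then show "\<exists>c\<in>grade (Cyl 3 B) m. ?\<rho> a c" by auto
  next
    fix c m assume c: "c \<in> grade (Cyl 3 B) m" "dif (Cyl 3 B) c = \<zero>\<^bsub>Cyl 3 B\<^esub>" "?\<rho> \<zero>\<^bsub>A\<^esub> c"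
    note cc = C3.grade_carrier[OF c(1)]
    have z: "cyl.ev 3 p x c = \<zero>\<^bsub>B\<^esub>"
      if px: "(p, x) \<in> cyl.nondeg 3" and ne: "(p, x) \<notin> {(2, inner_face), (3, ?t)}" for p x
    proof -
      have x: "x \<in> simplices (std_simplex 3) p" using px by (rule nondeg_simplices)
      have "\<not> ?J \<subseteq> x ` {0..p}" using nondeg_horn[OF px] ne by blast
      then obtain i where i: "i \<in> ?J" "i \<notin> x ` {0..p}" by blast
      have y: "drop_vertex i p x \<in> simplices (std_simplex 2) p"
        using drop_vertex_closed[OF x _ _ i(2)] i(1) by auto
      have "cyl.ev 3 p x c = cyl.ev 2 p (drop_vertex i p x) (g i \<zero>\<^bsub>A\<^esub>)"
        using ev_Cyl_act[OF mono[OF i(1)] cc y] coface_drop_vertex[OF x i(2)] c(3) i(1) by metis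
      then show ?thesis using cyl.ev_zero[of 2] by (simp add: g0[OF i(1)] Cyl_tensor)
    qed
    define b where "b = cyl.ev 3 3 ?t c"
    define b2 where "b2 = cyl.ev 3 2 inner_face c"
    have b: "b \<in> grade B (m - 3)" and b2: "b2 \<in> grade B (m - 2)"
      unfolding b_def b2_def using cyl.ev_grade[OF c(1)[unfolded Cyl_tensor], of 3 ?t]
        cyl.ev_grade[OF c(1)[unfolded Cyl_tensor], of 2 inner_face] by simp_all
    note bc = B.grade_carrier[OF b] and b2c = B.grade_carrier[OF b2]
    note db = B.dif_closed[OF bc] and db2 = B.dif_closed[OF b2c]
    note ptt = cyl.pt_delta_closed[OF top_nondeg[of 3], folded Cyl_tensor]
      and pte = cyl.pt_delta_closed[OF inner_face_nondeg, folded Cyl_tensor]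
    have cb: "c = cyl.pt 3 ?de b2 \<oplus>\<^bsub>Cyl 3 B\<^esub> cyl.pt 3 ?dt b"
    proof -
      have "c = finsum (Cyl 3 B) (\<lambda>(p, x). cyl.pt 3 (cyl.delta p x) (cyl.ev 3 p x c)) {(2, inner_face), (3, ?t)}"
        unfolding Cyl_tensor using cc z top_nondeg[of 3] inner_face_nondeg
        by (intro cyl.support_expansion[OF finite_nondeg]) (auto simp: Cyl_tensor)
      also have "\<dots> = cyl.pt 3 ?de b2 \<oplus>\<^bsub>Cyl 3 B\<^esub> cyl.pt 3 ?dt b"
        using neq ptt[OF bc] pte[OF b2c] by (simp add: C3.finsum_insert b_def b2_def)
      finally show ?thesis .
    qed
    have dpe: "dif (Cyl 3 B) (cyl.pt 3 ?de r) = \<ominus>\<^bsub>Cyl 3 B\<^esub> cyl.pt 3 ?dt r \<oplus>\<^bsub>Cyl 3 B\<^esub> cyl.pt 3 ?de (dif B r)"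
      if r: "r \<in> carrier B" for r
    proof -
      have "dif (cochain_ring (std_simplex 3)) ?de = \<ominus>\<^bsub>cochain_ring (std_simplex 3)\<^esub> ?dt"
        by (simp add: dif_delta_inner_face std.C_uminus cyl.delta_cochain top_nondeg)
      then have "cyl.pt 3 (dif (cochain_ring (std_simplex 3)) ?de) r = \<ominus>\<^bsub>Cyl 3 B\<^esub> cyl.pt 3 ?dt r"
        using cyl.N.pt_uminus_left[OF delta_carrier[OF top_nondeg[of 3]] r] by (simp add: Cyl_tensor)
      then show ?thesis
        using cyl.N.dif_pure[OF cyl.delta_grade[OF inner_face_nondeg] r] pte[OF B.dif_closed[OF r]]
        by (simp add: Cyl_tensor[symmetric] C3.sign_cases)
    qed
    have dpt: "dif (Cyl 3 B) (cyl.pt 3 ?dt r) = \<ominus>\<^bsub>Cyl 3 B\<^esub> cyl.pt 3 ?dt (dif B r)" if r: "r \<in> carrier B" for r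
      using dif_pt_top[OF r, of 3] ptt[OF B.dif_closed[OF r]] by (simp add: C3.sign_cases)
    have evt: "cyl.ev 3 3 ?t (cyl.pt 3 ?dt r) = r" "cyl.ev 3 3 ?t (cyl.pt 3 ?de r) = \<zero>\<^bsub>B\<^esub>"
      if "r \<in> carrier B" for r
      using that cyl.ev_pure[OF cyl.delta_cochain[OF top_nondeg[of 3]] that, of 3 ?t]
        cyl.ev_pure[OF cyl.delta_cochain[OF inner_face_nondeg] that, of 3 ?t]
      by (simp_all add: cyl.delta_def B.add.int_pow_1 B.int_pow_zero)
    \<comment> \<open>The coefficient at the top simplex in the cocycle condition: \<open>b2\<close>
      arrives there through the missing face, \<open>dif B b\<close> through the top dual cochain
      itself, both with a minus sign.\<close>
    have b2_eq: "b2 = \<ominus>\<^bsub>B\<^esub> dif B b"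
    proof -
      have "\<zero>\<^bsub>Cyl 3 B\<^esub> = (\<ominus>\<^bsub>Cyl 3 B\<^esub> cyl.pt 3 ?dt b2 \<oplus>\<^bsub>Cyl 3 B\<^esub> cyl.pt 3 ?de (dif B b2)) \<oplus>\<^bsub>Cyl 3 B\<^esub>
          \<ominus>\<^bsub>Cyl 3 B\<^esub> cyl.pt 3 ?dt (dif B b)"
        using c(2) ptt[OF bc] pte[OF b2c] by (simp add: cb C3.dif_add dpe dpt bc b2c)
      also have "\<dots> = cyl.pt 3 ?dt (\<ominus>\<^bsub>B\<^esub> b2) \<oplus>\<^bsub>Cyl 3 B\<^esub> cyl.pt 3 ?de (dif B b2) \<oplus>\<^bsub>Cyl 3 B\<^esub>
          cyl.pt 3 ?dt (\<ominus>\<^bsub>B\<^esub> dif B b)"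
        using cyl.N.pt_uminus_right[OF delta_carrier[OF top_nondeg[of 3]]] b2c db by (simp add: Cyl_tensor)
      finally have "cyl.ev 3 3 ?t \<zero>\<^bsub>Cyl 3 B\<^esub> = cyl.ev 3 3 ?t (cyl.pt 3 ?dt (\<ominus>\<^bsub>B\<^esub> b2) \<oplus>\<^bsub>Cyl 3 B\<^esub> cyl.pt 3 ?de (dif B b2) \<oplus>\<^bsub>Cyl 3 B\<^esub>
          cyl.pt 3 ?dt (\<ominus>\<^bsub>B\<^esub> dif B b))" by simp
      also have "\<dots> = \<ominus>\<^bsub>B\<^esub> b2 \<ominus>\<^bsub>B\<^esub> dif B b"
        using ptt pte b2c db db2
        by (simp add: Cyl_tensor cyl.ev_add evt a_minus_def)
      finally have "\<ominus>\<^bsub>B\<^esub> b2 \<ominus>\<^bsub>B\<^esub> dif B b = \<zero>\<^bsub>B\<^esub>" using cyl.ev_zero[of 3] by (simp add: Cyl_tensor)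
      then have "\<ominus>\<^bsub>B\<^esub> (\<ominus>\<^bsub>B\<^esub> dif B b) = \<ominus>\<^bsub>B\<^esub> b2"
        unfolding a_minus_def using b2c db by (intro B.minus_equality) auto
      then show ?thesis using b2c db by (metis B.minus_minus)
    qed
    \<comment> \<open>The contraction moves the top coefficient to the missing face. Its
      differential has \<open>b\<close> at the top and, by the equation for \<open>b2\<close>, the
      right coefficient on the missing face.\<close>
    define c' where "c' = cyl.pt 3 ?de (\<ominus>\<^bsub>B\<^esub> b)"
    have c'g: "c' \<in> grade (Cyl 3 B) (m - 1)"
      unfolding c'_def using cyl.N.pt_grade[OF cyl.delta_grade[OF inner_face_nondeg] B.uminus_grade[OF b]]
      by (simp add: Cyl_tensor)
    have dc': "dif (Cyl 3 B) c' = c"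
    proof -
      have "dif (Cyl 3 B) c' = cyl.pt 3 ?dt b \<oplus>\<^bsub>Cyl 3 B\<^esub> cyl.pt 3 ?de b2"
        unfolding c'_def using bc cyl.N.pt_uminus_right[OF delta_carrier[OF top_nondeg[of 3]] bc] ptt[OF bc]
        by (simp add: dpe B.dif_uminus b2_eq Cyl_tensor[symmetric])
      then show ?thesis unfolding cb using ptt[OF bc] pte[OF b2c] by (simp add: C3.a_comm)
    qed
    note cc' = C3.grade_carrier[OF c'g]
    have "Cyl_act B 2 (coface i) c' = g i \<zero>\<^bsub>A\<^esub>" if i: "i \<in> ?J" for i
      unfolding g0[OF i]
    proof (rule Cyl_eqI)
      show "Cyl_act B 2 (coface i) c' \<in> carrier (Cyl 2 B)"
        by (rule dg_mapD(3)[OF dg_map_Cyl_act[OF mono[OF i]] cc'])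
      show "\<zero>\<^bsub>Cyl 2 B\<^esub> \<in> carrier (Cyl 2 B)" unfolding Cyl_tensor by simp
      fix p y assume "(p, y) \<in> cyl.nondeg 2"
      then have y: "y \<in> simplices (std_simplex 2) p" by (rule nondeg_simplices)
      have "(p, std_simplex_map (coface i) p y) \<noteq> (2, inner_face)"
      proof
        assume "(p, std_simplex_map (coface i) p y) = (2, inner_face)"
        then have "p = 2" "std_simplex_map (coface i) p y = inner_face" by blast+
        then have "std_simplex_map (coface i) p y ` {0..p} = {0, 2, 3}" by (simp only: inner_face_image)
        then show False using coface_misses[of i p y] i by auto
      qed
      then have "?de p (std_simplex_map (coface i) p y) = 0" by (auto simp: cyl.delta_def)
      then have "cyl.ev 3 p (std_simplex_map (coface i) p y) c' = \<zero>\<^bsub>B\<^esub>"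
        using cyl.ev_pure[OF cyl.delta_cochain[OF inner_face_nondeg] B.a_inv_closed[OF bc]]
        by (simp add: c'_def B.int_pow_zero)
      then show "cyl.ev 2 p y (Cyl_act B 2 (coface i) c') = cyl.ev 2 p y \<zero>\<^bsub>Cyl 2 B\<^esub>"
        using ev_Cyl_act[OF mono[OF i] cc' y] cyl.ev_zero[of 2 p y] by (simp add: Cyl_tensor)
    qed
    then show "\<exists>c'\<in>grade (Cyl 3 B) (m - 1). ?\<rho> \<zero>\<^bsub>A\<^esub> c' \<and> dif (Cyl 3 B) c' = c"
      using c'g dc' by blast
  qed
qed

end

section \<open>Cohomology classes and the kernel of a surjective quasi-isomorphism\<close>

context dg_ring
begin

definition coset :: "int \<Rightarrow> 'a \<Rightarrow> 'a set"
  where "coset i z = (dif A ` grade A (i - 1)) #>\<^bsub>add_monoid A\<^esub> z"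

lemma mem_coset: "b \<in> coset i z \<longleftrightarrow> (\<exists>y\<in>grade A (i - 1). b = dif A y \<oplus> z)"
  by (auto simp: coset_def r_coset_def)

lemma coset_self: "z \<in> carrier A \<Longrightarrow> z \<in> coset i z"
  unfolding mem_coset by (intro bexI[of _ \<zero>]) (auto simp: dif_zero zero_grade)

lemma coset_dif:
  assumes y: "y \<in> grade A (i - 1)" and z: "z \<in> carrier A"
  shows "coset i (dif A y \<oplus> z) = coset i z"
proof (intro Set.set_eqI iffI)
  note yc = grade_carrier[OF y]
  fix b
  {
    assume "b \<in> coset i (dif A y \<oplus> z)"
    then obtain x where x: "x \<in> grade A (i - 1)" "b = dif A x \<oplus> (dif A y \<oplus> z)" unfolding mem_coset by blast
    then have "b = dif A (x \<oplus> y) \<oplus> z"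
      using yc z grade_carrier[OF x(1)] by (simp add: dif_add dif_closed a_assoc)
    then show "b \<in> coset i z" using x y add_grade unfolding mem_coset by blast
  next
    assume "b \<in> coset i z"
    then obtain x where x: "x \<in> grade A (i - 1)" "b = dif A x \<oplus> z" unfolding mem_coset by blast
    have "b = dif A (x \<ominus> y) \<oplus> (dif A y \<oplus> z)"
      using yc z grade_carrier[OF x(1)] unfolding x(2)
      by (simp add: dif_minus) (simp add: a_minus_def a_assoc r_neg1 dif_closed)
    then show "b \<in> coset i (dif A y \<oplus> z)" using x y minus_grade unfolding mem_coset by blast
  }
qed

lemma cohomology_carrier:
  "carrier (cohomology A i) = coset i ` {a \<in> grade A i. dif A a = \<zero>}"
  by (auto simp: cohomology_def FactGroup_def RCOSETS_def coset_def r_coset_def)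

end

context dg_hom_pair
begin

lemma cohomology_map_coset:
  assumes z: "z \<in> carrier A"
  shows "cohomology_map B i h (A.coset i z) = B.coset i (h z)"
proof -
  have "B.coset i (h b) = B.coset i (h z)" if b: "b \<in> A.coset i z" for b
  proof -
    obtain y where y: "y \<in> grade A (i - 1)" "b = dif A y \<oplus>\<^bsub>A\<^esub> z" using b unfolding A.mem_coset by blast
    then have "h b = dif B (h y) \<oplus>\<^bsub>B\<^esub> h z"
      using z A.grade_carrier by (simp add: hD A.dif_closed)
    then show ?thesis using B.coset_dif[of "h y" i "h z"] y z by (simp add: hD)
  qed
  then show ?thesis unfolding cohomology_map_def B.coset_def[symmetric] using A.coset_self[OF z] by blast
qed

text \<open>Since \<open>h\<close> commutes with taking components, the component of degree
  \<open>i\<close> of any preimage is again a preimage.\<close>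

lemma graded_surj:
  assumes surj: "h ` carrier A = carrier B" and b: "b \<in> grade B i"
  shows "\<exists>a\<in>grade A i. h a = b"
proof -
  have "b \<in> h ` carrier A" using surj B.grade_carrier[OF b] by simp
  then obtain a where a: "a \<in> carrier A" "h a = b" by blast
  then have "h (hcomp A a i) = b" using h_hcomp[OF a(1)] B.hcomp_homogeneous[OF b] by (metis (full_types))
  then show ?thesis using A.hcomp_grade[OF a(1)] by blast
qed

text \<open>Injectivity in degree \<open>i\<close> writes \<open>a\<close> as the differential of
  some \<open>y\<close>. Then \<open>h y\<close> is a cocycle, and surjectivity in degree
  \<open>i - 1\<close> expresses it as the image of a cocycle \<open>z\<close> plus a coboundary.
  Lifting the coboundary through \<open>h\<close> and subtracting both corrections from
  \<open>y\<close> moves it into the kernel without changing its differential.\<close>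

lemma kernel_acyclic:
  assumes qi: "quasi_iso A B h" and surj: "h ` carrier A = carrier B"
    and a: "a \<in> grade A i" "dif A a = \<zero>\<^bsub>A\<^esub>" "h a = \<zero>\<^bsub>B\<^esub>"
  shows "\<exists>a'\<in>grade A (i - 1). h a' = \<zero>\<^bsub>B\<^esub> \<and> dif A a' = a"
proof -
  have bij: "bij_betw (cohomology_map B i h) (carrier (cohomology A i)) (carrier (cohomology B i))" for i
    using qi by (simp add: quasi_iso_def iso_def)
  note ac = A.grade_carrier[OF a(1)]
  have "cohomology_map B i h (A.coset i a) = cohomology_map B i h (A.coset i \<zero>\<^bsub>A\<^esub>)"
    using ac a(3) by (simp add: cohomology_map_coset h_zero)
  moreover have "A.coset i a \<in> carrier (cohomology A i)" "A.coset i \<zero>\<^bsub>A\<^esub> \<in> carrier (cohomology A i)"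
    unfolding A.cohomology_carrier using a A.zero_grade A.dif_zero by auto
  ultimately have "A.coset i a = A.coset i \<zero>\<^bsub>A\<^esub>"
    using bij[of i] unfolding bij_betw_def inj_on_def by blast
  then have "a \<in> A.coset i \<zero>\<^bsub>A\<^esub>" using A.coset_self[OF ac] by blast
  then obtain y where y: "y \<in> grade A (i - 1)" "a = dif A y"
    unfolding A.mem_coset using A.dif_closed A.grade_carrier by auto
  note yc = A.grade_carrier[OF y(1)]
  have "h y \<in> grade B (i - 1)" "dif B (h y) = \<zero>\<^bsub>B\<^esub>"
    using y a(3) hD(1)[OF y(1)] hD(2)[OF yc] by simp_all
  then have "B.coset (i - 1) (h y) \<in> carrier (cohomology B (i - 1))" unfolding B.cohomology_carrier by blast
  then obtain z where z: "z \<in> grade A (i - 1)" "dif A z = \<zero>\<^bsub>A\<^esub>"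
    "B.coset (i - 1) (h y) = cohomology_map B (i - 1) h (A.coset (i - 1) z)"
    using bij[of "i - 1"] unfolding bij_betw_def A.cohomology_carrier by blast
  note zc = A.grade_carrier[OF z(1)]
  have "h y \<in> B.coset (i - 1) (h z)"
    using z(3) B.coset_self[of "h y" "i - 1"] yc zc by (simp add: cohomology_map_coset hD)
  then obtain w where w: "w \<in> grade B (i - 1 - 1)" "h y = dif B w \<oplus>\<^bsub>B\<^esub> h z" unfolding B.mem_coset by blast
  obtain w' where w': "w' \<in> grade A (i - 1 - 1)" "h w' = w" using graded_surj[OF surj w(1)] by blast
  note wc = A.grade_carrier[OF w'(1)]
  have dw: "dif A w' \<in> grade A (i - 1)" using A.dif_grade[OF w'(1)] by simp
  let ?a = "y \<ominus>\<^bsub>A\<^esub> (dif A w' \<oplus>\<^bsub>A\<^esub> z)"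
  have "?a \<in> grade A (i - 1)" using y z dw by (intro A.minus_grade A.add_grade)
  moreover have "h ?a = \<zero>\<^bsub>B\<^esub>"
  proof -
    have "h ?a = h y \<ominus>\<^bsub>B\<^esub> (h (dif A w') \<oplus>\<^bsub>B\<^esub> h z)"
      using yc zc wc by (simp add: h_minus hD(4) A.dif_closed)
    also have "h (dif A w') \<oplus>\<^bsub>B\<^esub> h z = h y" using w(2) w'(2) hD(2)[OF wc] by simp
    finally show ?thesis using hD(3)[OF yc] by (simp add: a_minus_def B.r_neg)
  qed
  moreover have "dif A ?a = a"
    using yc zc wc y(2) z(2) by (simp add: A.dif_minus A.dif_add A.dif_closed A.dif_dif) (simp add: a_minus_def A.dif_closed)
  ultimately show ?thesis by blast
qed

end

section \<open>Fundamental groupoids along a fibration\<close>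

lemma mem_path_rel: "(g, g') \<in> path_rel S x y \<longleftrightarrow> g \<in> paths S x y \<and> g' \<in> paths S x y \<and>
    (\<exists>h \<in> simplices S 2. face S 2 0 h = degen S 0 0 y \<and> face S 2 1 h = g' \<and> face S 2 2 h = g)"
  by (simp add: path_rel_def)

context simplicial_set
begin

lemma face0_degen1: "g \<in> simplices X 1 \<Longrightarrow> face X 2 0 (degen X 1 1 g) = degen X 0 0 (face X 1 0 g)"
  unfolding face_def degen_def numeral_2_eq_2 by (auto simp: monomap_def intro!: act_act_eq)

lemma face_degen_vertex: "y \<in> simplices X 0 \<Longrightarrow> k \<le> 1 \<Longrightarrow> face X 1 k (degen X 0 0 y) = y"
  using face_degen_mid[of k 0 0 y] by (cases k) auto

lemma degen_vertex_path: "y \<in> simplices X 0 \<Longrightarrow> degen X 0 0 y \<in> paths X y y"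
  using degen_closed[of 0 0 y] face_degen_vertex[of y 0] face_degen_vertex[of y 1] by (simp add: paths_def)

lemma degen_degen_vertex:
  assumes "y \<in> simplices X 0" "k \<le> 2"
  shows "face X 2 k (degen X 1 1 (degen X 0 0 y)) = degen X 0 0 y"
proof -
  have s: "degen X 0 0 y \<in> simplices X 1" using degen_closed[of 0 0 y] assms by simp
  have "k = 0 \<or> k = 1 \<or> k = 2" using assms(2) by linarith
  then show ?thesis using s face0_degen1[OF s] face_degen_vertex[OF assms(1), of 0] face_degen_mid[of k 1 1, OF _ _ s]
    by (auto simp: numeral_2_eq_2)
qed

text \<open>The triangle is s_1 g: its faces 1 and 2 are \<open>g\<close>, and its face 0 is
  constant at \<open>y\<close>.\<close>

lemma path_rel_refl:
  assumes "g \<in> paths X x y" shows "(g, g) \<in> path_rel X x y"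
proof -
  have s: "g \<in> simplices X 1" "face X 1 0 g = y" using assms by (simp_all add: paths_def)
  have "degen X 1 1 g \<in> simplices X 2" using degen_closed[of 1 1 g] s(1) by (simp add: numeral_2_eq_2)
  moreover have "face X 2 1 (degen X 1 1 g) = g" "face X 2 2 (degen X 1 1 g) = g"
    using face_degen_mid[of 1 1 1 g] face_degen_mid[of 2 1 1 g] s(1) by (simp_all add: numeral_2_eq_2)
  ultimately show ?thesis using assms face0_degen1[OF s(1)] s(2) unfolding mem_path_rel by blast
qed

end

locale inner_horn_filling = simplicial_set T for T :: "'y sset" +
  assumes horn: "\<And>w0 w2 w3. w0 \<in> simplices T 2 \<Longrightarrow> w2 \<in> simplices T 2 \<Longrightarrow> w3 \<in> simplices T 2 \<Longrightarrow>
      face T 2 1 w0 = face T 2 0 w2 \<Longrightarrow> face T 2 2 w0 = face T 2 0 w3 \<Longrightarrow> face T 2 2 w2 = face T 2 2 w3 \<Longrightarrow>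
      \<exists>w\<in>simplices T 3. face T 3 0 w = w0 \<and> face T 3 2 w = w2 \<and> face T 3 3 w = w3"
begin

text \<open>Extracts from a filler the triangle opposite the vertex 1; its edges are determined by
  the simplicial identities.\<close>

lemma missing_face:
  assumes w: "w0 \<in> simplices T 2" "w2 \<in> simplices T 2" "w3 \<in> simplices T 2"
    "face T 2 1 w0 = face T 2 0 w2" "face T 2 2 w0 = face T 2 0 w3" "face T 2 2 w2 = face T 2 2 w3"
  shows "\<exists>w1\<in>simplices T 2. face T 2 0 w1 = face T 2 0 w0 \<and> face T 2 1 w1 = face T 2 1 w2 \<and> face T 2 2 w1 = face T 2 1 w3"
proof -
  obtain w where w': "w \<in> simplices T 3" "face T 3 0 w = w0" "face T 3 2 w = w2" "face T 3 3 w = w3"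
    using horn[OF w] by blast
  have "face T 3 1 w \<in> simplices T 2" using face_closed[of 3 1 w] w'(1) by simp
  moreover have "face T 2 0 (face T 3 1 w) = face T 2 0 w0"
    using face_face[of 0 1 3 w] w' by simp
  moreover have "face T 2 1 (face T 3 1 w) = face T 2 1 w2"
    using face_face[of 1 2 3 w] w' by simp
  moreover have "face T 2 2 (face T 3 1 w) = face T 2 1 w3"
    using face_face[of 1 3 3 w] w' by simp
  ultimately show ?thesis by blast
qed

text \<open>The 3-simplex has the edges \<open>a, b, c\<close> from the vertex 0 to the vertices 1, 2, 3, and constant
  edges between the vertices 1, 2, 3.\<close>

lemma path_rel_euclidean:
  assumes y: "y \<in> simplices T 0" and ab: "(a, b) \<in> path_rel T x y" and ac: "(a, c) \<in> path_rel T x y"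
  shows "(b, c) \<in> path_rel T x y"
proof -
  let ?c = "degen T 0 0 y"
  obtain w3 where w3: "w3 \<in> simplices T 2" "face T 2 0 w3 = ?c" "face T 2 1 w3 = b" "face T 2 2 w3 = a"
    using ab unfolding mem_path_rel by blast
  obtain w2 where w2: "w2 \<in> simplices T 2" "face T 2 0 w2 = ?c" "face T 2 1 w2 = c" "face T 2 2 w2 = a"
    using ac unfolding mem_path_rel by blast
  have w0: "degen T 1 1 ?c \<in> simplices T 2"
    using degen_closed[of 1 1 ?c] degen_closed[of 0 0 y] y by (simp add: numeral_2_eq_2)
  obtain w1 where "w1 \<in> simplices T 2" "face T 2 0 w1 = ?c" "face T 2 1 w1 = c" "face T 2 2 w1 = b"
    using missing_face[OF w0 w2(1) w3(1)] degen_degen_vertex[OF y] w2 w3 by auto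
  then show ?thesis using ab ac unfolding mem_path_rel by blast
qed

text \<open>A reflexive Euclidean relation is symmetric: apply the Euclidean property to (a, b) and
  (a, a).\<close>

lemma path_rel_sym: "y \<in> simplices T 0 \<Longrightarrow> (a, b) \<in> path_rel T x y \<Longrightarrow> (b, a) \<in> path_rel T x y"
  using path_rel_euclidean path_rel_refl unfolding mem_path_rel by blast

lemma path_rel_trans: "y \<in> simplices T 0 \<Longrightarrow> (a, b) \<in> path_rel T x y \<Longrightarrow> (b, c) \<in> path_rel T x y \<Longrightarrow> (a, c) \<in> path_rel T x y"
  using path_rel_euclidean path_rel_sym by blast

lemma path_rel_class_eq:
  assumes "y \<in> simplices T 0" "(a, b) \<in> path_rel T x y"
  shows "path_rel T x y `` {a} = path_rel T x y `` {b}"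
  using assms path_rel_trans path_rel_sym by blast

text \<open>In the 3-simplex with all vertices at \<open>z\<close>, \<open>h\<close> is the triangle
  on the vertices 0, 1, 2, and all edges to the vertex 3 are constant. The two null homotopies fill
  the triangles 1, 2, 3 and 0, 1, 3, so the remaining triangle 0, 2, 3 is a null homotopy of the
  composite.\<close>

lemma null_composite:
  assumes z: "z \<in> simplices T 0" and h: "h \<in> simplices T 2"
    and b: "(degen T 0 0 z, face T 2 0 h) \<in> path_rel T z z"
    and a: "(degen T 0 0 z, face T 2 2 h) \<in> path_rel T z z"
    and k: "face T 2 1 h \<in> paths T z z"
  shows "(degen T 0 0 z, face T 2 1 h) \<in> path_rel T z z"
proof -
  let ?c = "degen T 0 0 z"
  obtain w0 where w0: "w0 \<in> simplices T 2" "face T 2 0 w0 = ?c" "face T 2 1 w0 = ?c" "face T 2 2 w0 = face T 2 0 h"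
    using path_rel_sym[OF z b] unfolding mem_path_rel by blast
  obtain w2 where w2: "w2 \<in> simplices T 2" "face T 2 0 w2 = ?c" "face T 2 1 w2 = ?c" "face T 2 2 w2 = face T 2 2 h"
    using path_rel_sym[OF z a] unfolding mem_path_rel by blast
  obtain w1 where "w1 \<in> simplices T 2" "face T 2 0 w1 = ?c" "face T 2 1 w1 = ?c" "face T 2 2 w1 = face T 2 1 h"
    using missing_face[OF w0(1) w2(1) h] w0 w2 by auto
  then have "(face T 2 1 h, ?c) \<in> path_rel T z z"
    using k degen_vertex_path[OF z] unfolding mem_path_rel by blast
  then show ?thesis by (rule path_rel_sym[OF z])
qed

end

text \<open>A simplicial map with the right lifting property against the boundary inclusions in
  dimensions 1 and 2.\<close>

locale boundary_fibration = S: simplicial_set S + T: inner_horn_filling T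
  for S :: "'x sset" and T :: "'y sset" +
  fixes \<pi> :: "nat \<Rightarrow> 'x \<Rightarrow> 'y"
  assumes \<pi>_closed: "x \<in> simplices S n \<Longrightarrow> \<pi> n x \<in> simplices T n"
    and \<pi>_act: "monomap m n \<theta> \<Longrightarrow> x \<in> simplices S n \<Longrightarrow> \<pi> m (act S m n \<theta> x) = act T m n \<theta> (\<pi> n x)"
    and lift_edge: "x \<in> simplices S 0 \<Longrightarrow> y \<in> simplices S 0 \<Longrightarrow> h \<in> simplices T 1 \<Longrightarrow>
      face T 1 1 h = \<pi> 0 x \<Longrightarrow> face T 1 0 h = \<pi> 0 y \<Longrightarrow>
      \<exists>g\<in>simplices S 1. face S 1 1 g = x \<and> face S 1 0 g = y \<and> \<pi> 1 g = h"
    and lift_triangle: "g0 \<in> simplices S 1 \<Longrightarrow> g1 \<in> simplices S 1 \<Longrightarrow> g2 \<in> simplices S 1 \<Longrightarrow> h \<in> simplices T 2 \<Longrightarrow>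
      face S 1 0 g0 = face S 1 0 g1 \<Longrightarrow> face S 1 1 g0 = face S 1 0 g2 \<Longrightarrow> face S 1 1 g1 = face S 1 1 g2 \<Longrightarrow>
      face T 2 0 h = \<pi> 1 g0 \<Longrightarrow> face T 2 1 h = \<pi> 1 g1 \<Longrightarrow> face T 2 2 h = \<pi> 1 g2 \<Longrightarrow>
      \<exists>k\<in>simplices S 2. face S 2 0 k = g0 \<and> face S 2 1 k = g1 \<and> face S 2 2 k = g2"
begin

lemma \<pi>_face: "1 \<le> n \<Longrightarrow> i \<le> n \<Longrightarrow> x \<in> simplices S n \<Longrightarrow> \<pi> (n - 1) (face S n i x) = face T n i (\<pi> n x)"
  unfolding face_def by (rule \<pi>_act) (auto simp: monomap_def)

lemma \<pi>_degen: "i \<le> n \<Longrightarrow> x \<in> simplices S n \<Longrightarrow> \<pi> (n + 1) (degen S n i x) = degen T n i (\<pi> n x)"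
  unfolding degen_def by (rule \<pi>_act) (auto simp: monomap_def)

lemma \<pi>_path: "g \<in> paths S x y \<Longrightarrow> \<pi> 1 g \<in> paths T (\<pi> 0 x) (\<pi> 0 y)"
  using \<pi>_closed[of g 1] \<pi>_face[of 1 0 g] \<pi>_face[of 1 1 g] by (auto simp: paths_def)

text \<open>For the converse direction a homotopy in the base is lifted as a triangle with
  prescribed boundary. The homotopy relation on parallel paths in \<open>S\<close> is thus pulled
  back from \<open>T\<close>, along with its formal properties.\<close>

lemma path_rel_iff:
  assumes y: "y \<in> simplices S 0" and g: "g \<in> paths S x y" and g': "g' \<in> paths S x y"
  shows "(g, g') \<in> path_rel S x y \<longleftrightarrow> (\<pi> 1 g, \<pi> 1 g') \<in> path_rel T (\<pi> 0 x) (\<pi> 0 y)"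
proof
  assume "(g, g') \<in> path_rel S x y"
  then obtain h where h: "h \<in> simplices S 2" "face S 2 0 h = degen S 0 0 y" "face S 2 1 h = g'" "face S 2 2 h = g"
    unfolding mem_path_rel by blast
  then have "face T 2 0 (\<pi> 2 h) = degen T 0 0 (\<pi> 0 y)" "face T 2 1 (\<pi> 2 h) = \<pi> 1 g'" "face T 2 2 (\<pi> 2 h) = \<pi> 1 g"
    using \<pi>_face[of 2 0 h] \<pi>_face[of 2 1 h] \<pi>_face[of 2 2 h] \<pi>_degen[of 0 0 y] y by simp_all
  then show "(\<pi> 1 g, \<pi> 1 g') \<in> path_rel T (\<pi> 0 x) (\<pi> 0 y)"
    using \<pi>_path[OF g] \<pi>_path[OF g'] \<pi>_closed[OF h(1)] unfolding mem_path_rel by blast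
next
  assume "(\<pi> 1 g, \<pi> 1 g') \<in> path_rel T (\<pi> 0 x) (\<pi> 0 y)"
  then obtain h where h: "h \<in> simplices T 2" "face T 2 0 h = degen T 0 0 (\<pi> 0 y)"
    "face T 2 1 h = \<pi> 1 g'" "face T 2 2 h = \<pi> 1 g"
    unfolding mem_path_rel by blast
  have d: "degen S 0 0 y \<in> simplices S 1" "face S 1 0 (degen S 0 0 y) = y" "face S 1 1 (degen S 0 0 y) = y"
    using S.degen_vertex_path[OF y] by (simp_all add: paths_def)
  have "\<exists>k\<in>simplices S 2. face S 2 0 k = degen S 0 0 y \<and> face S 2 1 k = g' \<and> face S 2 2 k = g"
    using g g' h d \<pi>_degen[of 0 0 y] y by (intro lift_triangle[of _ _ _ h]) (auto simp: paths_def)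
  then show "(g, g') \<in> path_rel S x y" using g g' unfolding mem_path_rel by blast
qed

context
  fixes z
  assumes z: "z \<in> simplices T 0"
begin

definition "fiber = {x \<in> simplices S 0. \<pi> 0 x = z}"
text \<open>A candidate defined without choosing a representative: being the full set of paths, it
  can be compared directly with \<open>pi_comp\<close>, which also returns all
  representatives.\<close>

definition "null x y = {g \<in> paths S x y. (degen T 0 0 z, \<pi> 1 g) \<in> path_rel T z z}"

lemma null_nonempty:
  assumes "x \<in> fiber" "y \<in> fiber" obtains g where "g \<in> null x y" "\<pi> 1 g = degen T 0 0 z"
proof -
  note d = T.degen_vertex_path[OF z]
  obtain g where g: "g \<in> simplices S 1" "face S 1 1 g = x" "face S 1 0 g = y" "\<pi> 1 g = degen T 0 0 z"
    using lift_edge[of x y "degen T 0 0 z"] assms d by (auto simp: fiber_def paths_def)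
  then have "g \<in> null x y" using T.path_rel_refl[OF d] by (simp add: null_def paths_def)
  then show ?thesis using that g(4) by blast
qed

lemma null_class:
  assumes x: "x \<in> fiber" and y: "y \<in> fiber" and g: "g \<in> null x y"
  shows "path_rel S x y `` {g} = null x y"
proof -
  have fx: "\<pi> 0 x = z" "\<pi> 0 y = z" "y \<in> simplices S 0" using x y by (auto simp: fiber_def)
  have iff: "(g, g') \<in> path_rel S x y \<longleftrightarrow> g' \<in> null x y" for g'
  proof (cases "g' \<in> paths S x y")
    case True
    have gp: "g \<in> paths S x y" "(degen T 0 0 z, \<pi> 1 g) \<in> path_rel T z z" using g by (auto simp: null_def)
    have "(g, g') \<in> path_rel S x y \<longleftrightarrow> (\<pi> 1 g, \<pi> 1 g') \<in> path_rel T z z"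
      using path_rel_iff[OF fx(3) gp(1) True] fx by simp
    also have "\<dots> \<longleftrightarrow> (degen T 0 0 z, \<pi> 1 g') \<in> path_rel T z z"
      using T.path_rel_trans[OF z gp(2)] T.path_rel_euclidean[OF z gp(2)] by blast
    finally show ?thesis using True by (simp add: null_def)
  qed (auto simp: mem_path_rel null_def)
  then show ?thesis by blast
qed

lemma null_pi_hom: "x \<in> fiber \<Longrightarrow> y \<in> fiber \<Longrightarrow> null x y \<in> pi_hom S x y"
proof -
  assume xy: "x \<in> fiber" "y \<in> fiber"
  obtain g where g: "g \<in> null x y" using null_nonempty[OF xy] by blast
  then have "g \<in> paths S x y" by (simp add: null_def)
  then show ?thesis unfolding pi_hom_def null_class[OF xy g, symmetric] by (rule quotientI)
qed

lemma pi_map_null: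
  assumes xy: "x \<in> fiber" "y \<in> fiber"
  shows "pi_map T \<pi> x y (null x y) = pi_id T z"
proof -
  have fx: "\<pi> 0 x = z" "\<pi> 0 y = z" using xy by (auto simp: fiber_def)
  obtain g where g: "g \<in> null x y" using null_nonempty[OF xy] by blast
  have "path_rel T z z `` {\<pi> 1 g} = path_rel T z z `` {degen T 0 0 z}" if "g \<in> null x y" for g
    using T.path_rel_class_eq[OF z] that by (auto simp: null_def)
  then show ?thesis using g unfolding pi_map_def pi_id_def fx by blast
qed

text \<open>The image of any representative belongs to the class that \<open>pi_map\<close>
  produces, here the class of the constant loop, so the representative is a member of
  \<open>null x y\<close>.\<close>

lemma null_unique:
  assumes xy: "x \<in> fiber" "y \<in> fiber" and \<gamma>: "\<gamma> \<in> pi_hom S x y"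
    and id: "pi_map T \<pi> x y \<gamma> = pi_id T z"
  shows "\<gamma> = null x y"
proof -
  have fx: "\<pi> 0 x = z" "\<pi> 0 y = z" using xy by (auto simp: fiber_def)
  obtain g where g: "g \<in> paths S x y" "\<gamma> = path_rel S x y `` {g}"
    using \<gamma> unfolding pi_hom_def by (rule quotientE)
  have "g \<in> \<gamma>" using S.path_rel_refl[OF g(1)] g(2) by blast
  moreover have "\<pi> 1 g \<in> path_rel T z z `` {\<pi> 1 g}"
    using T.path_rel_refl[OF \<pi>_path[OF g(1)]] fx by simp
  ultimately have "\<pi> 1 g \<in> pi_map T \<pi> x y \<gamma>" unfolding pi_map_def fx by blast
  then have "(degen T 0 0 z, \<pi> 1 g) \<in> path_rel T z z" unfolding id pi_id_def by blast
  then have "g \<in> null x y" using g(1) by (simp add: null_def)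
  then show ?thesis using null_class[OF xy] g(2) by blast
qed

lemma null_id:
  assumes x: "x \<in> fiber" shows "null x x = pi_id S x"
proof -
  have fx: "\<pi> 0 x = z" "x \<in> simplices S 0" using x by (auto simp: fiber_def)
  have "degen S 0 0 x \<in> null x x"
    using S.degen_vertex_path[OF fx(2)] \<pi>_degen[of 0 0 x] fx T.path_rel_refl[OF T.degen_vertex_path[OF z]]
    by (simp add: null_def)
  from null_class[OF x x this] show ?thesis unfolding pi_id_def by simp
qed

text \<open>A composite of null paths is null by \<open>null_composite\<close> in the base.
  Conversely every null path \<open>k\<close> is the long edge of a triangle over a null homotopy of
  its image, with short edges over the constant loop.\<close>

lemma null_comp:
  assumes x: "x \<in> fiber" and y: "y \<in> fiber" and w: "w \<in> fiber"
  shows "pi_comp S (null y w) (null x y) = null x w"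
proof (intro Set.set_eqI iffI)
  fix k assume "k \<in> pi_comp S (null y w) (null x y)"
  then obtain h where h: "h \<in> simplices S 2" "face S 2 0 h \<in> null y w" "face S 2 1 h = k" "face S 2 2 h \<in> null x y"
    unfolding pi_comp_def by blast
  have k1: "k \<in> simplices S 1" using S.face_closed[of 2 1 h] h by simp
  moreover have "face S 1 1 k = x"
    using S.face_face[of 1 2 2 h] h by (simp add: null_def paths_def)
  moreover have "face S 1 0 k = w"
    using S.face_face[of 0 1 2 h] h by (simp add: null_def paths_def)
  ultimately have kp: "k \<in> paths S x w" by (simp add: paths_def)
  have fx: "\<pi> 0 x = z" "\<pi> 0 w = z" using x w by (auto simp: fiber_def)
  have \<pi>h: "face T 2 0 (\<pi> 2 h) = \<pi> 1 (face S 2 0 h)" "face T 2 1 (\<pi> 2 h) = \<pi> 1 k" "face T 2 2 (\<pi> 2 h) = \<pi> 1 (face S 2 2 h)"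
    using \<pi>_face[of 2 0 h] \<pi>_face[of 2 1 h] \<pi>_face[of 2 2 h] h by simp_all
  have "\<pi> 1 k \<in> paths T z z" using \<pi>_path[OF kp] unfolding fx .
  then have "(degen T 0 0 z, \<pi> 1 k) \<in> path_rel T z z"
    using T.null_composite[OF z \<pi>_closed[OF h(1)], unfolded \<pi>h] h(2,4) unfolding null_def by blast
  then show "k \<in> null x w" using kp unfolding null_def by blast
next
  fix k assume k: "k \<in> null x w"
  obtain a where a: "a \<in> null x y" "\<pi> 1 a = degen T 0 0 z" by (rule null_nonempty[OF x y])
  obtain b where b: "b \<in> null y w" "\<pi> 1 b = degen T 0 0 z" by (rule null_nonempty[OF y w])
  \<comment> \<open>The witness that the image of \<open>k\<close> is null homotopic doubles as a
    composition triangle: its faces 0 and 2 are constant, as are the images of \<open>b\<close> and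
    \<open>a\<close>.\<close>
  obtain h where h: "h \<in> simplices T 2" "face T 2 0 h = degen T 0 0 z" "face T 2 1 h = \<pi> 1 k" "face T 2 2 h = degen T 0 0 z"
    using k unfolding null_def mem_Collect_eq mem_path_rel by blast
  have "\<exists>t\<in>simplices S 2. face S 2 0 t = b \<and> face S 2 1 t = k \<and> face S 2 2 t = a"
    using a b k h by (intro lift_triangle[of _ _ _ h]) (auto simp: null_def paths_def)
  then show "k \<in> pi_comp S (null y w) (null x y)" using a b unfolding pi_comp_def by blast
qed

lemma null_pi_iso:
  assumes "x \<in> fiber" "y \<in> fiber" shows "pi_iso S x y (null x y)"
  unfolding pi_iso_def
proof (intro conjI bexI)
  show "pi_comp S (null y x) (null x y) = pi_id S x" "pi_comp S (null x y) (null y x) = pi_id S y"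
    using assms by (simp_all add: null_comp null_id)
qed (use assms in \<open>simp_all add: null_pi_hom\<close>)

lemma null_characterization:
  assumes "x \<in> fiber" "y \<in> fiber"
  shows "pi_iso S x y \<gamma> \<and> pi_map T \<pi> x y \<gamma> = pi_id T z \<longleftrightarrow> \<gamma> = null x y"
proof
  assume *: "pi_iso S x y \<gamma> \<and> pi_map T \<pi> x y \<gamma> = pi_id T z"
  then have "\<gamma> \<in> pi_hom S x y" by (simp add: pi_iso_def)
  then show "\<gamma> = null x y" using * by (intro null_unique[OF assms]) simp_all
qed (use null_pi_iso[OF assms] pi_map_null[OF assms] in simp)

end

end

section \<open>Transfer to the simplicial sets of homomorphisms\<close>

lemma face_SHom: "face (SHom A B) n i g = compose (carrier A) (Cyl_act B (n - 1) (coface i)) g"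
  by (simp add: face_def SHom_def)

lemma face_SHom_apply: "a \<in> carrier A \<Longrightarrow> face (SHom A B) n i g a = Cyl_act B (n - 1) (coface i) (g a)"
  by (simp add: face_SHom compose_def)

lemma SHom_map_apply: "a \<in> carrier A \<Longrightarrow> SHom_map A B v n g a = Cyl_map B v n (g a)"
  by (simp add: SHom_map_def compose_def)

lemma dg_hom_eqI:
  assumes "f \<in> extensional (carrier A)" "g \<in> dg_hom A B" "\<And>a. a \<in> carrier A \<Longrightarrow> f a = g a"
  shows "f = g"
  using assms by (intro extensionalityI[of f "carrier A"]) (auto simp: dg_hom_iff)

lemma (in cylinders) inner_horn_filling_SHom:
  assumes A: "semi_free A" shows "inner_horn_filling (SHom A B)"
proof (intro inner_horn_filling.intro inner_horn_filling_axioms.intro)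
  show "simplicial_set (SHom A B)" using A by (intro simplicial_set_SHom) (simp add: semi_free_def)
  let ?T = "SHom A B"
  fix w0 w2 w3
  assume w: "w0 \<in> simplices ?T 2" "w2 \<in> simplices ?T 2" "w3 \<in> simplices ?T 2"
    "face ?T 2 1 w0 = face ?T 2 0 w2" "face ?T 2 2 w0 = face ?T 2 0 w3" "face ?T 2 2 w2 = face ?T 2 2 w3"
  define g where "g i = (if i = 0 then w0 else if i = 2 then w2 else w3)" for i :: nat
  have "\<exists>k\<in>dg_hom A (Cyl 3 B). \<forall>a\<in>carrier A. \<forall>i\<in>{0, 2, 3}. Cyl_act B 2 (coface i) (k a) = g i a"
  proof (rule horn_filling[OF A])
    show "g i \<in> dg_hom A (Cyl 2 B)" if "i \<in> {0, 2, 3}" for i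
      using w(1-3) by (simp add: g_def SHom_simps)
    fix i j a assume ij: "i \<in> {0, 2, 3}" "j \<in> {0, 2, 3}" "i < (j::nat)" and a: "a \<in> carrier A"
    have f: "Cyl_act B 1 (coface k) (w a) = face ?T 2 k w a" for k w
      using a by (simp add: face_SHom_apply)
    have "i = 0 \<and> j = 2 \<or> i = 0 \<and> j = 3 \<or> i = 2 \<and> j = 3" using ij by auto
    then show "Cyl_act B 1 (coface (j - 1)) (g i a) = Cyl_act B 1 (coface i) (g j a)"
      unfolding f using w(4-6) by (elim disjE) (simp_all add: g_def)
  qed
  then obtain k where k: "k \<in> dg_hom A (Cyl 3 B)"
    "\<And>a i. a \<in> carrier A \<Longrightarrow> i \<in> {0, 2, 3} \<Longrightarrow> Cyl_act B 2 (coface i) (k a) = g i a" by blast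
  have f: "face ?T 3 i k = g i" if i: "i \<in> {0, 2, 3}" for i
  proof (rule dg_hom_eqI)
    show "face ?T 3 i k \<in> extensional (carrier A)" by (simp add: face_SHom)
    show "g i \<in> dg_hom A (Cyl 2 B)" using w(1-3) by (simp add: g_def SHom_simps)
    show "face ?T 3 i k a = g i a" if "a \<in> carrier A" for a
      using k(2)[OF that i] that by (simp add: face_SHom_apply)
  qed
  show "\<exists>w\<in>simplices ?T 3. face ?T 3 0 w = w0 \<and> face ?T 3 2 w = w2 \<and> face ?T 3 3 w = w3"
    using k(1) f[of 0] f[of 2] f[of 3] by (intro bexI[of _ k]) (simp_all add: g_def SHom_simps)
qed

text \<open>Members of \<open>dg_hom\<close> are extensional, so the pointwise identities of
  \<open>boundary_lifting\<close> are identities of simplices.\<close>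

lemma (in acyclic_fibration) SHom_boundary_lifting:
  assumes A: "semi_free A" and n: "1 \<le> n"
    and g: "\<And>i. i \<le> n \<Longrightarrow> g i \<in> simplices (SHom A B') (n - 1)" and h: "h \<in> simplices (SHom A B) n"
    and comp: "\<And>i j. i < j \<Longrightarrow> j \<le> n \<Longrightarrow> 2 \<le> n \<Longrightarrow>
      face (SHom A B') (n - 1) (j - 1) (g i) = face (SHom A B') (n - 1) i (g j)"
    and comp_v: "\<And>i. i \<le> n \<Longrightarrow> face (SHom A B) n i h = SHom_map A B v (n - 1) (g i)"
  shows "\<exists>k\<in>simplices (SHom A B') n. (\<forall>i\<le>n. face (SHom A B') n i k = g i) \<and> SHom_map A B v n k = h"
proof -
  note gd = g[unfolded S.SHom_simps] and hd = h[unfolded T.SHom_simps]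
  have "\<exists>k\<in>dg_hom A (Cyl n B'). \<forall>a\<in>carrier A.
    (\<forall>i\<in>{..n}. Cyl_act B' (n - 1) (coface i) (k a) = g i a) \<and> Cyl_map B v n (k a) = h a"
  proof (rule boundary_lifting[OF A n gd hd])
    fix i j a assume ij: "i < j" "j \<le> n" "2 \<le> n" and a: "a \<in> carrier A"
    have "n - 1 - 1 = n - 2" by simp
    then show "Cyl_act B' (n - 2) (coface (j - 1)) (g i a) = Cyl_act B' (n - 2) (coface i) (g j a)"
      using fun_cong[OF comp[OF ij], of a] by (simp only: face_SHom_apply[OF a])
  next
    fix i a assume i: "i \<le> n" and a: "a \<in> carrier A"
    show "Cyl_map B v (n - 1) (g i a) = Cyl_act B (n - 1) (coface i) (h a)"
      using fun_cong[OF comp_v[OF i], of a] unfolding face_SHom_apply[OF a] SHom_map_apply[OF a] by (rule sym)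
  qed
  then obtain k where k: "k \<in> dg_hom A (Cyl n B')"
    "\<And>a i. a \<in> carrier A \<Longrightarrow> i \<le> n \<Longrightarrow> Cyl_act B' (n - 1) (coface i) (k a) = g i a"
    "\<And>a. a \<in> carrier A \<Longrightarrow> Cyl_map B v n (k a) = h a" by blast
  have "face (SHom A B') n i k = g i" if i: "i \<le> n" for i
    by (rule dg_hom_eqI[OF _ gd[OF i]]) (use k(2)[OF _ i] in \<open>simp_all add: face_SHom compose_def\<close>)
  moreover have "SHom_map A B v n k = h"
    by (rule dg_hom_eqI[OF _ hd]) (use k(3) in \<open>simp_all add: SHom_map_def compose_def\<close>)
  ultimately show ?thesis using k(1) unfolding S.SHom_simps by blast
qed

lemma (in acyclic_fibration) boundary_fibration_SHom:
  assumes A: "semi_free A"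
  shows "boundary_fibration (SHom A B') (SHom A B) (SHom_map A B v)"
proof (intro boundary_fibration.intro boundary_fibration_axioms.intro)
  have dA: "dg_ring A" using A by (simp add: semi_free_def)
  show "simplicial_set (SHom A B')" by (rule S.simplicial_set_SHom[OF dA])
  show "inner_horn_filling (SHom A B)" by (rule T.inner_horn_filling_SHom[OF A])
  let ?S = "SHom A B'" and ?T = "SHom A B"
  fix n x assume "x \<in> simplices ?S n"
  then have "x \<in> dg_hom A (Cyl n B')" unfolding S.SHom_simps .
  from dg_ring.dg_hom_compose[OF dA this dg_map_Cyl_map]
  show "SHom_map A B v n x \<in> simplices ?T n" unfolding T.SHom_simps SHom_map_def .
next
  fix m n \<theta> x assume \<theta>: "monomap m n \<theta>" and "x \<in> simplices (SHom A B') n"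
  then have x: "dg_map A (Cyl n B') x" unfolding S.SHom_simps dg_hom_iff by blast
  have "Cyl_map B v m (Cyl_act B' m \<theta> (x a)) = Cyl_act B m \<theta> (Cyl_map B v n (x a))" if "a \<in> carrier A" for a
    by (rule Cyl_map_act[OF \<theta> dg_mapD(3)[OF x that]])
  then show "SHom_map A B v m (act (SHom A B') m n \<theta> x) = act (SHom A B) m n \<theta> (SHom_map A B v n x)"
    unfolding SHom_map_def S.SHom_simps T.SHom_simps compose_def
    by (intro restrict_ext) simp
next
  let ?S = "SHom A B'" and ?T = "SHom A B"
  fix x y h assume xy: "x \<in> simplices ?S 0" "y \<in> simplices ?S 0" and h: "h \<in> simplices ?T 1"
    "face ?T 1 1 h = SHom_map A B v 0 x" "face ?T 1 0 h = SHom_map A B v 0 y"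
  define g where "g i = (if i = 0 then y else x)" for i :: nat
  have "\<exists>k\<in>simplices ?S 1. (\<forall>i\<le>1. face ?S 1 i k = g i) \<and> SHom_map A B v 1 k = h"
  proof (rule SHom_boundary_lifting[OF A order_refl _ h(1)])
    fix i :: nat assume "i \<le> 1"
    then have "i = 0 \<or> i = 1" by linarith
    then show "face ?T 1 i h = SHom_map A B v (1 - 1) (g i)"
      using h by (elim disjE) (simp_all add: g_def)
  qed (use xy in \<open>simp_all add: g_def\<close>)
  then obtain k where k: "k \<in> simplices ?S 1" "\<And>i. i \<le> 1 \<Longrightarrow> face ?S 1 i k = g i" "SHom_map A B v 1 k = h"
    by blast
  then show "\<exists>g\<in>simplices ?S 1. face ?S 1 1 g = x \<and> face ?S 1 0 g = y \<and> SHom_map A B v 1 g = h"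
    using k(2)[of 0] k(2)[of 1] by (intro bexI[of _ k]) (simp_all add: g_def)
next
  let ?S = "SHom A B'" and ?T = "SHom A B"
  fix g0 g1 g2 h
  assume gs: "g0 \<in> simplices ?S 1" "g1 \<in> simplices ?S 1" "g2 \<in> simplices ?S 1" and h1: "h \<in> simplices ?T 2"
    and comp: "face ?S 1 0 g0 = face ?S 1 0 g1" "face ?S 1 1 g0 = face ?S 1 0 g2" "face ?S 1 1 g1 = face ?S 1 1 g2"
    and h: "face ?T 2 0 h = SHom_map A B v 1 g0" "face ?T 2 1 h = SHom_map A B v 1 g1" "face ?T 2 2 h = SHom_map A B v 1 g2"
  define g where "g i = (if i = 0 then g0 else if i = 1 then g1 else g2)" for i :: nat
  have "\<exists>k\<in>simplices ?S 2. (\<forall>i\<le>2. face ?S 2 i k = g i) \<and> SHom_map A B v 2 k = h"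
  proof (rule SHom_boundary_lifting[OF A _ _ h1])
    fix i :: nat assume "i \<le> 2"
    then have "i = 0 \<or> i = 1 \<or> i = 2" by linarith
    then show "face ?T 2 i h = SHom_map A B v (2 - 1) (g i)"
      using h by (elim disjE) (simp_all add: g_def)
  next
    fix i j assume "i < j" "j \<le> (2::nat)"
    then have "i = 0 \<and> j = 1 \<or> i = 0 \<and> j = 2 \<or> i = 1 \<and> j = 2" by linarith
    then show "face ?S (2 - 1) (j - 1) (g i) = face ?S (2 - 1) i (g j)"
      using comp by (elim disjE) (simp_all add: g_def)
  qed (use gs in \<open>simp_all add: g_def\<close>)
  then obtain k where k: "k \<in> simplices ?S 2" "\<And>i. i \<le> 2 \<Longrightarrow> face ?S 2 i k = g i"
    by blast
  then show "\<exists>k\<in>simplices ?S 2. face ?S 2 0 k = g0 \<and> face ?S 2 1 k = g1 \<and> face ?S 2 2 k = g2"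
    using k(2)[of 0] k(2)[of 1] k(2)[of 2] by (intro bexI[of _ k]) (simp_all add: g_def)
qed

lemma (in cylinders) SHom_obj_closed:
  assumes "dg_ring A" "f \<in> dg_hom A B"
  shows "SHom_obj A B f \<in> simplices (SHom A B) 0"
  unfolding SHom_obj_def SHom_simps Cyl_tensor
  by (rule dg_ring.dg_hom_compose[OF assms cyl.N.dg_map_pure_one])

lemma (in acyclic_fibration) SHom_map_obj:
  assumes f: "f' \<in> dg_hom A B'" and eq: "\<And>a. a \<in> carrier A \<Longrightarrow> v (f' a) = f a"
  shows "SHom_map A B v 0 (SHom_obj A B' f') = SHom_obj A B f"
proof -
  have "f' a \<in> carrier B'" if "a \<in> carrier A" for a using f dg_mapD(3)[of A B' f' a] that by (simp add: dg_hom_iff)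
  then show ?thesis
    unfolding SHom_map_def SHom_obj_def compose_def
    by (intro restrict_ext) (simp add: Cyl_map_pure eq)
qed

theorem theorem0p8:
  fixes A :: "'a dg_ring" and B :: "'b dg_ring"
    and A' :: "'c dg_ring" and B' :: "'d dg_ring"
    and f :: "'a \<Rightarrow> 'b" and u :: "'c \<Rightarrow> 'a" and v :: "'d \<Rightarrow> 'b"
    and I :: "'i set" and f' :: "'i \<Rightarrow> 'c \<Rightarrow> 'd"
  assumes "dg_ring A" and "dg_ring B" and "f \<in> dg_hom A B"
    and "semi_free_resolution A' A u" and "semi_free_resolution B' B v"
    and "f' ` I = liftings A' B' u v f"
  defines "g \<equiv> \<lambda>i j. distinguished_iso A' B' B u v f (f' i) (f' j)"
  shows "(\<forall>i\<in>I. \<forall>j\<in>I. \<exists>!\<gamma>. distinguished A' B' B u v f (f' i) (f' j) \<gamma>) \<and>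
    (\<forall>i\<in>I. \<forall>j\<in>I. \<forall>k\<in>I. pi_comp (SHom A' B') (g j k) (g i j) = g i k) \<and>
    (\<forall>i\<in>I. g i i = pi_id (SHom A' B') (SHom_obj A' B' (f' i)))"
proof -
  have A': "semi_free A'" "dg_ring A'" using assms(4) by (auto simp: semi_free_resolution_def semi_free_def)
  have B': "dg_ring B'" and v: "v \<in> dg_hom B' B" and v_qi: "quasi_iso B' B v" and v_surj: "v ` carrier B' = carrier B"
    using assms(5) by (auto simp: semi_free_resolution_def semi_free_def quasi_iso_def)
  have u: "u \<in> dg_hom A' A" using assms(4) by (simp add: semi_free_resolution_def quasi_iso_def)
  interpret v: dg_hom_pair B' B v
    using B' assms(2) v by (intro dg_hom_pair.intro dg_hom_pair_axioms.intro) (simp_all add: dg_hom_iff)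
  interpret V: acyclic_fibration B' B v
    by (intro acyclic_fibration.intro acyclic_fibration_axioms.intro cylinders.intro B' assms(2) v.h
        v.graded_surj[OF v_surj] v.kernel_acyclic[OF v_qi v_surj])
  interpret P: boundary_fibration "SHom A' B'" "SHom A' B" "SHom_map A' B v"
    by (rule V.boundary_fibration_SHom[OF A'(1)])
  \<comment> \<open>The common image of all liftings: each \<open>f' i\<close> gives a vertex of the
    fibre of \<open>SHom_map A' B v\<close> over \<open>z\<close>.\<close>
  define z where "z = SHom_obj A' B (compose (carrier A') f u)"
  have "compose (carrier A') f u \<in> dg_hom A' B"
    using assms(3) by (intro dg_ring.dg_hom_compose[OF A'(2) u]) (simp add: dg_hom_iff)
  then have z: "z \<in> simplices (SHom A' B) 0" unfolding z_def by (rule V.T.SHom_obj_closed[OF A'(2)])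
  define x where "x i = SHom_obj A' B' (f' i)" for i
  have x: "x i \<in> P.fiber z" if "i \<in> I" for i
  proof -
    have l: "f' i \<in> dg_hom A' B'" "compose (carrier A') v (f' i) = compose (carrier A') f u"
      using assms(6) that by (auto simp: liftings_def)
    have "v (f' i a) = compose (carrier A') f u a" if "a \<in> carrier A'" for a
      using fun_cong[OF l(2), of a] that by (simp add: compose_def)
    from V.SHom_map_obj[OF l(1) this] have "SHom_map A' B v 0 (x i) = z"
      unfolding x_def z_def .
    moreover have "x i \<in> simplices (SHom A' B') 0"
      unfolding x_def by (rule V.S.SHom_obj_closed[OF A'(2) l(1)])
    ultimately show ?thesis unfolding P.fiber_def[OF z] by blast
  qed
  \<comment> \<open>The identification with one explicit set gives existence and uniqueness at once
    and turns the composition laws into those for \<open>null\<close>.\<close>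
  have dist: "distinguished A' B' B u v f (f' i) (f' j) \<gamma> \<longleftrightarrow> \<gamma> = P.null z (x i) (x j)"
    if "i \<in> I" "j \<in> I" for i j \<gamma>
    unfolding distinguished_def x_def[symmetric] z_def[symmetric]
    by (rule P.null_characterization[OF z x[OF that(1)] x[OF that(2)]])
  have g: "g i j = P.null z (x i) (x j)" if "i \<in> I" "j \<in> I" for i j
    unfolding g_def distinguished_iso_def dist[OF that] by simp
  show ?thesis
    unfolding x_def[symmetric]
  proof (intro conjI ballI)
    show "\<exists>!\<gamma>. distinguished A' B' B u v f (f' i) (f' j) \<gamma>" if "i \<in> I" "j \<in> I" for i j
      unfolding dist[OF that] by simp
    show "pi_comp (SHom A' B') (g j k) (g i j) = g i k" if "i \<in> I" "j \<in> I" "k \<in> I" for i j k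
      using that by (simp add: g P.null_comp[OF z x x x])
    show "g i i = pi_id (SHom A' B') (x i)" if "i \<in> I" for i
      using that by (simp add: g P.null_id[OF z x])
  qed
qed

end
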